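(* Let $((\mathbf{X}^n_k,\mathcal{T}^n_k))_{k\ge 0}$ be the free path Markov chain, with transition operator $Q_n$. Let $$\mu_n(\mathbf{x},t) := n\,\mathbb{E}\left[(\mathbf{X}^n_1,\mathcal{T}^n_1)-(\mathbf{x},t)\mid (\mathbf{X}^n_0,\mathcal{T}^n_0)=(\mathbf{x},t)\right]$$ be its scaled drift, and let $S$ be a compact subset of $\mathcal{D}^\circ$. Then $$\lim_{n\to\infty}\ \sup_{(\mathbf{x},t):\,\|\mathbf{x}\|\in S,\ t\ge 0}\left|\mu_n(\mathbf{x},t)-\left(\frac{-1}{3g(\mathbf{x})^2}\left[\frac{2\nabla\mathcal{U}(\mathbf{x})}{m\,v(\mathbf{x})^2}+\frac{\nabla g(\mathbf{x})}{g(\mathbf{x})}\right],\ \frac{1}{g(\mathbf{x})v(\mathbf{x})}\right)\right|=0 .$$ Furthermore, for $i,j\in\{1,2,3\}$ let $$\sigma^2_{n,ij}(\mathbf{x},t):=n\,\mathbb{E}\left[(X^n_{1,i}-x_i)(X^n_{1,j}-x_j)\mid(\mathbf{X}^n_0,\mathcal{T}^n_0)=(\mathbf{x},t)\right],$$ $$\sigma^2_{n,it}(\mathbf{x},t):=n\,\mathbb{E}\left[(X^n_{1,i}-x_i)(\mathcal{T}^n_1-t)\mid(\mathbf{X}^n_0,\mathcal{T}^n_0)=(\mathbf{x},t)\right],$$ $$\sigma^2_{n,t}(\mathbf{x},t):=n\,\mathbb{E}\left[(\mathcal{T}^n_1-t)^2\mid(\mathbf{X}^n_0,\mathcal{T}^n_0)=(\mathbf{x},t)\right].$$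 Then, with $\delta_{ij}=1$ if $i=j$ and $0$ otherwise, (1) $\displaystyle\lim_{n\to\infty}\sup_{(\mathbf{x},t):\|\mathbf{x}\|\in S,\,t\ge0}\left|\sigma^2_{n,ij}(\mathbf{x},t)-\frac{2}{3g(\mathbf{x})^2}\delta_{ij}\right|=0$; (2) $\displaystyle\lim_{n\to\infty}\sup_{(\mathbf{x},t):\|\mathbf{x}\|\in S,\,t\ge0}\sigma^2_{n,it}(\mathbf{x},t)=0$; (3) $\displaystyle\lim_{n\to\infty}\sup_{(\mathbf{x},t):\|\mathbf{x}\|\in S,\,t\ge0}\sigma^2_{n,t}(\mathbf{x},t)=0$.
   Context: Setting and standing assumptions. Fix a mass $m>0$ and an energy $E\in\mathbb{R}$. Let $\mathcal{D}$ be either $[0,\infty)$ (then $h_-=0$, $h_+=\infty$) or $[h_-,h_+]$ with $0\le h_-<h_+<\infty$; $\mathcal{D}^\circ=(h_-,h_+)$. The potential $\mathcal{U}$ and scatterer density $g$ are real functions on $\mathcal{D}$; for $\mathbf{x}\in\mathbb{R}^3$ with $\|\mathbf{x}\|\in\mathcal{D}$ write $\mathcal{U}(\mathbf{x})=\mathcal{U}(\|\mathbf{x}\|)$, $g(\mathbf{x})=g(\|\mathbf{x}\|)$, and let $\nabla$ be the gradient in $\mathbb{R}^3$. Put $v(r)=\sqrt{\tfrac{2}{m}(E-\mathcal{U}(r))}$ and $v(\mathbf{x})=v(\|\mathbf{x}\|)$. Assume: (a) $E-\mathcal{U}(r)>0$ for $r\in\mathcal{D}^\circ$. (b) If $h_->0$: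 $\mathcal{U}(h_-)=E$ and $-\partial_r\mathcal{U}(h_-)>0$. If $h_+<\infty$: $\mathcal{U}(h_+)=E$ and $-\partial_r\mathcal{U}(h_+)<0$. If $h_-=0$: $E-\mathcal{U}(0)>0$. If $h_+=\infty$: $\inf_{[h_-+\varepsilon,\infty)}(E-\mathcal{U}(r))>0$ for every $\varepsilon>0$. (c) $\mathcal{U}\in C^1(\mathcal{D})$. If $\mathcal{D}=[0,h_+]$ with $h_+<\infty$ this may be relaxed to $\mathcal{U}\in C^1((0,h_+])$ (allowing e.g. $\mathcal{U}(r)=-1/r$), in which case $E-\mathcal{U}(0)>0$ is read as $\liminf_{r\downarrow0}(E-\mathcal{U}(r))>0$. (d) $g\in C(\mathcal{D})\cap C^1(\mathcal{D}^\circ)$ and $\inf_{\mathcal{D}}g>0$. Scaling. For $n\in\mathbb{N}$: $g_n=\sqrt{n}\,g$, $\mathcal{U}_n=n^{-1/2}\mathcal{U}$, $E_n=n^{-1/2}E$, $v_n=n^{-1/4}v$. Trajectories. For $\mathbf{w}\in\mathbb{R}^3$ with $\|\mathbf{w}\|=v_n(\mathbf{x})$, $t\mapsto\mathbf{y}_n(\mathbf{x},\mathbf{w},t)$ denotes the solution of $m\mathbf{y}''=-\nabla\mathcal{U}_n(\mathbf{y})$, $\mathbf{y}(0)=\mathbf{x}$, $\mathbf{y}'(0)=\mathbf{w}$; if it hits the origin for the first time at time $T$ it is continued by $\mathbf{y}(t)=-\mathbf{y}(2T-t)$ on $[T,2T]$, then by the equation of motion, repeating this rule at later hits. The norm of the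 trajectory stays in $\mathcal{D}$. Free-flight time. For $\mathbf{u}\in\mathbf{S}^2$ (unit sphere of $\mathbb{R}^3$), $N^{(n)}(\mathbf{x},\mathbf{u})$ is a nonnegative random variable with $$\mathbb{P}(N^{(n)}(\mathbf{x},\mathbf{u})>t)=\exp\left(-\int_0^t g_n[\mathbf{y}_n(\mathbf{x},v_n(\mathbf{x})\mathbf{u},s)]\,v_n[\mathbf{y}_n(\mathbf{x},v_n(\mathbf{x})\mathbf{u},s)]\,ds\right).$$ Let $\mathbf{U}$ be uniform on $\mathbf{S}^2$ and, conditionally on $\mathbf{U}=\mathbf{u}$, let $N^{(n)}(\mathbf{x},\mathbf{U})$ be distributed as $N^{(n)}(\mathbf{x},\mathbf{u})$. Free path chain. $((\mathbf{X}^n_k,\mathcal{T}^n_k))_{k\ge0}$ is the Markov chain with values in $\{\mathbf{x}\in\mathbb{R}^3:\|\mathbf{x}\|\in\mathcal{D}\}\times[0,\infty)$ and transition operator $$Q_nf(\mathbf{x},t)=\mathbb{E}\left[f\left(\mathbf{y}_n(\mathbf{x},v_n(\mathbf{x})\mathbf{U},N^{(n)}(\mathbf{x},\mathbf{U})),\ t+n^{-3/4}N^{(n)}(\mathbf{x},\mathbf{U})\right)\right].$$ $X^n_{1,i}$ and $x_i$ denote the $i$-th coordinates of $\mathbf{X}^n_1$ and $\mathbf{x}$. *)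

theory Defs
  imports "HOL-Probability.Probability"
begin

section \<open>The radial domain and the medium\<close>

definition radial_dom :: "real \<Rightarrow> ereal \<Rightarrow> real set" where
  "radial_dom hm hp = {r. hm \<le> r \<and> ereal r \<le> hp}"

definition radial_int :: "real \<Rightarrow> ereal \<Rightarrow> real set" where
  "radial_int hm hp = {r. hm < r \<and> ereal r < hp}"

text \<open>The library's \<open>C1_differentiable_on\<close> uses two-sided derivatives; here the function only
  lives on an interval, so derivatives at an included endpoint are one-sided.\<close>

definition C1_on :: "real set \<Rightarrow> (real \<Rightarrow> real) \<Rightarrow> bool" where
  "C1_on A f \<longleftrightarrow>
     (\<exists>f'. (\<forall>r\<in>A. (f has_real_derivative f' r) (at r within A)) \<and> continuous_on A f')"

text \<open>Assumptions (a)--(d). In the second alternative of (c) the value \<open>U 0\<close> is irrelevant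
  (for instance \<open>U r = - 1 / r\<close>). The infima are taken in the extended reals, so that they are
  meaningful without a separate boundedness condition.\<close>

definition admissible_medium ::
  "real \<Rightarrow> real \<Rightarrow> real \<Rightarrow> ereal \<Rightarrow> (real \<Rightarrow> real) \<Rightarrow> (real \<Rightarrow> real) \<Rightarrow> bool" where
  "admissible_medium m E hm hp U g \<longleftrightarrow>
     0 < m \<and>
     (hm = 0 \<and> hp = \<infinity> \<or> 0 \<le> hm \<and> ereal hm < hp \<and> hp < \<infinity>) \<and>
     (\<forall>r\<in>radial_int hm hp. E - U r > 0) \<and>
     (hm > 0 \<longrightarrow> U hm = E \<and>
        (\<exists>d. (U has_real_derivative d) (at hm within radial_dom hm hp) \<and> - d > 0)) \<and>
     (hp < \<infinity> \<longrightarrow> U (real_of_ereal hp) = E \<and>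
        (\<exists>d. (U has_real_derivative d) (at (real_of_ereal hp) within radial_dom hm hp) \<and> - d < 0)) \<and>
     (hp = \<infinity> \<longrightarrow> (\<forall>\<epsilon>>0. (INF r\<in>{hm + \<epsilon>..}. ereal (E - U r)) > 0)) \<and>
     (C1_on (radial_dom hm hp) U \<and> (hm = 0 \<longrightarrow> E - U 0 > 0) \<or>
      hm = 0 \<and> hp < \<infinity> \<and> C1_on (radial_dom hm hp - {0}) U \<and>
        Liminf (at_right 0) (\<lambda>r. ereal (E - U r)) > 0) \<and>
     continuous_on (radial_dom hm hp) g \<and> C1_on (radial_int hm hp) g \<and>
     (INF r\<in>radial_dom hm hp. ereal (g r)) > 0"

definition speed :: "real \<Rightarrow> real \<Rightarrow> (real \<Rightarrow> real) \<Rightarrow> real \<Rightarrow> real" where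
  "speed m E U r = sqrt (2 / m * (E - U r))"

text \<open>The gradient in \<open>\<real>\<^sup>3\<close> of \<open>x \<mapsto> f (norm x)\<close>. Only points \<open>z\<close> with \<open>norm z \<in> D\<close> count; this makes
  a difference only on the boundary spheres, which a trajectory may touch.\<close>

definition radial_grad :: "real set \<Rightarrow> (real \<Rightarrow> real) \<Rightarrow> real^3 \<Rightarrow> real^3" where
  "radial_grad D f x =
     (THE G. ((\<lambda>z. f (norm z)) has_derivative (\<lambda>h. G \<bullet> h)) (at x within {z. norm z \<in> D}))"

section \<open>Scaling\<close>

definition scaled_density :: "(real \<Rightarrow> real) \<Rightarrow> nat \<Rightarrow> real \<Rightarrow> real" where
  "scaled_density g n r = sqrt (real n) * g r"

definition scaled_potential :: "(real \<Rightarrow> real) \<Rightarrow> nat \<Rightarrow> real \<Rightarrow> real" where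
  "scaled_potential U n r = real n powr (- 1 / 2) * U r"

definition scaled_speed :: "real \<Rightarrow> real \<Rightarrow> (real \<Rightarrow> real) \<Rightarrow> nat \<Rightarrow> real \<Rightarrow> real" where
  "scaled_speed m E U n r = real n powr (- 1 / 4) * speed m E U r"

section \<open>Trajectories\<close>

text \<open>\<open>\<tau>\<close> is the lifetime. The assumptions do not exclude that for \<open>D = [0, \<infinity>)\<close> a trajectory runs
  off to infinity in finite time (for instance \<open>U r = - r ^ 4\<close>); then its optical depth (see below)
  diverges at \<open>\<tau>\<close>, so it is almost surely not followed up to \<open>\<tau>\<close>. In all other cases \<open>\<tau> = \<infinity>\<close>.
  Outside \<open>[0, \<tau>)\<close> the value of \<open>y\<close> is the dummy \<open>0\<close>.

  The last clause is the rule at the origin: if \<open>T\<close> is a hitting time, then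
  \<open>y t = - y (2 * T - t)\<close> for \<open>t = T + s\<close>, where \<open>T - s\<close> runs back to the preceding hit, or
  to time 0 if there is none. For the first hit this is the interval \<open>[T, 2 * T]\<close>.\<close>

definition is_trajectory ::
  "real \<Rightarrow> real set \<Rightarrow> (real \<Rightarrow> real) \<Rightarrow> real^3 \<Rightarrow> real^3 \<Rightarrow> (real \<Rightarrow> real^3) \<Rightarrow> bool" where
  "is_trajectory m D V x w y \<longleftrightarrow> (\<exists>\<tau>::ereal. 0 < \<tau> \<and>
     (\<tau> = \<infinity> \<or> filterlim (\<lambda>t. norm (y t)) at_top (at_left (real_of_ereal \<tau>))) \<and>
     (\<forall>t. t < 0 \<or> \<tau> \<le> ereal t \<longrightarrow> y t = 0) \<and>
     (\<forall>t. 0 \<le> t \<and> ereal t < \<tau> \<longrightarrow> norm (y t) \<in> D) \<and>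
     continuous_on {t. 0 \<le> t \<and> ereal t < \<tau>} y \<and>
     y 0 = x \<and> (y has_vector_derivative w) (at 0 within {0..}) \<and>
     (\<exists>y'. \<forall>t. 0 < t \<and> ereal t < \<tau> \<and> y t \<noteq> 0 \<longrightarrow>
        (y has_vector_derivative y' t) (at t) \<and>
        (\<exists>a. (y' has_vector_derivative a) (at t) \<and> m *\<^sub>R a = - radial_grad D V (y t))) \<and>
     (\<forall>T s. 0 < T \<and> y T = 0 \<and> 0 \<le> s \<and> s \<le> T \<and> ereal (T + s) < \<tau> \<and>
        (\<forall>t\<in>{T - s<..<T}. y t \<noteq> 0) \<longrightarrow> y (T + s) = - y (T - s)))"

section \<open>Free flight\<close>

definition exp_neg :: "ennreal \<Rightarrow> real" where
  "exp_neg a = (if a = \<infinity> then 0 else exp (- enn2real a))"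

text \<open>The integral is taken in the extended reals, since the speed is unbounded near the origin
  for singular potentials and near infinity for potentials tending to \<open>- \<infinity>\<close>.\<close>

definition optical_depth ::
  "(real \<Rightarrow> real) \<Rightarrow> (real \<Rightarrow> real) \<Rightarrow> (real \<Rightarrow> real^3) \<Rightarrow> real \<Rightarrow> ennreal" where
  "optical_depth G V y t = (\<integral>\<^sup>+s\<in>{0..t}. ennreal (G (norm (y s)) * V (norm (y s))) \<partial>lborel)"

definition flight_law ::
  "(real \<Rightarrow> real) \<Rightarrow> (real \<Rightarrow> real) \<Rightarrow> (real \<Rightarrow> real^3) \<Rightarrow> real measure" where
  "flight_law G V y = (THE \<nu>. prob_space \<nu> \<and> sets \<nu> = sets borel \<and> measure \<nu> {..<0} = 0 \<and>
     (\<forall>t\<ge>0. measure \<nu> {t<..} = exp_neg (optical_depth G V y t)))"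

text \<open>The uniform distribution on the unit sphere: normalised surface measure, as the radial
  projection of the uniform distribution on the unit ball (\<open>sgn x = x / norm x\<close>).\<close>

definition uniform_sphere :: "(real^3) measure" where
  "uniform_sphere =
     restrict_space (distr (uniform_measure lborel (cball 0 1)) borel sgn) (sphere 0 1)"

section \<open>The free path chain\<close>

text \<open>Here \<open>y n x w\<close> is the trajectory started from \<open>x\<close> with velocity \<open>w\<close>. The outer integral is
  over the direction, the inner one over the flight time given the direction. The operator is
  meaningful only at \<open>(x, t)\<close> such that \<open>y n x w\<close> is a trajectory whenever \<open>w\<close> has the prescribed
  norm and depends measurably on \<open>w\<close>.\<close>

definition transition_op ::
  "real \<Rightarrow> real \<Rightarrow> (real \<Rightarrow> real) \<Rightarrow> (real \<Rightarrow> real) \<Rightarrow>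
   (nat \<Rightarrow> real^3 \<Rightarrow> real^3 \<Rightarrow> real \<Rightarrow> real^3) \<Rightarrow> nat \<Rightarrow>
   ((real^3) \<times> real \<Rightarrow> real) \<Rightarrow> (real^3) \<times> real \<Rightarrow> real" where
  "transition_op m E U g y n f = (\<lambda>(x, t).
     \<integral>u. (let traj = y n x (scaled_speed m E U n (norm x) *\<^sub>R u) in
           \<integral>s. f (traj s, t + real n powr (- 3 / 4) * s)
             \<partial>flight_law (scaled_density g n) (scaled_speed m E U n) traj)
     \<partial>uniform_sphere)"

definition past :: "'w measure \<Rightarrow> (nat \<Rightarrow> 'w \<Rightarrow> 'b::topological_space) \<Rightarrow> nat \<Rightarrow> 'w measure" where
  "past M Z k = sigma (space M) (\<Union>i\<le>k. {Z i -` B \<inter> space M |B. B \<in> sets borel})"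

text \<open>\<open>Z\<close> is a Markov chain on \<open>M\<close> with values in \<open>A\<close>, transition operator \<open>Q\<close> and deterministic
  initial state \<open>z\<close>; expectations under \<open>M\<close> are the conditional expectations given that the
  initial state is \<open>z\<close>.\<close>

definition markov_chain_from ::
  "'b::topological_space set \<Rightarrow> (('b \<Rightarrow> real) \<Rightarrow> 'b \<Rightarrow> real) \<Rightarrow> 'b \<Rightarrow> 'w measure \<Rightarrow>
   (nat \<Rightarrow> 'w \<Rightarrow> 'b) \<Rightarrow> bool" where
  "markov_chain_from A Q z M Z \<longleftrightarrow>
     prob_space M \<and>
     (\<forall>k. Z k \<in> measurable M borel) \<and>
     (\<forall>k. \<forall>\<omega>\<in>space M. Z k \<omega> \<in> A) \<and>
     (AE \<omega> in M. Z 0 \<omega> = z) \<and>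
     (\<forall>k f. f \<in> borel_measurable borel \<and> bounded (range f) \<longrightarrow>
        (AE \<omega> in M. real_cond_exp M (past M Z k) (\<lambda>\<omega>. f (Z (Suc k) \<omega>)) \<omega> = Q f (Z k \<omega>)))"

definition state_space :: "real \<Rightarrow> ereal \<Rightarrow> ((real^3) \<times> real) set" where
  "state_space hm hp = {x. norm x \<in> radial_dom hm hp} \<times> {0..}"

section \<open>Scaled drift and covariances\<close>

text \<open>\<open>M n z\<close> and \<open>Z n z\<close> are the probability space and the chain with initial state \<open>z\<close>.\<close>

definition drift ::
  "(nat \<Rightarrow> (real^3) \<times> real \<Rightarrow> 'w measure) \<Rightarrow>
   (nat \<Rightarrow> (real^3) \<times> real \<Rightarrow> nat \<Rightarrow> 'w \<Rightarrow> (real^3) \<times> real) \<Rightarrow>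
   nat \<Rightarrow> (real^3) \<times> real \<Rightarrow> (real^3) \<times> real" where
  "drift M Z n z = real n *\<^sub>R (\<integral>\<omega>. Z n z 1 \<omega> - z \<partial>M n z)"

definition cov_xx ::
  "(nat \<Rightarrow> (real^3) \<times> real \<Rightarrow> 'w measure) \<Rightarrow>
   (nat \<Rightarrow> (real^3) \<times> real \<Rightarrow> nat \<Rightarrow> 'w \<Rightarrow> (real^3) \<times> real) \<Rightarrow>
   nat \<Rightarrow> 3 \<Rightarrow> 3 \<Rightarrow> (real^3) \<times> real \<Rightarrow> real" where
  "cov_xx M Z n i j z = real n *
     (\<integral>\<omega>. (fst (Z n z 1 \<omega>) $ i - fst z $ i) * (fst (Z n z 1 \<omega>) $ j - fst z $ j) \<partial>M n z)"

definition cov_xt ::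
  "(nat \<Rightarrow> (real^3) \<times> real \<Rightarrow> 'w measure) \<Rightarrow>
   (nat \<Rightarrow> (real^3) \<times> real \<Rightarrow> nat \<Rightarrow> 'w \<Rightarrow> (real^3) \<times> real) \<Rightarrow>
   nat \<Rightarrow> 3 \<Rightarrow> (real^3) \<times> real \<Rightarrow> real" where
  "cov_xt M Z n i z = real n *
     (\<integral>\<omega>. (fst (Z n z 1 \<omega>) $ i - fst z $ i) * (snd (Z n z 1 \<omega>) - snd z) \<partial>M n z)"

definition cov_tt ::
  "(nat \<Rightarrow> (real^3) \<times> real \<Rightarrow> 'w measure) \<Rightarrow>
   (nat \<Rightarrow> (real^3) \<times> real \<Rightarrow> nat \<Rightarrow> 'w \<Rightarrow> (real^3) \<times> real) \<Rightarrow>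
   nat \<Rightarrow> (real^3) \<times> real \<Rightarrow> real" where
  "cov_tt M Z n z = real n * (\<integral>\<omega>. (snd (Z n z 1 \<omega>) - snd z)\<^sup>2 \<partial>M n z)"

definition limit_drift ::
  "real \<Rightarrow> real \<Rightarrow> real \<Rightarrow> ereal \<Rightarrow> (real \<Rightarrow> real) \<Rightarrow> (real \<Rightarrow> real) \<Rightarrow> real^3 \<Rightarrow> (real^3) \<times> real" where
  "limit_drift m E hm hp U g x =
     ((- 1 / (3 * (g (norm x))\<^sup>2)) *\<^sub>R
        ((2 / (m * (speed m E U (norm x))\<^sup>2)) *\<^sub>R radial_grad (radial_dom hm hp) U x +
         (1 / g (norm x)) *\<^sub>R radial_grad (radial_dom hm hp) g x),
      1 / (g (norm x) * speed m E U (norm x)))"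

end

theory Submission
  imports Defs
begin

text \<open>Rescaling time by \<open>n powr (1/4)\<close> turns the \<open>n\<close>-th trajectory into a path \<open>z\<close> of the unscaled
  equation of motion, and the depth \<open>\<Lambda> = \<integral> g v\<close> along this path, taken at the collision, is an
  exponential variable divided by \<open>\<surd>n\<close>. Hence \<open>\<Lambda>\<close> has the moments \<open>1/\<surd>n, 2/n, 6/n^(3/2), 24/n\<^sup>2\<close>.
  With respect to \<open>\<Lambda>\<close> the path has, at its start, first derivative \<open>u/g\<close> and second derivative
  \<open>(z'/(g v))'/(g v)\<close>, so \<open>z = x + \<Lambda> u/g + \<Lambda>\<^sup>2/2 (z'/(g v))'/(g v)\<close> up to
  \<open>\<epsilon> \<Lambda>\<^sup>2 + C \<Lambda>\<^sup>3\<close>. Taking expectations and averaging over the direction \<open>u\<close>, with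
  \<open>E u = 0\<close> and \<open>E (u\<^sub>i u\<^sub>j) = \<delta>\<^sub>i\<^sub>j/3\<close>, gives the claim. The error term is admissible for paths of
  any length, since \<open>\<Lambda>\<close> dominates the length of the path (energy is conserved, also across the
  origin) and the time: a path is slow only near a turning radius, from where the force expels it.\<close>

section \<open>Uniform directions\<close>

text \<open>Taylor expansion controls a path only near its start, uniformly over \<open>S\<close>,
  up to a time before which it stays among regular radii. Later it may touch a turning radius, pass
  the origin, where speed and force may be singular, or run off to infinity in finite time. By then
  its depth is at least some fixed b > 0, so a crude error bound of order \<open>\<Lambda>\<close>
  is also one of order \<open>\<Lambda>^3\<close>, which after multiplication by n costs only a
  constant over \<surd>n. Hence long flights are never split off as a separate event. The term with
  \<epsilon> is not sharpened to a power of \<open>\<Lambda>\<close> because U and g are only C1: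
  the second derivative of the path with respect to its depth is merely continuous.

  A second obstacle is the conditioning on the direction. The hypotheses speak of each trajectory
  separately, and of the chain through bounded test functions, whereas displacement and time are
  unbounded. Measurability and integrability in the direction are therefore extracted from the
  Markov property itself.\<close>

definition signed_perm :: "('n \<Rightarrow> real) \<Rightarrow> ('n \<Rightarrow> 'n) \<Rightarrow> real^'n \<Rightarrow> real^'n" where
  "signed_perm c \<pi> x = (\<chi> i. c i * x $ \<pi> i)"

lemma continuous_signed_perm: "continuous_on A (signed_perm c \<pi>)"
  unfolding signed_perm_def by (intro continuous_intros)

lemma signed_perm_borel [measurable]: "signed_perm c \<pi> \<in> borel_measurable borel"
  by (rule borel_measurable_continuous_onI[OF continuous_signed_perm])

lemma Basis_vec_range: "(Basis :: (real^'n) set) = range (\<lambda>i. axis i 1)"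
  by (auto simp: Basis_vec_def)

lemma prod_Basis_vec:
  fixes f :: "real^'n \<Rightarrow> 'b::comm_monoid_mult"
  shows "(\<Prod>b\<in>Basis. f b) = (\<Prod>i\<in>UNIV. f (axis i 1))"
proof -
  have "inj (\<lambda>i. axis i (1::real) :: real^'n)" by (auto simp: inj_on_def axis_eq_axis)
  from prod.reindex[OF this, of f]
  show ?thesis unfolding Basis_vec_range o_def by simp
qed

text \<open>The preimage of a box is again a box: its sides are permuted, and reflected where the
  sign is -1, so its volume is the same product in another order.\<close>

lemma lborel_signed_perm:
  assumes \<pi>: "bij \<pi>" and c: "\<And>i. c i = 1 \<or> c i = -1"
  shows "distr lborel borel (signed_perm c \<pi>) = (lborel :: (real^'n) measure)"
proof (rule lborel_eqI[symmetric])
  fix l u :: "real^'n"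
  assume le: "\<And>b. b \<in> Basis \<Longrightarrow> l \<bullet> b \<le> u \<bullet> b"
  have lu: "l $ i \<le> u $ i" for i using le[of "axis i 1"] by (simp add: inner_axis axis_in_Basis_iff)
  define \<rho> where "\<rho> = inv \<pi>"
  have \<rho>: "\<pi> (\<rho> j) = j" "\<rho> (\<pi> i) = i" for i j
    using \<pi> by (simp_all add: \<rho>_def bij_is_surj surj_f_inv_f bij_is_inj)
  define l' where "l' = (\<chi> j. if c (\<rho> j) = 1 then l $ \<rho> j else - u $ \<rho> j)"
  define u' where "u' = (\<chi> j. if c (\<rho> j) = 1 then u $ \<rho> j else - l $ \<rho> j)"
  have "signed_perm c \<pi> -` box l u = box l' u'"
  proof (rule set_eqI)
    fix x
    have "x \<in> signed_perm c \<pi> -` box l u \<longleftrightarrow> (\<forall>i. l $ i < c i * x $ \<pi> i \<and> c i * x $ \<pi> i < u $ i)"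
      by (simp add: mem_box_cart signed_perm_def)
    also have "\<dots> \<longleftrightarrow> (\<forall>j. l $ \<rho> j < c (\<rho> j) * x $ j \<and> c (\<rho> j) * x $ j < u $ \<rho> j)"
      by (metis \<rho>)
    also have "\<dots> \<longleftrightarrow> (\<forall>j. l' $ j < x $ j \<and> x $ j < u' $ j)"
    proof (intro arg_cong[where f=All] ext)
      fix j show "(l $ \<rho> j < c (\<rho> j) * x $ j \<and> c (\<rho> j) * x $ j < u $ \<rho> j) = (l' $ j < x $ j \<and> x $ j < u' $ j)"
        using c[of "\<rho> j"] by (auto simp: l'_def u'_def)
    qed
    also have "\<dots> \<longleftrightarrow> x \<in> box l' u'" by (simp add: mem_box_cart)
    finally show "x \<in> signed_perm c \<pi> -` box l u \<longleftrightarrow> x \<in> box l' u'" .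
  qed
  then have "emeasure (distr lborel borel (signed_perm c \<pi>)) (box l u) = emeasure lborel (box l' u')"
    by (subst emeasure_distr) auto
  also have "\<dots> = (\<Prod>b\<in>Basis. (u' - l') \<bullet> b)"
  proof (rule emeasure_lborel_box)
    fix b :: "real^'n" assume "b \<in> Basis"
    then obtain j where "b = axis j 1" by (auto simp: Basis_vec_def)
    then show "l' \<bullet> b \<le> u' \<bullet> b" using lu[of "\<rho> j"] by (auto simp: inner_axis l'_def u'_def)
  qed
  also have "(\<Prod>b\<in>Basis. (u' - l') \<bullet> b) = (\<Prod>j\<in>UNIV. u $ \<rho> j - l $ \<rho> j)"
    unfolding prod_Basis_vec by (intro prod.cong) (auto simp: inner_axis l'_def u'_def)
  also have "\<dots> = (\<Prod>i\<in>UNIV. u $ i - l $ i)"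
    by (rule prod.reindex_bij_betw[of \<rho> UNIV UNIV "\<lambda>i. u $ i - l $ i"]) (use \<pi> in \<open>simp add: \<rho>_def bij_imp_bij_inv\<close>)
  also have "\<dots> = (\<Prod>b\<in>Basis. (u - l) \<bullet> b)"
    unfolding prod_Basis_vec by (simp add: inner_axis)
  finally show "emeasure (distr lborel borel (signed_perm c \<pi>)) (box l u) = ennreal (\<Prod>b\<in>Basis. (u - l) \<bullet> b)" .
qed simp

lemma norm_signed_perm:
  assumes \<pi>: "bij \<pi>" and c: "\<And>i. c i = 1 \<or> c i = -1"
  shows "norm (signed_perm c \<pi> x) = norm x"
proof -
  have "(\<Sum>i\<in>UNIV. (norm (signed_perm c \<pi> x $ i))\<^sup>2) = (\<Sum>i\<in>UNIV. (norm (x $ \<pi> i))\<^sup>2)"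
  proof (rule sum.cong)
    fix i show "(norm (signed_perm c \<pi> x $ i))\<^sup>2 = (norm (x $ \<pi> i))\<^sup>2"
      using c[of i] by (auto simp: signed_perm_def)
  qed simp
  also have "\<dots> = (\<Sum>i\<in>UNIV. (norm (x $ i))\<^sup>2)"
    by (rule sum.reindex_bij_betw) (rule \<pi>)
  finally show ?thesis by (simp add: norm_vec_def L2_set_def)
qed

lemma sgn_signed_perm:
  assumes \<pi>: "bij \<pi>" and c: "\<And>i. c i = 1 \<or> c i = -1"
  shows "sgn (signed_perm c \<pi> x) = signed_perm c \<pi> (sgn x)"
  using norm_signed_perm[OF assms, where x=x] by (simp add: sgn_div_norm vec_eq_iff signed_perm_def)

abbreviation "ball3 \<equiv> uniform_measure lborel (cball (0::real^3) 1)"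

lemma sgn_borel [measurable]: "(sgn :: real^3 \<Rightarrow> real^3) \<in> borel_measurable borel"
  unfolding sgn_div_norm[abs_def] by measurable

lemma cball_measure: "emeasure lborel (cball (0::real^3) 1) \<noteq> 0" "emeasure lborel (cball (0::real^3) 1) \<noteq> \<infinity>"
proof -
  have "0 < measure lborel (cball (0::real^3) 1)" by (rule content_cball_pos) simp
  then show "emeasure lborel (cball (0::real^3) 1) \<noteq> 0" by (auto simp: measure_def)
  show "emeasure lborel (cball (0::real^3) 1) \<noteq> \<infinity>"
    using emeasure_lborel_cball_finite[of "0::real^3" 1] by simp
qed

lemma prob_space_ball3: "prob_space ball3"
  by (rule prob_space_uniform_measure[OF cball_measure])

lemma ball3_signed_perm:
  assumes \<pi>: "bij \<pi>" and c: "\<And>i. c i = 1 \<or> c i = -1"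
  shows "distr ball3 borel (signed_perm c \<pi>) = ball3"
proof (rule measure_eqI)
  fix A assume "A \<in> sets (distr ball3 borel (signed_perm c \<pi>))"
  then have A[measurable]: "A \<in> sets borel" by simp
  let ?T = "signed_perm c \<pi> :: real^3 \<Rightarrow> real^3"
  have "?T -` A \<in> sets borel" using measurable_sets[OF signed_perm_borel A, of c \<pi>] by simp
  then have "emeasure (distr ball3 borel ?T) A = emeasure lborel (cball 0 1 \<inter> ?T -` A) / emeasure lborel (cball (0::real^3) 1)"
    by (simp add: emeasure_distr)
  also have "cball 0 1 \<inter> ?T -` A = ?T -` (cball 0 1 \<inter> A)"
    using norm_signed_perm[OF assms] by auto
  also have "emeasure lborel (?T -` (cball 0 1 \<inter> A)) = emeasure (distr lborel borel ?T) (cball 0 1 \<inter> A)"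
    by (subst emeasure_distr) auto
  finally show "emeasure (distr ball3 borel ?T) A = emeasure ball3 A"
    by (simp add: lborel_signed_perm[OF assms])
qed simp

lemma space_uniform_sphere: "space uniform_sphere = sphere 0 1"
  by (simp add: uniform_sphere_def space_restrict_space)

lemma borel_uniform_sphere: "f \<in> borel_measurable borel \<Longrightarrow> f \<in> borel_measurable uniform_sphere"
  unfolding uniform_sphere_def by (rule measurable_restrict_space1) simp

lemma prob_space_uniform_sphere: "prob_space uniform_sphere"
  unfolding uniform_sphere_def
proof (rule prob_space_restrict_space)
  interpret B: prob_space ball3 by (rule prob_space_ball3)
  interpret N: prob_space "distr ball3 borel (sgn :: real^3 \<Rightarrow> real^3)"
    by (rule B.prob_space_distr) simp
  show "sphere 0 1 \<in> sets (distr ball3 borel (sgn :: real^3 \<Rightarrow> real^3))" by simp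
  \<comment> \<open>\<open>sgn 0 = 0\<close> lies off the sphere, so the centre has to be discarded
    as a null set.\<close>
  have "AE x in ball3. x \<noteq> (0::real^3)"
    by (rule AE_uniform_measureI) (auto intro: AE_mp[OF AE_lborel_singleton[of 0]])
  then have "AE x in ball3. sgn x \<in> sphere (0::real^3) 1"
    by eventually_elim (simp add: norm_sgn)
  then have "AE x in distr ball3 borel (sgn :: real^3 \<Rightarrow> real^3). x \<in> sphere 0 1"
    by (subst AE_distr_iff) auto
  then show "emeasure (distr ball3 borel (sgn :: real^3 \<Rightarrow> real^3)) (sphere 0 1) = 1"
    by (intro N.emeasure_eq_1_AE) auto
qed

text \<open>\<open>sgn\<close> commutes with signed permutations, so the invariance of the ball
  passes to its radial projection.\<close>

lemma uniform_sphere_signed_perm: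
  fixes f :: "real^3 \<Rightarrow> real"
  assumes \<pi>: "bij \<pi>" and c: "\<And>i. c i = 1 \<or> c i = -1" and f [measurable]: "f \<in> borel_measurable borel"
  shows "(\<integral>u. f (signed_perm c \<pi> u) \<partial>uniform_sphere) = (\<integral>u. f u \<partial>uniform_sphere)"
proof -
  let ?T = "signed_perm c \<pi> :: real^3 \<Rightarrow> real^3"
  let ?N = "distr ball3 borel (sgn :: real^3 \<Rightarrow> real^3)"
  have "distr ?N borel ?T = distr ball3 borel (?T \<circ> sgn)"
    by (rule distr_distr) auto
  also have "?T \<circ> sgn = sgn \<circ> ?T" using sgn_signed_perm[OF \<pi> c] by auto
  also have "distr ball3 borel (sgn \<circ> ?T) = distr (distr ball3 borel ?T) borel sgn"
    by (rule distr_distr[symmetric]) auto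
  also have "\<dots> = ?N" by (simp add: ball3_signed_perm[OF \<pi> c])
  finally have inv: "distr ?N borel ?T = ?N" .
  have int: "(\<integral>u. h u \<partial>uniform_sphere) = (\<integral>u. indicator (sphere 0 1) u *\<^sub>R h u \<partial>?N)" for h :: "real^3 \<Rightarrow> real"
    unfolding uniform_sphere_def by (subst integral_restrict_space) auto
  have "(\<integral>u. f (?T u) \<partial>uniform_sphere) = (\<integral>u. indicator (sphere 0 1) (?T u) *\<^sub>R f (?T u) \<partial>?N)"
    unfolding int using norm_signed_perm[OF \<pi> c] by (simp add: indicator_def)
  also have "\<dots> = (\<integral>u. indicator (sphere 0 1) u *\<^sub>R f u \<partial>distr ?N borel ?T)"
    by (rule integral_distr[symmetric]) (auto intro!: borel_measurable_times f borel_measurable_indicator borel_closed)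
  finally show ?thesis by (simp add: inv int)
qed

lemma sphere_component_le: "u \<in> space uniform_sphere \<Longrightarrow> \<bar>u $ i\<bar> \<le> 1"
  using component_le_norm_cart[of u i] by (simp add: space_uniform_sphere)

lemma integrable_sphere_component: "integrable uniform_sphere (\<lambda>u. u $ i)"
proof -
  interpret prob_space uniform_sphere by (rule prob_space_uniform_sphere)
  show ?thesis
    by (rule integrable_const_bound[of _ 1]) (auto intro!: borel_uniform_sphere sphere_component_le)
qed

lemma integrable_sphere_components: "integrable uniform_sphere (\<lambda>u. u $ i * u $ j)"
proof -
  interpret prob_space uniform_sphere by (rule prob_space_uniform_sphere)
  show ?thesis
    by (rule integrable_const_bound[of _ 1])
      (auto intro!: borel_uniform_sphere mult_le_one sphere_component_le simp: abs_mult)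
qed

text \<open>The antipodal map is a signed permutation, so the mean equals its own negative.\<close>

lemma sphere_mean: "(\<integral>u. u $ i \<partial>uniform_sphere) = 0"
proof -
  have "(\<integral>u. signed_perm (\<lambda>_. -1) id u $ i \<partial>uniform_sphere) = (\<integral>u. u $ i \<partial>uniform_sphere)"
    by (rule uniform_sphere_signed_perm[where f="\<lambda>u. u $ i"]) auto
  then show ?thesis by (simp add: signed_perm_def)
qed

text \<open>A sign change in one coordinate kills the mixed moments. Transpositions make the three
  squares equal in mean, and the squares add up to 1 on the sphere.\<close>

lemma sphere_second_moment:
  "(\<integral>u. u $ i * u $ j \<partial>uniform_sphere) = (if i = j then 1 / 3 else 0)"
proof (cases "i = j")
  case False
  have "(\<integral>u. signed_perm (\<lambda>k. if k = i then -1 else 1) id u $ i * signed_perm (\<lambda>k. if k = i then -1 else 1) id u $ j \<partial>uniform_sphere) =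
      (\<integral>u. u $ i * u $ j \<partial>uniform_sphere)"
    by (rule uniform_sphere_signed_perm[where f="\<lambda>u. u $ i * u $ j"]) auto
  then show ?thesis using False by (simp add: signed_perm_def)
next
  case True
  interpret prob_space uniform_sphere by (rule prob_space_uniform_sphere)
  have eq: "(\<integral>u. u $ k * u $ k \<partial>uniform_sphere) = (\<integral>u. u $ i * u $ i \<partial>uniform_sphere)" for k
  proof -
    have "(\<integral>u. signed_perm (\<lambda>_. 1) (Transposition.transpose i k) u $ i * signed_perm (\<lambda>_. 1) (Transposition.transpose i k) u $ i \<partial>uniform_sphere) =
        (\<integral>u. u $ i * u $ i \<partial>uniform_sphere)"
      by (rule uniform_sphere_signed_perm[where f="\<lambda>u. u $ i * u $ i"]) auto
    then show ?thesis by (simp add: signed_perm_def)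
  qed
  have one: "(\<Sum>k\<in>UNIV. u $ k * u $ k) = 1" if "u \<in> space uniform_sphere" for u
  proof -
    have "u \<bullet> u = 1" using that by (simp add: space_uniform_sphere norm_eq_1)
    then show ?thesis by (simp add: inner_vec_def)
  qed
  have "(\<Sum>k\<in>UNIV. \<integral>u. u $ k * u $ k \<partial>uniform_sphere) = (\<integral>u. (\<Sum>k\<in>UNIV. u $ k * u $ k) \<partial>uniform_sphere)"
    by (rule Bochner_Integration.integral_sum[symmetric]) (rule integrable_sphere_components)
  also have "\<dots> = (\<integral>u. 1 \<partial>uniform_sphere)"
    by (rule Bochner_Integration.integral_cong) (simp_all add: one)
  also have "\<dots> = 1" by (simp add: prob_space)
  finally have "(\<Sum>k\<in>UNIV. \<integral>u. u $ k * u $ k \<partial>uniform_sphere) = 1" .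
  moreover have "(\<Sum>k\<in>UNIV. \<integral>u. u $ k * u $ k \<partial>uniform_sphere) = (\<Sum>k\<in>(UNIV::3 set). \<integral>u. u $ i * u $ i \<partial>uniform_sphere)"
    by (intro sum.cong eq) auto
  ultimately have "3 * (\<integral>u. u $ i * u $ i \<partial>uniform_sphere) = 1" by simp
  then show ?thesis using True by simp
qed

section \<open>The first step of the chain\<close>

text \<open>This is the Markov property at \<open>k = 0\<close> after taking expectations: the tower
  property removes the conditioning, and the initial state is almost surely \<open>z\<close>, so
  \<open>Q f (Z 0 \<omega>)\<close> is the number \<open>Q f z\<close>.\<close>

lemma markov_chain_first_step:
  fixes f :: "'b::topological_space \<Rightarrow> real"
  assumes chain: "markov_chain_from A Q z M Z"
    and f: "f \<in> borel_measurable borel" "bounded (range f)"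
  shows "(\<integral>\<omega>. f (Z 1 \<omega>) \<partial>M) = Q f z"
proof -
  interpret prob_space M using chain by (simp add: markov_chain_from_def)
  have Z: "Z k \<in> measurable M borel" for k using chain by (simp add: markov_chain_from_def)
  have past0: "past M Z 0 = sigma (space M) {Z 0 -` B \<inter> space M |B. B \<in> sets borel}"
    by (simp add: past_def)
  have gen: "{Z 0 -` B \<inter> space M |B. B \<in> sets borel} \<subseteq> sets M"
    using measurable_sets[OF Z[of 0]] by auto
  then have "{Z 0 -` B \<inter> space M |B. B \<in> sets borel} \<subseteq> Pow (space M)"
    using sets.space_closed by (rule order_trans)
  then have "sets (past M Z 0) = sigma_sets (space M) {Z 0 -` B \<inter> space M |B. B \<in> sets borel}"
    unfolding past0 by (rule sets_measure_of)
  then have sub: "subalgebra M (past M Z 0)"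
    using sets.sigma_sets_subset[OF gen] by (simp add: subalgebra_def past0 space_measure_of_conv)
  interpret finite_measure_subalgebra M "past M Z 0" by standard (rule sub)
  obtain C where C: "\<And>b. \<bar>f b\<bar> \<le> C" using f(2) by (auto simp: bounded_iff)
  have int: "integrable M (\<lambda>\<omega>. f (Z 1 \<omega>))"
    by (rule integrable_const_bound[of _ C]) (use C measurable_compose[OF Z f(1)] in auto)
  have "AE \<omega> in M. real_cond_exp M (past M Z 0) (\<lambda>\<omega>. f (Z (Suc 0) \<omega>)) \<omega> = Q f (Z 0 \<omega>)"
    using chain f unfolding markov_chain_from_def by blast
  moreover have "AE \<omega> in M. Z 0 \<omega> = z" using chain by (simp add: markov_chain_from_def)
  ultimately have ae: "AE \<omega> in M. real_cond_exp M (past M Z 0) (\<lambda>\<omega>. f (Z 1 \<omega>)) \<omega> = Q f z"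
    by eventually_elim simp
  have "(\<integral>\<omega>. f (Z 1 \<omega>) \<partial>M) = (\<integral>\<omega>. real_cond_exp M (past M Z 0) (\<lambda>\<omega>. f (Z 1 \<omega>)) \<omega> \<partial>M)"
    using real_cond_exp_int(2)[OF int] by simp
  also have "\<dots> = (\<integral>\<omega>. Q f z \<partial>M)"
    by (rule integral_cong_AE) (use ae in auto)
  finally show ?thesis by (simp add: prob_space)
qed

text \<open>\<open>K u\<close> stands for the law of the next state given the direction
  \<open>u\<close>. It is not assumed to be a measurable kernel: \<open>mix\<close> is only an
  identity between numbers, for bounded test functions. The lemmas below recover measurability in
  \<open>u\<close> and extend the identity to unbounded functions.\<close>

locale mixture = M: prob_space M + P: prob_space P
  for M :: "'w measure" and P :: "'u measure" +
  fixes X :: "'w \<Rightarrow> 'b::topological_space" and K :: "'u \<Rightarrow> 'b measure"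
  assumes X [measurable]: "X \<in> measurable M borel"
    and K: "\<And>u. u \<in> space P \<Longrightarrow> prob_space (K u)" "\<And>u. u \<in> space P \<Longrightarrow> sets (K u) = sets borel"
    and mix: "\<And>f :: 'b \<Rightarrow> real. f \<in> borel_measurable borel \<Longrightarrow> bounded (range f) \<Longrightarrow>
      (\<integral>\<omega>. f (X \<omega>) \<partial>M) = (\<integral>u. (\<integral>b. f b \<partial>K u) \<partial>P)"
begin

lemma bounded_integrable_K:
  fixes f :: "'b \<Rightarrow> real"
  assumes f: "f \<in> borel_measurable borel" "bounded (range f)" and u: "u \<in> space P"
  shows "integrable (K u) f"
proof -
  interpret prob_space "K u" by (rule K(1)[OF u])
  obtain C where C: "\<And>b. \<bar>f b\<bar> \<le> C" using f(2) by (auto simp: bounded_iff)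
  show ?thesis
    by (rule integrable_const_bound[of _ C]) (use C f(1) K(2)[OF u] in \<open>auto cong: measurable_cong_sets\<close>)
qed

text \<open>The Bochner integral of a non-integrable function is \<open>0\<close>. If \<open>u \<mapsto> \<integral> f \<partial>K u\<close> were not
  integrable, the same would hold for \<open>f + 1\<close>, and \<open>mix\<close> would give the two functions equal means.\<close>

lemma bounded_integrable_P:
  fixes f :: "'b \<Rightarrow> real"
  assumes f: "f \<in> borel_measurable borel" "bounded (range f)"
  shows "integrable P (\<lambda>u. \<integral>b. f b \<partial>K u)"
proof (rule ccontr)
  assume no: "\<not> integrable P (\<lambda>u. \<integral>b. f b \<partial>K u)"
  obtain C where C: "\<And>b. \<bar>f b\<bar> \<le> C" using f(2) by (auto simp: bounded_iff)
  have f1: "(\<lambda>b. f b + 1) \<in> borel_measurable borel" "bounded (range (\<lambda>b. f b + 1))"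
    using f(1) C by (auto simp: bounded_iff intro!: exI[of _ "C + 1"] order_trans[OF abs_triangle_ineq])
  have eq: "(\<integral>b. f b + 1 \<partial>K u) = (\<integral>b. f b \<partial>K u) + 1" if u: "u \<in> space P" for u
  proof -
    interpret prob_space "K u" by (rule K(1)[OF u])
    show ?thesis using bounded_integrable_K[OF f u] by (simp add: prob_space)
  qed
  have "\<not> integrable P (\<lambda>u. \<integral>b. f b + 1 \<partial>K u)"
  proof
    assume "integrable P (\<lambda>u. \<integral>b. f b + 1 \<partial>K u)"
    then have "integrable P (\<lambda>u. (\<integral>b. f b + 1 \<partial>K u) - 1)" by simp
    also have "integrable P (\<lambda>u. (\<integral>b. f b + 1 \<partial>K u) - 1) = integrable P (\<lambda>u. \<integral>b. f b \<partial>K u)"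
      by (rule Bochner_Integration.integrable_cong) (simp_all add: eq)
    finally show False using no by blast
  qed
  then have "(\<integral>\<omega>. f (X \<omega>) + 1 \<partial>M) = 0" using mix[OF f1] by (simp add: not_integrable_integral_eq)
  moreover have "(\<integral>\<omega>. f (X \<omega>) \<partial>M) = 0" using mix[OF f] no by (simp add: not_integrable_integral_eq)
  moreover have "integrable M (\<lambda>\<omega>. f (X \<omega>))"
    by (rule M.integrable_const_bound[of _ C]) (use C measurable_compose[OF X f(1)] in auto)
  ultimately show False by (simp add: M.prob_space)
qed

text \<open>The truncations at level \<open>k\<close> are bounded, so \<open>mix\<close> applies and
  bounds their means by \<open>C\<close>. Monotone convergence then gives integrability of the
  limit.\<close>

lemma nonneg_integrable_M:
  fixes f :: "'b \<Rightarrow> real"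
  assumes f [measurable]: "f \<in> borel_measurable borel" and nn: "\<And>b. 0 \<le> f b"
    and int: "\<And>u. u \<in> space P \<Longrightarrow> integrable (K u) f"
    and C: "\<And>u. u \<in> space P \<Longrightarrow> (\<integral>b. f b \<partial>K u) \<le> C"
  shows "integrable M (\<lambda>\<omega>. f (X \<omega>))"
proof -
  define h where "h k b = min (f b) (real k)" for k b
  have hm [measurable]: "h k \<in> borel_measurable borel" for k unfolding h_def by measurable
  have hb: "bounded (range (h k))" for k
    unfolding bounded_iff using nn by (intro exI[of _ "real k"]) (auto simp: h_def)
  have hi: "integrable M (\<lambda>\<omega>. h k (X \<omega>))" for k
    by (rule M.integrable_const_bound[of _ "real k"]) (use nn in \<open>auto simp: h_def\<close>)
  have le: "(\<integral>\<omega>. h k (X \<omega>) \<partial>M) \<le> C" for k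
  proof -
    have "(\<integral>\<omega>. h k (X \<omega>) \<partial>M) = (\<integral>u. (\<integral>b. h k b \<partial>K u) \<partial>P)" by (rule mix[OF hm hb])
    also have "\<dots> \<le> (\<integral>u. C \<partial>P)"
    proof (rule integral_mono[OF bounded_integrable_P[OF hm hb]])
      fix u assume u: "u \<in> space P"
      have "(\<integral>b. h k b \<partial>K u) \<le> (\<integral>b. f b \<partial>K u)"
        by (rule integral_mono[OF bounded_integrable_K[OF hm hb u] int[OF u]]) (simp add: h_def)
      then show "(\<integral>b. h k b \<partial>K u) \<le> C" using C[OF u] by simp
    qed simp
    finally show ?thesis by (simp add: P.prob_space)
  qed
  have inc: "incseq (\<lambda>k. \<integral>\<omega>. h k (X \<omega>) \<partial>M)"
    by (auto simp: incseq_def h_def[abs_def] intro!: integral_mono hi[unfolded h_def[abs_def]])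
  have "\<exists>l. (\<lambda>k. \<integral>\<omega>. h k (X \<omega>) \<partial>M) \<longlonglongrightarrow> l"
    using incseq_convergent[OF inc] le by metis
  then obtain l where l: "(\<lambda>k. \<integral>\<omega>. h k (X \<omega>) \<partial>M) \<longlonglongrightarrow> l" ..
  have hlim: "(\<lambda>k. h k b) \<longlonglongrightarrow> f b" for b
  proof (rule tendsto_eventually)
    obtain n :: nat where n: "f b \<le> real n" using real_arch_simple by blast
    show "\<forall>\<^sub>F k in sequentially. h k b = f b"
      using eventually_ge_at_top[of n] by eventually_elim (use n in \<open>simp add: h_def\<close>)
  qed
  show ?thesis
  proof (rule integrable_monotone_convergence[OF hi _ _ l])
    show "AE \<omega> in M. mono (\<lambda>k. h k (X \<omega>))"
      by (intro AE_I2 monoI) (simp add: h_def min.coboundedI2)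
    show "AE \<omega> in M. (\<lambda>k. h k (X \<omega>)) \<longlonglongrightarrow> f (X \<omega>)" by (intro AE_I2 hlim)
  qed simp
qed

text \<open>Truncation on both sides and dominated convergence under each of \<open>M\<close>,
  \<open>K u\<close> and \<open>P\<close>. Under \<open>M\<close> the dominating function is
  integrable by the preceding lemma, under \<open>P\<close> it is the constant
  \<open>C\<close>.\<close>

lemma integrable_mix:
  fixes f :: "'b \<Rightarrow> real"
  assumes f [measurable]: "f \<in> borel_measurable borel"
    and int: "\<And>u. u \<in> space P \<Longrightarrow> integrable (K u) f"
    and C: "\<And>u. u \<in> space P \<Longrightarrow> (\<integral>b. \<bar>f b\<bar> \<partial>K u) \<le> C"
  shows "integrable M (\<lambda>\<omega>. f (X \<omega>))" "integrable P (\<lambda>u. \<integral>b. f b \<partial>K u)"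
    "(\<integral>\<omega>. f (X \<omega>) \<partial>M) = (\<integral>u. (\<integral>b. f b \<partial>K u) \<partial>P)"
proof -
  have iabs: "integrable M (\<lambda>\<omega>. \<bar>f (X \<omega>)\<bar>)"
    by (rule nonneg_integrable_M[where f="\<lambda>b. \<bar>f b\<bar>"]) (use int C in auto)
  show "integrable M (\<lambda>\<omega>. f (X \<omega>))"
    by (rule integrable_abs_cancel[OF iabs]) simp
  define h where "h k b = max (- real k) (min (f b) (real k))" for k b
  have hm [measurable]: "h k \<in> borel_measurable borel" for k unfolding h_def by measurable
  have hb: "bounded (range (h k))" for k
    unfolding bounded_iff by (intro exI[of _ "real k"]) (auto simp: h_def)
  have habs: "\<bar>h k b\<bar> \<le> \<bar>f b\<bar>" for k b by (auto simp: h_def)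
  have hlim: "(\<lambda>k. h k b) \<longlonglongrightarrow> f b" for b
  proof (rule tendsto_eventually)
    obtain n :: nat where n: "\<bar>f b\<bar> \<le> real n" using real_arch_simple by blast
    show "\<forall>\<^sub>F k in sequentially. h k b = f b"
      using eventually_ge_at_top[of n] by eventually_elim (use n in \<open>auto simp: h_def\<close>)
  qed
  have l1: "(\<lambda>k. \<integral>\<omega>. h k (X \<omega>) \<partial>M) \<longlonglongrightarrow> (\<integral>\<omega>. f (X \<omega>) \<partial>M)"
    by (rule integral_dominated_convergence[where w="\<lambda>\<omega>. \<bar>f (X \<omega>)\<bar>"])
      (use iabs hlim habs in auto)
  have l2: "(\<lambda>k. \<integral>b. h k b \<partial>K u) \<longlonglongrightarrow> (\<integral>b. f b \<partial>K u)" if u: "u \<in> space P" for u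
    by (rule integral_dominated_convergence[where w="\<lambda>b. \<bar>f b\<bar>"])
      (use int[OF u] hlim habs f hm K(2)[OF u] in \<open>auto cong: measurable_cong_sets\<close>)
  \<comment> \<open>Measurability in \<open>u\<close> is inherited from the truncations, for which
    \<open>bounded_integrable_P\<close> supplies it.\<close>
  have Gm: "(\<lambda>u. \<integral>b. f b \<partial>K u) \<in> borel_measurable P"
    by (rule borel_measurable_LIMSEQ_real[OF l2]) (use bounded_integrable_P[OF hm hb] in auto)
  have Gb: "\<bar>\<integral>b. h k b \<partial>K u\<bar> \<le> C" if u: "u \<in> space P" for u k
  proof -
    have "\<bar>\<integral>b. h k b \<partial>K u\<bar> \<le> (\<integral>b. \<bar>h k b\<bar> \<partial>K u)" by (rule integral_abs_bound)
    also have "\<dots> \<le> (\<integral>b. \<bar>f b\<bar> \<partial>K u)"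
      using bounded_integrable_K[OF hm hb u] int[OF u] habs by (intro integral_mono) auto
    finally show ?thesis using C[OF u] by simp
  qed
  have Gb': "\<bar>\<integral>b. f b \<partial>K u\<bar> \<le> C" if u: "u \<in> space P" for u
    using integral_abs_bound[of "K u" f] C[OF u] by linarith
  show "integrable P (\<lambda>u. \<integral>b. f b \<partial>K u)"
    by (rule P.integrable_const_bound[of _ C]) (use Gb' Gm in auto)
  have "(\<lambda>k. \<integral>u. (\<integral>b. h k b \<partial>K u) \<partial>P) \<longlonglongrightarrow> (\<integral>u. (\<integral>b. f b \<partial>K u) \<partial>P)"
    by (rule integral_dominated_convergence[where w="\<lambda>_. C"])
      (use Gm bounded_integrable_P[OF hm hb] l2 Gb in auto)
  then have "(\<lambda>k. \<integral>\<omega>. h k (X \<omega>) \<partial>M) \<longlonglongrightarrow> (\<integral>u. (\<integral>b. f b \<partial>K u) \<partial>P)"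
    by (simp add: mix[OF hm hb])
  then show "(\<integral>\<omega>. f (X \<omega>) \<partial>M) = (\<integral>u. (\<integral>b. f b \<partial>K u) \<partial>P)"
    using l1 LIMSEQ_unique by blast
qed

end

section \<open>Flight laws\<close>

abbreviation exp1 :: "real measure" where
  "exp1 \<equiv> density lborel (exponential_density 1)"

lemma prob_space_exp1: "prob_space exp1"
  by (rule prob_space_erlang_density) simp

lemma distributed_exp1: "distributed exp1 lborel (\<lambda>\<xi>. \<xi>) (exponential_density 1)"
  by (auto simp: distributed_def distr_id2)

lemma exp1_tail: "0 \<le> a \<Longrightarrow> measure exp1 {a<..} = exp (- a)"
proof -
  assume a: "0 \<le> a"
  interpret prob_space exp1 by (rule prob_space_exp1)
  have "\<P>(\<xi> in exp1. a < \<xi>) = exp (- a * 1)"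
    by (rule exponential_distributedD_gt[OF distributed_exp1 a]) simp
  then show ?thesis by (simp add: greaterThan_def)
qed

lemma AE_exp1_pos: "AE \<xi> in exp1. 0 < \<xi>"
proof (subst AE_density)
  show "AE \<xi> in lborel. 0 < ennreal (exponential_density 1 \<xi>) \<longrightarrow> 0 < \<xi>"
    using AE_lborel_singleton[of "0::real"]
    by eventually_elim (simp add: exponential_density_def split: if_splits)
qed simp

lemma exp1_moment: "integrable exp1 (\<lambda>\<xi>. \<xi> ^ k)" "(\<integral>\<xi>. \<xi> ^ k \<partial>exp1) = fact k"
proof -
  interpret prob_space exp1 by (rule prob_space_exp1)
  show "integrable exp1 (\<lambda>\<xi>. \<xi> ^ k)"
    by (rule erlang_ith_moment_integrable[OF _ distributed_exp1]) simp
  show "(\<integral>\<xi>. \<xi> ^ k \<partial>exp1) = fact k"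
    using erlang_ith_moment[OF _ distributed_exp1, of k] by simp
qed

text \<open>The generalised inverse of a hazard function: applied to an exponential variable, it
  yields a flight time with survival function exp(-\<Lambda>).\<close>

definition crossing :: "(real \<Rightarrow> ennreal) \<Rightarrow> real \<Rightarrow> real" where
  "crossing \<Lambda> \<xi> = Inf {t. 0 \<le> t \<and> ennreal \<xi> \<le> \<Lambda> t}"

locale cumulative_hazard =
  fixes \<Lambda> :: "real \<Rightarrow> ennreal"
  assumes hazard_mono: "\<And>s t. s \<le> t \<Longrightarrow> \<Lambda> s \<le> \<Lambda> t"
    and hazard_0: "\<Lambda> 0 = 0"
    and hazard_left: "\<And>T c. 0 < T \<Longrightarrow> (\<And>s. 0 \<le> s \<Longrightarrow> s < T \<Longrightarrow> \<Lambda> s \<le> c) \<Longrightarrow> \<Lambda> T \<le> c"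
    and hazard_right: "\<And>T c. 0 \<le> T \<Longrightarrow> \<Lambda> T < \<infinity> \<Longrightarrow> (\<And>s. T < s \<Longrightarrow> c \<le> \<Lambda> s) \<Longrightarrow> c \<le> \<Lambda> T"
    and hazard_unbounded: "\<And>\<xi>. \<exists>t\<ge>0. ennreal \<xi> \<le> \<Lambda> t"
begin

lemma crossing_bdd: "bdd_below {t. 0 \<le> t \<and> ennreal \<xi> \<le> \<Lambda> t}"
  by (rule bdd_belowI[of _ 0]) auto

lemma crossing_nonneg: "0 \<le> crossing \<Lambda> \<xi>"
  unfolding crossing_def using hazard_unbounded[of \<xi>] by (intro cInf_greatest) auto

text \<open>At the infimum, left continuity bounds the hazard from above and right continuity from
  below, so the level is met exactly. This is what makes the depth at a collision an exponential
  variable up to a factor.\<close>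

lemma hazard_crossing: "\<Lambda> (crossing \<Lambda> \<xi>) = ennreal \<xi>"
proof -
  let ?S = "{t. 0 \<le> t \<and> ennreal \<xi> \<le> \<Lambda> t}" and ?T = "crossing \<Lambda> \<xi>"
  have ne: "?S \<noteq> {}" using hazard_unbounded by auto
  have before: "\<Lambda> s \<le> ennreal \<xi>" if s: "0 \<le> s" "s < ?T" for s
  proof (rule ccontr)
    assume "\<not> \<Lambda> s \<le> ennreal \<xi>"
    then have "s \<in> ?S" using s by auto
    then have "?T \<le> s" unfolding crossing_def by (rule cInf_lower[OF _ crossing_bdd])
    then show False using s by simp
  qed
  have after: "ennreal \<xi> \<le> \<Lambda> s" if s: "?T < s" for s
  proof -
    obtain t where "t \<in> ?S" "t < s"
      using s cInf_less_iff[OF ne crossing_bdd] unfolding crossing_def by blast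
    then show ?thesis using hazard_mono[of t s] by auto
  qed
  have le: "\<Lambda> ?T \<le> ennreal \<xi>"
    using crossing_nonneg[of \<xi>] hazard_left[OF _ before] hazard_0 by (cases "?T = 0") auto
  then have "\<Lambda> ?T < \<infinity>" by (rule order.strict_trans1) simp
  with le show ?thesis using hazard_right[OF crossing_nonneg _ after] by (intro antisym) auto
qed

lemma less_crossing_iff: "0 \<le> t \<Longrightarrow> t < crossing \<Lambda> \<xi> \<longleftrightarrow> \<Lambda> t < ennreal \<xi>"
proof
  assume t: "0 \<le> t" "t < crossing \<Lambda> \<xi>"
  show "\<Lambda> t < ennreal \<xi>"
  proof (rule ccontr)
    assume "\<not> \<Lambda> t < ennreal \<xi>"
    then have "crossing \<Lambda> \<xi> \<le> t" unfolding crossing_def using t by (intro cInf_lower[OF _ crossing_bdd]) auto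
    then show False using t by simp
  qed
next
  assume "\<Lambda> t < ennreal \<xi>"
  then show "t < crossing \<Lambda> \<xi>"
    using hazard_mono[of "crossing \<Lambda> \<xi>" t] hazard_crossing[of \<xi>] by (metis leD not_le)
qed

lemma crossing_borel [measurable]: "crossing \<Lambda> \<in> borel_measurable borel"
proof (rule borel_measurable_mono, rule monoI)
  fix \<xi> \<xi>' :: real assume "\<xi> \<le> \<xi>'"
  then have "ennreal \<xi> \<le> ennreal \<xi>'" by (rule ennreal_leI)
  then show "crossing \<Lambda> \<xi> \<le> crossing \<Lambda> \<xi>'"
    unfolding crossing_def using hazard_unbounded[of \<xi>']
    by (intro cInf_superset_mono crossing_bdd) (auto intro: order_trans)
qed

lemma prob_space_crossing: "prob_space (distr exp1 borel (crossing \<Lambda>))"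
  by (rule prob_space.prob_space_distr[OF prob_space_exp1]) simp

lemma crossing_tail: "0 \<le> t \<Longrightarrow> measure (distr exp1 borel (crossing \<Lambda>)) {t<..} = exp_neg (\<Lambda> t)"
proof -
  assume t: "0 \<le> t"
  interpret prob_space exp1 by (rule prob_space_exp1)
  have "measure (distr exp1 borel (crossing \<Lambda>)) {t<..} = measure exp1 {\<xi>. t < crossing \<Lambda> \<xi>}"
    by (subst measure_distr) (auto simp: vimage_def)
  also have "{\<xi>. t < crossing \<Lambda> \<xi>} = {\<xi>. \<Lambda> t < ennreal \<xi>}"
    using less_crossing_iff[OF t] by simp
  also have "\<dots> = (if \<Lambda> t = \<infinity> then {} else {enn2real (\<Lambda> t)<..})"
  proof (cases "\<Lambda> t = \<infinity>")
    case False
    then obtain l where l: "0 \<le> l" "\<Lambda> t = ennreal l" by (cases "\<Lambda> t") auto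
    then show ?thesis by (auto simp: ennreal_less_iff)
  qed auto
  also have "measure exp1 \<dots> = exp_neg (\<Lambda> t)"
    using exp1_tail[of "enn2real (\<Lambda> t)"] by (simp add: exp_neg_def)
  finally show ?thesis .
qed

end

text \<open>Supplies the uniqueness that the definite description in \<open>flight_law\<close>
  demands; the complements of the tails are the values of the distribution function.\<close>

lemma real_distribution_eqI_tail:
  assumes "prob_space \<mu>" "sets \<mu> = sets borel" "prob_space \<nu>" "sets \<nu> = sets borel"
    and "measure \<mu> {..<0} = (0::real)" "measure \<nu> {..<0} = (0::real)"
    and tail: "\<And>t. 0 \<le> t \<Longrightarrow> measure \<mu> {t<..} = measure \<nu> {t<..}"
  shows "\<mu> = (\<nu> :: real measure)"
proof -
  interpret \<mu>: prob_space \<mu> by fact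
  interpret \<nu>: prob_space \<nu> by fact
  have rd: "real_distribution \<mu>" "real_distribution \<nu>"
    by (auto intro!: real_distribution.intro real_distribution_axioms.intro assms)
  have sp: "space \<mu> = UNIV" "space \<nu> = UNIV"
    using assms(2,4)[THEN sets_eq_imp_space_eq] by auto
  have "cdf \<mu> t = cdf \<nu> t" for t
  proof (cases "0 \<le> t")
    case True
    have c: "{..t} = UNIV - {t<..}" by auto
    have "measure \<mu> {..t} = 1 - measure \<mu> {t<..}"
      using \<mu>.prob_compl[of "{t<..}"] assms(2) by (simp add: c sp)
    moreover have "measure \<nu> {..t} = 1 - measure \<nu> {t<..}"
      using \<nu>.prob_compl[of "{t<..}"] assms(4) by (simp add: c sp)
    ultimately show ?thesis using tail[OF True] by (simp add: cdf_def)
  next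
    case False
    have "measure \<mu> {..t} \<le> measure \<mu> {..<0}"
      by (rule \<mu>.finite_measure_mono) (use False assms(2) in auto)
    moreover have "measure \<nu> {..t} \<le> measure \<nu> {..<0}"
      by (rule \<nu>.finite_measure_mono) (use False assms(4) in auto)
    ultimately show ?thesis using assms(5,6) by (simp add: cdf_def measure_le_0_iff)
  qed
  then show ?thesis by (intro cdf_unique rd ext)
qed

text \<open>Turns the description by survival probabilities into a coupling with one exponential
  variable, so that integrals over the flight time become integrals over
  \<open>exp1\<close>.\<close>

lemma flight_law_eq:
  assumes "cumulative_hazard (optical_depth G V y)"
  shows "flight_law G V y = distr exp1 borel (crossing (optical_depth G V y))"
  unfolding flight_law_def
proof (rule the_equality)
  interpret cumulative_hazard "optical_depth G V y" by fact
  let ?\<nu> = "distr exp1 borel (crossing (optical_depth G V y))"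
  have "(crossing (optical_depth G V y) -` {..<0}) = {}"
  proof -
    have "\<not> crossing (optical_depth G V y) \<xi> < 0" for \<xi> using crossing_nonneg[of \<xi>] by simp
    then show ?thesis by (simp add: vimage_def)
  qed
  then have neg: "measure ?\<nu> {..<0} = 0" by (subst measure_distr) auto
  show "prob_space ?\<nu> \<and> sets ?\<nu> = sets borel \<and> measure ?\<nu> {..<0} = 0 \<and>
    (\<forall>t\<ge>0. measure ?\<nu> {t<..} = exp_neg (optical_depth G V y t))"
    using prob_space_crossing neg crossing_tail by simp
  fix \<nu> :: "real measure"
  assume "prob_space \<nu> \<and> sets \<nu> = sets borel \<and> measure \<nu> {..<0} = 0 \<and>
    (\<forall>t\<ge>0. measure \<nu> {t<..} = exp_neg (optical_depth G V y t))"
  then show "\<nu> = ?\<nu>"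
    using prob_space_crossing neg crossing_tail by (intro real_distribution_eqI_tail) auto
qed

section \<open>Radial gradients\<close>

text \<open>On the boundary spheres of the shell \<open>{z. norm z \<in> D}\<close> only one-sided increments are available.
  The gradient is still unique, since the curves \<open>\<gamma>\<close> below, whose norm moves linearly from
  \<open>norm x\<close> to another point \<open>b\<close> of \<open>D\<close>, leave \<open>x\<close> in enough directions.\<close>

lemma radial_gradient_unique:
  fixes x :: "real^3"
  assumes D: "convex D" "norm x \<in> D" "b \<in> D" "b \<noteq> norm x" and x: "x \<noteq> 0"
    and G1: "(F has_derivative (\<lambda>h. G1 \<bullet> h)) (at x within {z. norm z \<in> D})"
    and G2: "(F has_derivative (\<lambda>h. G2 \<bullet> h)) (at x within {z. norm z \<in> D})"
    and D_nonneg: "\<And>r. r \<in> D \<Longrightarrow> 0 \<le> r"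
  shows "G1 = G2"
proof -
  let ?r = "norm x"
  have r: "0 < ?r" using x by simp
  have key: "(G1 - G2) \<bullet> ((b - ?r) *\<^sub>R (x /\<^sub>R ?r) + (k - (x \<bullet> k / ?r\<^sup>2) *\<^sub>R x)) = 0" for k
  proof -
    \<comment> \<open>For \<open>t \<le> e\<close> the vector \<open>t *\<^sub>R k\<close> is
      shorter than \<open>x\<close>, so \<open>x + t *\<^sub>R k\<close> has a direction;
      \<open>e \<le> 1\<close> keeps the prescribed norm between \<open>norm x\<close> and
      \<open>b\<close>.\<close>
    define e where "e = min 1 (?r / (2 * (norm k + 1)))"
    have kp: "0 < 2 * (norm k + 1)" using add_nonneg_pos[OF norm_ge_zero[of k], of 1] by simp
    have "e \<le> ?r / (2 * (norm k + 1))" by (simp only: e_def min.cobounded2)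
    then have "e * (2 * (norm k + 1)) \<le> ?r" by (simp only: pos_le_divide_eq[OF kp])
    moreover have "0 < e" "e \<le> 1" unfolding e_def using divide_pos_pos[OF r kp] by auto
    ultimately have e: "0 < e" "e \<le> 1" "e * (2 * (norm k + 1)) \<le> ?r" by auto
    have nz: "x + t *\<^sub>R k \<noteq> 0" if t: "t \<in> {0..e}" for t
    proof
      assume "x + t *\<^sub>R k = 0"
      then have "x = - (t *\<^sub>R k)" by (simp add: eq_neg_iff_add_eq_0)
      then have "?r = t * norm k" using t by simp
      also have "\<dots> \<le> e * (norm k + 1)" using t by (intro mult_mono) auto
      also have "\<dots> < e * (2 * (norm k + 1))" using e(1) kp by (intro mult_strict_left_mono) auto
      finally show False using e(3) by simp
    qed
    define \<gamma> where "\<gamma> t = ((?r + t * (b - ?r)) / norm (x + t *\<^sub>R k)) *\<^sub>R (x + t *\<^sub>R k)" for t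
    have \<gamma>D: "norm (\<gamma> t) \<in> D" if t: "t \<in> {0..e}" for t
    proof -
      have "(1 - t) *\<^sub>R ?r + t *\<^sub>R b \<in> D" using D t e by (intro convexD) auto
      then have m: "?r + t * (b - ?r) \<in> D" by (simp add: algebra_simps)
      then show ?thesis using nz[OF t] D_nonneg[OF m] by (simp add: \<gamma>_def)
    qed
    have \<gamma>0: "\<gamma> 0 = x" using r by (simp add: \<gamma>_def)
    have lin: "((\<lambda>t. x + t *\<^sub>R k) has_derivative (\<lambda>h. h *\<^sub>R k)) (at 0 within {0..e})"
      by (auto intro!: derivative_eq_intros)
    have nd: "((\<lambda>t. norm (x + t *\<^sub>R k)) has_real_derivative (x \<bullet> k) / ?r) (at 0 within {0..e})"
    proof -
      have x0: "x + 0 *\<^sub>R k \<noteq> 0" using x by simp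
      show ?thesis
        unfolding has_field_derivative_def
        by (rule has_derivative_eq_rhs[OF has_derivative_compose[OF lin has_derivative_norm[OF x0]]])
          (auto simp: sgn_div_norm inner_commute divide_simps)
    qed
    have qd: "((\<lambda>t. (?r + t * (b - ?r)) / norm (x + t *\<^sub>R k)) has_real_derivative
        ((b - ?r) * ?r - ?r * ((x \<bullet> k) / ?r)) / (?r * ?r)) (at 0 within {0..e})"
    proof -
      have "((\<lambda>t. ?r + t * (b - ?r)) has_real_derivative (b - ?r)) (at 0 within {0..e})"
        by (auto intro!: derivative_eq_intros)
      from DERIV_divide[OF this nd] show ?thesis using x by simp
    qed
    have coeff: "((b - ?r) * ?r - ?r * ((x \<bullet> k) / ?r)) / (?r * ?r) = (b - ?r) / ?r - x \<bullet> k / ?r\<^sup>2"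
      using r by (simp add: field_simps power2_eq_square)
    have "(\<gamma> has_derivative (\<lambda>h. h *\<^sub>R ((b - ?r) *\<^sub>R (x /\<^sub>R ?r) + (k - (x \<bullet> k / ?r\<^sup>2) *\<^sub>R x)))) (at 0 within {0..e})"
      unfolding \<gamma>_def
      by (rule has_derivative_eq_rhs[OF has_derivative_scaleR[OF qd[unfolded has_field_derivative_def] lin]])
        (use r in \<open>simp add: fun_eq_iff coeff divide_inverse power2_eq_square algebra_simps\<close>)
    note \<gamma>' = this
    have "((\<lambda>t. F (\<gamma> t)) has_derivative (\<lambda>h. G \<bullet> (h *\<^sub>R ((b - ?r) *\<^sub>R (x /\<^sub>R ?r) + (k - (x \<bullet> k / ?r\<^sup>2) *\<^sub>R x))))) (at 0 within {0..e})"
      if "(F has_derivative (\<lambda>h. G \<bullet> h)) (at x within {z. norm z \<in> D})" for G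
    proof (rule has_derivative_in_compose[OF \<gamma>'])
      show "(F has_derivative (\<lambda>h. G \<bullet> h)) (at (\<gamma> 0) within \<gamma> ` {0..e})"
        unfolding \<gamma>0 by (rule has_derivative_subset[OF that]) (use \<gamma>D in auto)
    qed
    from this[OF G1] this[OF G2]
    have "G1 \<bullet> ((b - ?r) *\<^sub>R (x /\<^sub>R ?r) + (k - (x \<bullet> k / ?r\<^sup>2) *\<^sub>R x)) =
        G2 \<bullet> ((b - ?r) *\<^sub>R (x /\<^sub>R ?r) + (k - (x \<bullet> k / ?r\<^sup>2) *\<^sub>R x))"
      using e(1) by (intro vector_derivative_unique_within_closed_interval[of 0 e 0 "\<lambda>t. F (\<gamma> t)"])
        (auto simp: has_vector_derivative_def)
    then show ?thesis by (simp add: inner_diff_left)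
  qed
  \<comment> \<open>The choice \<open>k = 0\<close> leaves only the radial part, which is a nonzero
    multiple of \<open>x\<close> as \<open>b \<noteq> norm x\<close>. Once it is removed,
    \<open>k\<close> itself is an arbitrary direction.\<close>
  have gx: "(G1 - G2) \<bullet> x = 0" using key[of 0] D(4) r by simp
  then have "(G1 - G2) \<bullet> k = 0" for k
    using key[of k] by (simp add: inner_add_right inner_diff_right)
  then show ?thesis using inner_eq_zero_iff[of "G1 - G2"] by simp
qed

lemma radial_grad_eq:
  fixes x :: "real^3"
  assumes D: "convex D" "norm x \<in> D" "b \<in> D" "b \<noteq> norm x" and x: "x \<noteq> 0"
    and D_nonneg: "\<And>r. r \<in> D \<Longrightarrow> 0 \<le> r"
    and f: "(f has_real_derivative f') (at (norm x) within D)"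
  shows "radial_grad D f x = (f' / norm x) *\<^sub>R x"
  unfolding radial_grad_def
proof (rule the_equality)
  have n: "(norm has_derivative (\<lambda>h. inner (sgn x) h)) (at x within {z. norm z \<in> D})"
    by (rule has_derivative_at_withinI)
      (use has_derivative_norm[OF x] in \<open>simp add: inner_commute\<close>)
  have "(f has_derivative (\<lambda>h. h * f')) (at (norm x) within norm ` {z::real^3. norm z \<in> D})"
    by (rule has_derivative_subset[OF f[THEN has_field_derivative_imp_has_derivative, unfolded mult.commute[of f']]]) auto
  from has_derivative_in_compose[OF n this]
  show d: "((\<lambda>z. f (norm z)) has_derivative (\<lambda>h. ((f' / norm x) *\<^sub>R x) \<bullet> h)) (at x within {z. norm z \<in> D})"
    by (rule has_derivative_eq_rhs) (auto simp: sgn_div_norm divide_inverse fun_eq_iff)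
  fix G assume "((\<lambda>z. f (norm z)) has_derivative (\<lambda>h. G \<bullet> h)) (at x within {z. norm z \<in> D})"
  then show "G = (f' / norm x) *\<^sub>R x"
    using radial_gradient_unique[OF D x _ d D_nonneg] by blast
qed

section \<open>Radial motion\<close>

text \<open>\<open>L\<close> is the interval from \<open>0\<close> to the lifetime. The velocity \<open>p\<close> is specified only away from the
  zeros of \<open>z\<close>; \<open>p 0\<close> is the initial velocity.\<close>

locale radial_motion =
  fixes m E :: real and D :: "real set" and U U' :: "real \<Rightarrow> real"
    and z p :: "real \<Rightarrow> 'a::euclidean_space" and L :: "real set"
  assumes m_pos: "0 < m"
    and D_nonneg: "\<And>r. r \<in> D \<Longrightarrow> 0 \<le> r"
    and U_deriv: "\<And>r. r \<in> D \<Longrightarrow> 0 < r \<Longrightarrow> (U has_real_derivative U' r) (at r within D)"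
    and U'_cont: "continuous_on (D - {0}) U'"
    and U_le: "\<And>r. r \<in> D \<Longrightarrow> 0 < r \<Longrightarrow> U r \<le> E"
    and lifetime: "L = {0..} \<or>
      (\<exists>b>0. L = {0..<b} \<and> filterlim (\<lambda>t. norm (z t)) at_top (at_left b))"
    and outside: "\<And>t. t \<notin> L \<Longrightarrow> z t = 0"
    and in_D: "\<And>t. t \<in> L \<Longrightarrow> norm (z t) \<in> D"
    and cont: "continuous_on L z"
    and start_nz: "z 0 \<noteq> 0"
    and start_velocity: "(z has_vector_derivative p 0) (at 0 within {0..})"
    and start_energy: "norm (p 0) = speed m E U (norm (z 0))"
    and velocity: "\<And>t. t \<in> L \<Longrightarrow> 0 < t \<Longrightarrow> z t \<noteq> 0 \<Longrightarrow> (z has_vector_derivative p t) (at t)"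
    and accel: "\<And>t. t \<in> L \<Longrightarrow> 0 < t \<Longrightarrow> z t \<noteq> 0 \<Longrightarrow>
      (p has_vector_derivative (- (U' (norm (z t)) / (m * norm (z t)))) *\<^sub>R z t) (at t)"
    and reflect: "\<And>T s. 0 < T \<Longrightarrow> z T = 0 \<Longrightarrow> 0 \<le> s \<Longrightarrow> s \<le> T \<Longrightarrow> T + s \<in> L \<Longrightarrow>
      \<forall>t\<in>{T - s<..<T}. z t \<noteq> 0 \<Longrightarrow> z (T + s) = - z (T - s)"
begin

abbreviation "v \<equiv> speed m E U"

definition acc :: "real \<Rightarrow> 'a" where
  "acc t = (- (U' (norm (z t)) / (m * norm (z t)))) *\<^sub>R z t"

lemma zero_in_L: "0 \<in> L"
  using lifetime by auto

lemma L_down: "t \<in> L \<Longrightarrow> 0 \<le> s \<Longrightarrow> s \<le> t \<Longrightarrow> s \<in> L"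
  using lifetime by auto

lemma L_nonneg: "t \<in> L \<Longrightarrow> 0 \<le> t"
  using lifetime by auto

lemma L_open_right: "t \<in> L \<Longrightarrow> \<exists>d>0. t + d \<in> L"
proof -
  assume t: "t \<in> L"
  from lifetime show ?thesis
  proof
    assume "L = {0..}" then show ?thesis using t by (intro exI[of _ 1]) auto
  next
    assume "\<exists>b>0. L = {0..<b} \<and> filterlim (\<lambda>t. norm (z t)) at_top (at_left b)"
    then obtain b where "L = {0..<b}" by auto
    then show ?thesis using t by (intro exI[of _ "(b - t) / 2"]) (auto simp: field_simps)
  qed
qed

lemma L_sub: "b \<in> L \<Longrightarrow> 0 \<le> a \<Longrightarrow> {a..b} \<subseteq> L"
  using L_down by auto

lemma norm_pos_D: "t \<in> L \<Longrightarrow> z t \<noteq> 0 \<Longrightarrow> norm (z t) \<in> D - {0}"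
  using in_D by auto

lemma acc_cont: "(\<And>t. t \<in> {a..b} \<Longrightarrow> z t \<noteq> 0) \<Longrightarrow> {a..b} \<subseteq> L \<Longrightarrow> continuous_on {a..b} acc"
  unfolding acc_def using m_pos
  by (intro continuous_intros continuous_on_compose2[OF U'_cont] continuous_on_subset[OF cont])
    (auto simp: in_D)

lemma start_nbhd: "\<exists>d>0. d \<in> L \<and> (\<forall>t\<in>{0..d}. z t \<noteq> 0)"
proof -
  obtain e where e: "e > 0" "0 + e \<in> L" using L_open_right[OF zero_in_L] by auto
  have "continuous_on {0..e} z" using e by (intro continuous_on_subset[OF cont L_sub]) auto
  then have "\<forall>\<^sub>F t in at 0 within {0..e}. z t \<noteq> 0"
    using e start_nz by (intro tendsto_imp_eventually_ne[of z "z 0"]) (auto simp: continuous_on_def)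
  then obtain d where d: "d > 0" "\<And>t. t \<in> {0..e} \<Longrightarrow> 0 < dist t 0 \<Longrightarrow> dist t 0 < d \<Longrightarrow> z t \<noteq> 0"
    unfolding eventually_at by auto
  show ?thesis
  proof (intro exI conjI ballI)
    show "0 < min e (d/2)" using e d by auto
    show "min e (d/2) \<in> L" using e d L_down[of e] by auto
    fix t assume "t \<in> {0..min e (d/2)}"
    then show "z t \<noteq> 0" using d(2)[of t] d(1) start_nz by (cases "t = 0") auto
  qed
qed

text \<open>The equation of motion bounds the acceleration near time \<open>0\<close>, so the velocity has a limit
  there, which must be the prescribed initial velocity.\<close>

lemma p_cont:
  assumes "b \<in> L" "0 \<le> a" "\<And>t. t \<in> {a..b} \<Longrightarrow> z t \<noteq> 0"
  shows "continuous_on {a..b} p"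
proof -
  have pos: "isCont p t" if "t \<in> {a..b}" "0 < t" for t
    using accel[of t] that assms L_sub[of b a] has_vector_derivative_continuous by blast
  have zero: "continuous (at 0 within {0..d}) p"
    if d: "d > 0" "d \<in> L" "\<And>t. t \<in> {0..d} \<Longrightarrow> z t \<noteq> 0" for d
  proof -
    \<comment> \<open>The primitive of the acceleration that agrees with \<open>p\<close> at
      \<open>d\<close>; unlike \<open>p\<close>, it is continuous at time 0 by construction.\<close>
    define P where "P t = p d - integral {0..d} acc + integral {0..t} acc" for t
    have ac: "continuous_on {0..d} acc" using d L_sub[of d 0] by (intro acc_cont) auto
    have P': "(P has_vector_derivative acc t) (at t within {0..d})" if "t \<in> {0..d}" for t
      unfolding P_def by (auto intro!: derivative_eq_intros integral_has_vector_derivative ac that)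
    have Pc: "continuous_on {0..d} P"
      using P' by (meson continuous_on_eq_continuous_within has_vector_derivative_continuous)
    have Pp: "P t = p t" if t: "t \<in> {0<..d}" for t
    proof -
      have "continuous_on {t..d} p"
      proof (rule continuous_at_imp_continuous_on, rule ballI)
        fix s assume "s \<in> {t..d}"
        then show "isCont p s"
          using t d L_down[of d s] by (intro has_vector_derivative_continuous[OF accel]) auto
      qed
      then have "(acc has_integral (p d - p t)) {t..d}"
        using t d L_sub[of d 0]
        by (intro fundamental_theorem_of_calculus_interior) (auto simp: acc_def intro!: accel[unfolded scaleR_minus_left])
      moreover have "(acc has_integral (P d - P t)) {t..d}"
        using t by (intro fundamental_theorem_of_calculus)
          (auto intro!: has_vector_derivative_within_subset[OF P'])
      ultimately have "p d - p t = P d - P t" by (rule has_integral_unique)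
      then show ?thesis by (simp add: P_def algebra_simps)
    qed
    have zc: "continuous_on {0..t} z" if "t \<in> {0..d}" for t
      using L_down[of d t] that d by (intro continuous_on_subset[OF cont L_sub]) auto
    have "(P has_integral (z t - z 0)) {0..t}" if t: "t \<in> {0..d}" for t
    proof (rule fundamental_theorem_of_calculus_interior)
      show "0 \<le> t" "continuous_on {0..t} z" using t zc by auto
      fix s assume "s \<in> {0<..<t}"
      then show "(z has_vector_derivative P s) (at s)"
        using velocity[of s] Pp[of s] t d L_down[of d s] by auto
    qed
    then have I: "integral {0..t} P = z t - z 0" if "t \<in> {0..d}" for t
      using that by blast
    \<comment> \<open>As \<open>z\<close> is the integral of \<open>P\<close>, its one-sided
      derivative at 0 is \<open>P 0\<close>, which uniqueness then identifies with
      \<open>p 0\<close>.\<close>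
    have "((\<lambda>t. integral {0..t} P) has_vector_derivative P 0) (at 0 within {0..d})"
      using d Pc by (intro integral_has_vector_derivative) auto
    then have "((\<lambda>t. z t - z 0) has_vector_derivative P 0) (at 0 within {0..d})"
      by (rule has_vector_derivative_transform[rotated 2]) (use d I in auto)
    then have "(z has_vector_derivative P 0) (at 0 within {0..d})"
      using has_vector_derivative_add[of "\<lambda>t. z t - z 0" "P 0" "at 0 within {0..d}" "\<lambda>_. z 0" 0] by simp
    moreover have "(z has_vector_derivative p 0) (at 0 within {0..d})"
      using start_velocity by (rule has_vector_derivative_within_subset) auto
    ultimately have "P 0 = p 0"
      using d vector_derivative_unique_within_closed_interval[of 0 d 0] by auto
    then have eq: "P t = p t" if "t \<in> {0..d}" for t using that Pp by (cases "t = 0") auto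
    have "continuous_on {0..d} p" using Pc continuous_on_cong[of "{0..d}" "{0..d}" P p] eq by auto
    then show ?thesis using d by (simp add: continuous_on_eq_continuous_within)
  qed
  show ?thesis
    unfolding continuous_on_eq_continuous_within
  proof
    fix t assume t: "t \<in> {a..b}"
    show "continuous (at t within {a..b}) p"
    proof (cases "t = 0")
      case False
      then show ?thesis using pos[OF t] t assms by (auto intro: continuous_at_imp_continuous_at_within)
    next
      case True
      then have a: "a = 0" using t assms by auto
      show ?thesis
      proof (cases "b = 0")
        case True then show ?thesis using a \<open>t = 0\<close> by (simp add: continuous_within at_within_def)
      next
        case False
        then show ?thesis using zero[of b] a assms t \<open>t = 0\<close> by auto
      qed
    qed
  qed
qed

lemma U_cont: "continuous_on (D - {0}) U"
  unfolding continuous_on_eq_continuous_within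
proof
  fix r assume r: "r \<in> D - {0}"
  then have "0 < r" using D_nonneg[of r] by auto
  then have "continuous (at r within D) U"
    using r by (intro DERIV_continuous[OF U_deriv]) auto
  then show "continuous (at r within D - {0}) U" by (rule continuous_within_subset) auto
qed

definition energy :: "real \<Rightarrow> real" where
  "energy t = m / 2 * (p t \<bullet> p t) + U (norm (z t))"

lemma energy_const:
  assumes b: "b \<in> L" and ab: "0 \<le> a" "a \<le> b" and nz: "\<And>t. t \<in> {a..b} \<Longrightarrow> z t \<noteq> 0"
  shows "energy b = energy a"
proof -
  have sub: "{a..b} \<subseteq> L" using b ab L_sub by auto
  have zc: "continuous_on {a..b} z" by (rule continuous_on_subset[OF cont sub])
  have ec: "continuous_on {a..b} energy"
    unfolding energy_def
  proof (intro continuous_intros p_cont b ab nz)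
    show "continuous_on {a..b} (\<lambda>t. U (norm (z t)))"
      by (rule continuous_on_compose2[OF U_cont, of _ "\<lambda>t. norm (z t)"])
        (use norm_pos_D nz sub in \<open>auto intro!: continuous_intros zc\<close>)
  qed auto
  have ed: "(energy has_vector_derivative 0) (at t)" if t: "t \<in> {a<..<b}" for t
  proof -
    have tL: "t \<in> L" "0 < t" "z t \<noteq> 0" using t ab sub nz by auto
    have n: "((\<lambda>s. norm (z s)) has_real_derivative (z t \<bullet> p t) / norm (z t)) (at t within {a..b})"
    proof -
      have z: "(z has_derivative (\<lambda>h. h *\<^sub>R p t)) (at t within {a..b})"
        using velocity[OF tL] by (auto simp: has_vector_derivative_def intro: has_derivative_at_withinI)
      show ?thesis
        unfolding has_field_derivative_def
        using has_derivative_compose[OF z has_derivative_norm[OF tL(3)]]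
        by (rule has_derivative_eq_rhs) (auto simp: sgn_div_norm inner_commute divide_simps)
    qed
    \<comment> \<open>At a turning radius the derivative of \<open>U\<close> is one-sided. That
      suffices, since the norm of the path takes its values in \<open>D\<close>.\<close>
    have "(U has_real_derivative U' (norm (z t))) (at (norm (z t)) within (\<lambda>s. norm (z s)) ` {a..b})"
    proof (rule DERIV_subset)
      show "(U has_real_derivative U' (norm (z t))) (at (norm (z t)) within D)"
        using U_deriv[of "norm (z t)"] tL in_D by auto
      show "(\<lambda>s. norm (z s)) ` {a..b} \<subseteq> D" using sub in_D by auto
    qed
    from DERIV_image_chain[OF this n]
    have u: "((\<lambda>s. U (norm (z s))) has_real_derivative U' (norm (z t)) * ((z t \<bullet> p t) / norm (z t))) (at t)"
      using at_within_interior[of t "{a..b}"] t by (simp add: o_def)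
    have "((\<lambda>s. p s \<bullet> p s) has_real_derivative 2 * (p t \<bullet> acc t)) (at t)"
    proof -
      have d: "(p has_derivative (\<lambda>h. h *\<^sub>R acc t)) (at t)"
        using accel[OF tL] by (simp add: has_vector_derivative_def acc_def)
      show ?thesis
        unfolding has_field_derivative_def
        by (rule has_derivative_eq_rhs[OF has_derivative_inner[OF d d]]) (auto simp: inner_commute)
    qed
    then have "(energy has_real_derivative m / 2 * (2 * (p t \<bullet> acc t)) + U' (norm (z t)) * ((z t \<bullet> p t) / norm (z t))) (at t)"
      unfolding energy_def by (intro DERIV_add DERIV_cmult u)
    moreover have "m / 2 * (2 * (p t \<bullet> acc t)) + U' (norm (z t)) * ((z t \<bullet> p t) / norm (z t)) = 0"
      using m_pos tL by (simp add: acc_def inner_commute field_simps)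
    ultimately show ?thesis by (simp add: has_real_derivative_iff_has_vector_derivative)
  qed
  have "((\<lambda>_. 0) has_integral (energy b - energy a)) {a..b}"
    using fundamental_theorem_of_calculus_interior[OF ab(2) ec ed] by simp
  then show ?thesis using has_integral_unique[of "\<lambda>_. 0::real" _ "{a..b}" 0] by fastforce
qed

section \<open>Passages through the origin and conservation of energy across them\<close>

lemma least_zero:
  assumes "T \<in> L" "z T = 0" "0 \<le> c" "c \<le> T"
  obtains a where "c \<le> a" "a \<le> T" "z a = 0" "\<And>t. c \<le> t \<Longrightarrow> t < a \<Longrightarrow> z t \<noteq> 0"
proof -
  have c: "continuous_on {c..T} z" by (rule continuous_on_subset[OF cont L_sub[OF assms(1,3)]])
  define K where "K = {c..T} \<inter> z -` {0}"
  have "closed K" unfolding K_def using c by (intro continuous_closed_preimage) auto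
  moreover have "bounded K" by (rule bounded_subset[of "{c..T}"]) (auto simp: K_def)
  ultimately have "compact K" by (simp add: compact_eq_bounded_closed)
  moreover have "K \<noteq> {}" using assms by (auto simp: K_def)
  ultimately obtain a where a: "a \<in> K" "\<And>t. t \<in> K \<Longrightarrow> a \<le> t"
    using compact_attains_inf[of K] by auto
  show thesis
  proof
    show "c \<le> a" "a \<le> T" "z a = 0" using a(1) by (auto simp: K_def)
    fix t assume "c \<le> t" "t < a"
    then show "z t \<noteq> 0" using a(2)[of t] a(1) by (auto simp: K_def)
  qed
qed

text \<open>By the reflection rule, a zero-free interval to the left of a zero has a mirror image to the
  right of it. So no gap between zeros is shorter than the time of the first one.\<close>

lemma zero_gap: "\<exists>d>0. \<forall>T\<in>L. z T = 0 \<longrightarrow> d \<le> T \<and> (\<forall>t\<in>{T-d<..<T}. z t \<noteq> 0)"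
proof (cases "\<exists>T\<in>L. z T = 0")
  case False then show ?thesis by (intro exI[of _ 1]) auto
next
  case True
  then obtain T0 where T0: "T0 \<in> L" "z T0 = 0" by auto
  obtain d where d: "0 \<le> d" "d \<le> T0" "z d = 0" "\<And>t. 0 \<le> t \<Longrightarrow> t < d \<Longrightarrow> z t \<noteq> 0"
    using least_zero[OF T0 order_refl L_nonneg[OF T0(1)]] by blast
  have d0: "0 < d" using d start_nz by (auto simp: order_le_less)
  have first: "d \<le> t" if "t \<in> L" "z t = 0" for t
    using d(4)[of t] that L_nonneg[OF that(1)] by force
  \<comment> \<open>A zero \<open>a\<close> that is preceded by a gap of length \<open>d\<close> is
    also followed by one.\<close>
  have mirror: "z t \<noteq> 0" if a: "a \<in> L" "z a = 0" "\<forall>s\<in>{a-d<..<a}. z s \<noteq> 0"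
    and t: "t \<in> L" "a < t" "t < a + d" for a t
  proof -
    have "z (a + (t - a)) = - z (a - (t - a))"
      using t a first[OF a(1,2)] d0 by (intro reflect) auto
    moreover have "z (a - (t - a)) \<noteq> 0" using t by (intro a(3)[rule_format]) auto
    ultimately show ?thesis by simp
  qed
  have gap: "\<forall>t\<in>L. t < real k * d \<longrightarrow> z t = 0 \<longrightarrow> (\<forall>s\<in>{t-d<..<t}. z s \<noteq> 0)" for k
  proof (induction k)
    case 0 then show ?case using L_nonneg by force
  next
    case (Suc k)
    have "\<forall>s\<in>{t-d<..<t}. z s \<noteq> 0" if t: "t \<in> L" "t < real (Suc k) * d" "z t = 0" for t
    proof (cases "t < real k * d")
      case True
      then show ?thesis using Suc t by blast
    next
      \<comment> \<open>Induction over time blocks of length \<open>d\<close>. Let \<open>a\<close>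
        be the first zero in the last block. A zero \<open>s\<close> closer than \<open>d\<close>
        before \<open>a\<close> would belong to an earlier block, and its mirrored gap would exclude
        \<open>a\<close>. So \<open>a\<close> has its gap, and the mirrored gap excludes every other
        zero up to \<open>t\<close>.\<close>
      case False
      then obtain a where a: "real k * d \<le> a" "a \<le> t" "z a = 0"
        "\<And>s. real k * d \<le> s \<Longrightarrow> s < a \<Longrightarrow> z s \<noteq> 0"
        using least_zero[OF t(1,3), of "real k * d"] d0 by auto
      have kd: "0 \<le> real k * d" using d0 by simp
      have aL: "a \<in> L" using L_down[OF t(1), of a] a(1,2) kd by linarith
      have good: "\<forall>s\<in>{a-d<..<a}. z s \<noteq> 0"
      proof (intro ballI notI)
        fix s assume s: "s \<in> {a-d<..<a}" "z s = 0"
        then have sk: "s < real k * d" using a(4)[of s] by fastforce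
        have "0 \<le> s" using first[OF aL a(3)] s by auto
        then have sL: "s \<in> L" using L_down[OF aL, of s] s by auto
        show False using mirror[OF sL s(2) _ aL] s Suc[rule_format, OF sL sk s(2)] a(3) by auto
      qed
      have "t < a + d" using a(1) t(2) by (simp add: algebra_simps)
      then have "t = a" using mirror[OF aL a(3) good t(1)] t(3) a(2) by force
      then show ?thesis using good by simp
    qed
    then show ?case by blast
  qed
  have "\<forall>s\<in>{t-d<..<t}. z s \<noteq> 0" if "t \<in> L" "z t = 0" for t
  proof -
    obtain k :: nat where "t / d < k" using reals_Archimedean2 by blast
    then have "t < real k * d" using d0 by (simp only: pos_divide_less_eq)
    then show ?thesis using gap that by blast
  qed
  then show ?thesis using d0 first by blast
qed

lemma finite_zeros:
  assumes "b \<in> L" shows "finite {t\<in>{0..b}. z t = 0}"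
proof -
  obtain d where d: "d > 0" "\<And>T. T\<in>L \<Longrightarrow> z T = 0 \<Longrightarrow> d \<le> T \<and> (\<forall>t\<in>{T-d<..<T}. z t \<noteq> 0)"
    using zero_gap by blast
  have "uniform_discrete {t\<in>{0..b}. z t = 0}"
    unfolding uniform_discrete_def
  proof (intro exI conjI ballI impI)
    show "d > 0" by fact
    fix s t assume st: "s \<in> {t\<in>{0..b}. z t = 0}" "t \<in> {t\<in>{0..b}. z t = 0}" "dist s t < d"
    have sL: "s \<in> L" "t \<in> L" using st L_down[OF assms] by auto
    have "\<not> a < b" if "a \<in> L" "b \<in> L" "z a = 0" "z b = 0" "dist a b < d" for a b
      using d(2)[OF that(2,4), THEN conjunct2, rule_format, of a] that by (auto simp: dist_real_def)
    from this[of s t] this[of t s] show "s = t" using st sL by (auto simp: dist_commute)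
  qed
  moreover have "bounded {t\<in>{0..b}. z t = 0}" by (rule bounded_subset[of "{0..b}"]) auto
  ultimately show ?thesis using uniform_discrete_finite_iff by blast
qed

text \<open>Differentiating the reflection rule produces two signs, from the rule and from the
  reversed time, which cancel.\<close>

lemma reflect_velocity:
  assumes T: "T \<in> L" "z T = 0" and d: "d \<le> T" "\<And>t. t \<in> {T-d<..<T} \<Longrightarrow> z t \<noteq> 0"
    and s: "0 < s" "s < d" "T + s \<in> L"
  shows "p (T + s) = p (T - s)"
proof -
  have "0 < T" using L_nonneg[OF T(1)] T start_nz by (auto simp: order_le_less)
  have r: "z (T + r) = - z (T - r)" if "0 \<le> r" "r < d" "T + r \<in> L" for r
    using that d \<open>0 < T\<close> T by (intro reflect) auto
  have nz: "z (T - s) \<noteq> 0" using d s by auto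
  have TsL: "T - s \<in> L" "0 < T - s" using L_down[OF T(1), of "T - s"] d s by auto
  have 1: "(z has_vector_derivative p (T + s)) (at (T + s))"
    using r[of s] s nz \<open>0 < T\<close> by (intro velocity) auto
  have "((\<lambda>t. 2 * T - t) has_real_derivative -1) (at (T + s))" by (auto intro!: derivative_eq_intros)
  moreover have "(z has_vector_derivative p (T - s)) (at (2 * T - (T + s)))"
    using velocity[OF TsL nz] by (simp add: algebra_simps)
  ultimately have "((z \<circ> (\<lambda>t. 2 * T - t)) has_vector_derivative (-1) *\<^sub>R p (T - s)) (at (T + s))"
    by (intro vector_diff_chain_at) (auto simp: has_real_derivative_iff_has_vector_derivative)
  then have der: "((\<lambda>t. - z (2 * T - t)) has_vector_derivative p (T - s)) (at (T + s))"
    using has_vector_derivative_minus by (fastforce simp: o_def)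
  obtain e where e: "e > 0" "T + s + e \<in> L" using L_open_right[OF s(3)] by auto
  have eq: "- z (2 * T - t) = z t" if "t \<in> {T<..<min (T + s + e) (T + d)}" for t
    using r[of "t - T"] that L_down[OF e(2), of t] \<open>0 < T\<close> by (auto simp: algebra_simps)
  have "(z has_vector_derivative p (T - s)) (at (T + s))"
    by (rule has_vector_derivative_transform_within_open[where S="{T<..<min (T + s + e) (T + d)}",
          OF der open_greaterThanLessThan _ eq])
      (use s(1,2) e(1) in auto)
  with 1 show ?thesis using vector_derivative_unique_at by blast
qed

text \<open>At a zero the velocity is unspecified, so the energy cannot be followed through it. It
  is carried across by symmetry: at \<open>T + s\<close> and \<open>T - s\<close> the positions
  differ by a sign and the velocities agree. The induction advances by half the minimal gap
  \<open>d\<close> between zeros, so that each step meets at most one zero.\<close>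

lemma energy_eq:
  assumes "t \<in> L" "z t \<noteq> 0" shows "energy t = E"
proof -
  obtain d where d: "d > 0" "\<And>T. T\<in>L \<Longrightarrow> z T = 0 \<Longrightarrow> d \<le> T \<and> (\<forall>t\<in>{T-d<..<T}. z t \<noteq> 0)"
    using zero_gap by blast
  have e0: "energy 0 = E"
  proof -
    have "norm (z 0) \<in> D" "0 < norm (z 0)" using in_D[OF zero_in_L] start_nz by auto
    then have "0 \<le> 2 / m * (E - U (norm (z 0)))" using U_le m_pos by simp
    then have "p 0 \<bullet> p 0 = 2 / m * (E - U (norm (z 0)))"
      using start_energy by (simp add: speed_def power2_norm_eq_inner[symmetric])
    then show ?thesis using m_pos by (simp add: energy_def field_simps)
  qed
  have ind: "\<forall>t\<in>L. t < real k * (d/2) \<longrightarrow> z t \<noteq> 0 \<longrightarrow> energy t = E" for k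
  proof (induction k)
    case 0 then show ?case using L_nonneg by force
  next
    case (Suc k)
    show ?case
    proof (intro ballI impI)
      fix t assume t: "t \<in> L" "t < real (Suc k) * (d/2)" "z t \<noteq> 0"
      show "energy t = E"
      proof (cases "\<exists>T\<in>{max 0 (t - d/2)..t}. z T = 0")
        case False
        have "energy t = energy (max 0 (t - d/2))"
          using t L_nonneg[OF t(1)] d(1) False by (intro energy_const) auto
        also have "\<dots> = E"
        proof (cases "t - d/2 \<le> 0")
          case True then show ?thesis using e0 by (simp add: max_def)
        next
          case F: False
          have "z (t - d/2) \<noteq> 0" using False F d(1) by auto
          moreover have "t - d/2 \<in> L" using L_down[OF t(1), of "t - d/2"] F d(1) by simp
          moreover have "t - d/2 < real k * (d/2)" using t(2) by (simp add: algebra_simps)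
          ultimately have "energy (t - d/2) = E" using Suc by blast
          then show ?thesis using F by (simp add: max_def)
        qed
        finally show ?thesis .
      next
        case True
        then obtain T where T: "0 \<le> T" "t - d/2 \<le> T" "T \<le> t" "z T = 0" by auto
        then have TL: "T \<in> L" using L_down t by auto
        note dT = d(2)[OF TL T(4)]
        define s where "s = t - T"
        have s: "0 < s" "s < d" "T + s \<in> L" "t = T + s" using T t d(1) by (auto simp: s_def order_le_less)
        have refl: "z (T + s) = - z (T - s)"
          using dT s(1-3) T(4) \<open>0 < d\<close> by (intro reflect) auto
        have et: "energy t = energy (T - s)"
          unfolding energy_def s(4) using reflect_velocity[OF TL T(4), of d s] dT s refl by simp
        \<comment> \<open>Still inside the zero-free gap before \<open>T\<close>, earlier than
          \<open>T - s\<close> because \<open>s \<le> d/2\<close>, and more than \<open>d/2\<close>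
          before \<open>t\<close>, so that the induction hypothesis covers it.\<close>
        let ?a = "T - 3 * d / 4"
        have half: "s \<le> d / 2" using T by (simp add: s_def)
        have nz: "z r \<noteq> 0" if "r \<in> {?a..T - s}" for r
          using that s(1) d(1) by (intro dT[THEN conjunct2, rule_format]) auto
        have "energy (T - s) = E"
        proof -
          have "energy (T - s) = energy ?a"
            using L_down[OF TL, of "T - s"] dT[THEN conjunct1] s(1,2) half d(1) nz by (intro energy_const) auto
          also have "\<dots> = E"
          proof -
            have "?a < real k * (d/2)" using t(2) s(1,4) d(1) by (simp add: algebra_simps)
            moreover have "?a \<in> L" using L_down[OF TL, of ?a] dT[THEN conjunct1] d(1) by auto
            moreover have "z ?a \<noteq> 0" using nz[of ?a] half d(1) by auto
            ultimately show ?thesis using Suc by blast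
          qed
          finally show ?thesis .
        qed
        with et show ?thesis by simp
      qed
    qed
  qed
  obtain k :: nat where "t / (d/2) < k" using reals_Archimedean2 by blast
  then have "t < real k * (d/2)" using d(1) by (simp only: pos_divide_less_eq half_gt_zero_iff)
  then show ?thesis using ind assms by blast
qed

lemma v_nonneg: "t \<in> L \<Longrightarrow> z t \<noteq> 0 \<Longrightarrow> 0 \<le> v (norm (z t))"
  using U_le[of "norm (z t)"] in_D[of t] m_pos by (simp add: speed_def)

lemma norm_p:
  assumes "t \<in> L" "z t \<noteq> 0" shows "norm (p t) = v (norm (z t))"
proof -
  have "p t \<bullet> p t = 2 / m * (E - U (norm (z t)))"
    using energy_eq[OF assms] m_pos by (simp add: energy_def field_simps)
  then show ?thesis by (simp add: speed_def norm_eq_sqrt_inner)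
qed

end

section \<open>Length of a path, escape from turning radii, confinement near the start\<close>

context radial_motion
begin

text \<open>\<open>speed m E U 0\<close> may be junk, possibly negative, when \<open>U\<close> is singular at the origin. The value \<open>1\<close>
  at the zeros of \<open>z\<close> does not affect integrals, since the zeros are locally finite.\<close>

definition path_speed :: "real \<Rightarrow> real" where
  "path_speed t = (if z t = 0 then 1 else v (norm (z t)))"

lemma path_speed_nonneg: "t \<in> L \<Longrightarrow> 0 \<le> path_speed t"
  using v_nonneg by (simp add: path_speed_def)

text \<open>The zeros, where no velocity is specified, are finitely many on \<open>{0..T}\<close>,
  and \<open>z\<close> is continuous at them, so the fundamental theorem of calculus still
  applies.\<close>

lemma displacement_le:
  assumes T: "T \<in> L" and int: "path_speed integrable_on {0..T}"
  shows "norm (z T - z 0) \<le> integral {0..T} path_speed"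
proof -
  define f' where "f' t = (if z t = 0 then 0 else p t)" for t
  have "(f' has_integral (z T - z 0)) {0..T}"
  proof (rule fundamental_theorem_of_calculus_strong)
    show "finite (insert 0 (insert T {t\<in>{0..T}. z t = 0}))" using finite_zeros[OF T] by simp
    show "0 \<le> T" using L_nonneg T .
    show "continuous_on {0..T} z" by (rule continuous_on_subset[OF cont L_sub[OF T]]) simp
    fix t assume t: "t \<in> {0..T} - insert 0 (insert T {t \<in> {0..T}. z t = 0})"
    then have "t \<in> L" using L_down[OF T, of t] by auto
    then show "(z has_vector_derivative f' t) (at t)"
      using velocity[of t] t by (auto simp: f'_def)
  qed
  moreover have "norm (f' t) \<le> path_speed t" if "t \<in> {0..T}" for t
    using norm_p[of t] L_down[OF T, of t] that by (auto simp: f'_def path_speed_def)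
  ultimately show ?thesis
    using integral_norm_bound_integral[OF _ int, of f'] by (auto simp: has_integral_iff)
qed

lemma p_cont_at: "t \<in> L \<Longrightarrow> z t \<noteq> 0 \<Longrightarrow> continuous (at t within {0..T}) p"
proof (cases "t = 0")
  case False
  assume "t \<in> L" "z t \<noteq> 0"
  then have "isCont p t"
    using False L_nonneg[of t] by (intro has_vector_derivative_continuous[OF accel]) auto
  then show ?thesis by (rule continuous_at_imp_continuous_at_within)
next
  case True
  obtain d where d: "d>0" "d \<in> L" "\<forall>t\<in>{0..d}. z t \<noteq> 0" using start_nbhd by blast
  have "continuous_on {0..d} p" using d by (intro p_cont) auto
  then have c: "continuous (at 0 within {0..d}) p"
    using d(1) by (simp add: continuous_on_eq_continuous_within)
  show ?thesis
  proof (cases "T \<le> 0")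
    case T: True
    then have "{0..T} = {} \<or> {0..T} = {0}" by auto
    then show ?thesis using True by (auto simp: continuous_within at_within_def)
  next
    case False
    have "at 0 within {0..T} = at 0 within {0..d}"
      by (rule at_within_nhd[where S="{..<min d T}"]) (use d False in auto)
    then show ?thesis using c True by simp
  qed
qed

text \<open>\<open>\<phi> (|z|\<^sup>2) * (z \<bullet> z')\<close> is bounded along the path. The hypothesis \<open>main\<close> says that it grows at
  least at rate \<open>\<kappa>\<close> wherever the path is slow; so the path cannot be slow for long.\<close>

lemma escape:
  assumes \<phi>: "\<And>\<rho>. (\<phi> has_real_derivative \<phi>' \<rho>) (at \<rho>)"
    and \<eta>: "0 < \<eta>" "\<And>r. r \<in> D \<Longrightarrow> r < \<eta> \<Longrightarrow> \<phi> (r\<^sup>2) = 0"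
    and bound: "\<And>r. r \<in> D \<Longrightarrow> 0 < r \<Longrightarrow> \<bar>\<phi> (r\<^sup>2)\<bar> * r * v r \<le> B"
    and main: "\<And>r. r \<in> D \<Longrightarrow> 0 < r \<Longrightarrow>
      \<kappa> \<le> K * v r - 2 * \<bar>\<phi>' (r\<^sup>2)\<bar> * r\<^sup>2 * (v r)\<^sup>2 + \<phi> (r\<^sup>2) * ((v r)\<^sup>2 - r * U' r / m)"
    and T: "T \<in> L" and int: "path_speed integrable_on {0..T}"
  shows "\<kappa> * T - 2 * B \<le> K * integral {0..T} path_speed"
proof -
  define Q where "Q t = \<phi> (z t \<bullet> z t) * (z t \<bullet> p t)" for t
  \<comment> \<open>The value at a zero is free, as zeros are exceptional points of the integral;
    this one makes the final comparison an equality there.\<close>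
  define Q' where "Q' t = (if z t = 0 then \<kappa> - K * path_speed t else
      2 * \<phi>' (z t \<bullet> z t) * (z t \<bullet> p t)\<^sup>2 + \<phi> (z t \<bullet> z t) * (p t \<bullet> p t + z t \<bullet> acc t))" for t
  have L': "t \<in> L" if "t \<in> {0..T}" for t using that L_down[OF T, of t] by auto
  have Qb: "\<bar>Q t\<bar> \<le> B" if "t \<in> L" "z t \<noteq> 0" for t
  proof -
    have "\<bar>Q t\<bar> \<le> \<bar>\<phi> (z t \<bullet> z t)\<bar> * (norm (z t) * norm (p t))"
      unfolding Q_def abs_mult by (intro mult_left_mono Cauchy_Schwarz_ineq2) auto
    also have "\<dots> \<le> B"
      using bound[OF in_D[OF that(1)]] that norm_p[OF that]
      by (simp add: power2_norm_eq_inner mult.assoc)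
    finally show ?thesis .
  qed
  have B0: "0 \<le> B" using Qb[OF zero_in_L start_nz] by linarith
  have Qb': "\<bar>Q t\<bar> \<le> B" if "t \<in> L" for t
    using Qb[OF that] B0 by (cases "z t = 0") (auto simp: Q_def)
  have zc: "continuous_on {0..T} z" by (rule continuous_on_subset[OF cont L_sub[OF T]]) simp
  have zct: "continuous (at t within {0..T}) z" if "t \<in> {0..T}" for t
    using zc that by (simp add: continuous_on_eq_continuous_within)
  have Qc: "continuous (at t within {0..T}) Q" if t: "t \<in> {0..T}" for t
  proof (cases "z t = 0")
    case False
    have "isCont \<phi> (z t \<bullet> z t)" using \<phi> DERIV_isCont by blast
    then have "continuous (at t within {0..T}) (\<lambda>t. \<phi> (z t \<bullet> z t))"
      by (rule continuous_within_compose3) (intro continuous_intros zct t)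
    then show ?thesis
      unfolding Q_def by (intro continuous_intros zct t p_cont_at False L')
  next
    \<comment> \<open>The velocity may be singular at a zero of \<open>z\<close>, but
      \<open>\<phi>\<close> vanishes for radii below \<open>\<eta>\<close>, and with it
      \<open>Q\<close>.\<close>
    case True
    have "((\<lambda>s. norm (z s)) \<longlongrightarrow> norm (z t)) (at t within {0..T})"
      using zct[OF t] by (intro tendsto_norm) (simp add: continuous_within)
    then have "\<forall>\<^sub>F s in at t within {0..T}. norm (z s) < \<eta>"
      using True \<eta>(1) by (intro order_tendstoD) auto
    moreover have "\<forall>\<^sub>F s in at t within {0..T}. s \<in> {0..T}"
      by (auto simp: eventually_at_filter)
    ultimately have "\<forall>\<^sub>F s in at t within {0..T}. Q s = 0"
    proof eventually_elim
      case (elim s)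
      then show ?case using \<eta>(2)[OF in_D[OF L'[OF elim(2)]]] by (simp add: Q_def power2_norm_eq_inner)
    qed
    then have "(Q \<longlongrightarrow> 0) (at t within {0..T})"
      by (rule tendsto_eventually)
    then show ?thesis using True by (simp add: continuous_within Q_def)
  qed
  have Qi: "(Q' has_integral (Q T - Q 0)) {0..T}"
  proof (rule fundamental_theorem_of_calculus_strong)
    show "finite (insert 0 (insert T {t\<in>{0..T}. z t = 0}))" using finite_zeros[OF T] by simp
    show "0 \<le> T" using L_nonneg T .
    show "continuous_on {0..T} Q" using Qc by (simp add: continuous_on_eq_continuous_within)
    fix t assume t: "t \<in> {0..T} - insert 0 (insert T {t \<in> {0..T}. z t = 0})"
    then have tL: "t \<in> L" "0 < t" "z t \<noteq> 0" using L'[of t] by auto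
    have zd: "(z has_derivative (\<lambda>h. h *\<^sub>R p t)) (at t)"
      using velocity[OF tL] by (simp add: has_vector_derivative_def)
    have pd: "(p has_derivative (\<lambda>h. h *\<^sub>R acc t)) (at t)"
      using accel[OF tL] by (simp add: has_vector_derivative_def acc_def)
    have zz: "((\<lambda>t. z t \<bullet> z t) has_real_derivative 2 * (z t \<bullet> p t)) (at t)"
      unfolding has_field_derivative_def
      by (rule has_derivative_eq_rhs[OF has_derivative_inner[OF zd zd]]) (auto simp: inner_commute)
    have zp: "((\<lambda>t. z t \<bullet> p t) has_real_derivative p t \<bullet> p t + z t \<bullet> acc t) (at t)"
      unfolding has_field_derivative_def
      by (rule has_derivative_eq_rhs[OF has_derivative_inner[OF zd pd]]) (auto simp: inner_commute algebra_simps)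
    have "(Q has_real_derivative \<phi>' (z t \<bullet> z t) * (2 * (z t \<bullet> p t)) * (z t \<bullet> p t) +
        (p t \<bullet> p t + z t \<bullet> acc t) * \<phi> (z t \<bullet> z t)) (at t)"
      unfolding Q_def by (rule DERIV_mult[OF DERIV_chain2[OF \<phi> zz] zp])
    then show "(Q has_vector_derivative Q' t) (at t)"
      using tL(3) unfolding has_real_derivative_iff_has_vector_derivative[symmetric]
      by (simp add: Q'_def power2_eq_square algebra_simps)
  qed
  have Pi: "((\<lambda>t. \<kappa> - K * path_speed t) has_integral (\<kappa> * T - K * integral {0..T} path_speed)) {0..T}"
    using has_integral_diff[OF has_integral_const_real[of \<kappa> 0 T]
        has_integral_mult_right[OF integrable_integral[OF int], of K]] L_nonneg[OF T]
    by (simp add: mult.commute)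
  have "\<kappa> - K * path_speed t \<le> Q' t" if t: "t \<in> {0..T}" for t
  proof (cases "z t = 0")
    case True then show ?thesis by (simp add: Q'_def)
  next
    case False
    let ?r = "norm (z t)"
    have r: "?r \<in> D" "0 < ?r" using in_D[OF L'[OF t]] False by auto
    have pp: "p t \<bullet> p t = (v ?r)\<^sup>2" using norm_p[OF L'[OF t] False] by (simp add: power2_norm_eq_inner[symmetric])
    have za: "z t \<bullet> acc t = - ?r * U' ?r / m"
      using r by (simp add: acc_def power2_norm_eq_inner[symmetric] power2_eq_square)
    \<comment> \<open>The angle between position and velocity is unknown; the worst case is the
      source of the term with \<open>\<bar>\<phi>' (r\<^sup>2)\<bar>\<close> in
      \<open>main\<close>.\<close>
    have "(z t \<bullet> p t)\<^sup>2 \<le> ?r\<^sup>2 * (v ?r)\<^sup>2"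
      using Cauchy_Schwarz_ineq[of "z t" "p t"] pp by (simp add: power2_norm_eq_inner[symmetric])
    then have "\<bar>\<phi>' (?r\<^sup>2)\<bar> * (z t \<bullet> p t)\<^sup>2 \<le> \<bar>\<phi>' (?r\<^sup>2)\<bar> * (?r\<^sup>2 * (v ?r)\<^sup>2)"
      by (intro mult_left_mono) auto
    moreover have "- (\<bar>\<phi>' (?r\<^sup>2)\<bar> * (z t \<bullet> p t)\<^sup>2) \<le> \<phi>' (?r\<^sup>2) * (z t \<bullet> p t)\<^sup>2"
      using mult_right_mono[of "- \<bar>\<phi>' (?r\<^sup>2)\<bar>" "\<phi>' (?r\<^sup>2)" "(z t \<bullet> p t)\<^sup>2"] by simp
    ultimately have "\<kappa> \<le> K * v ?r + (2 * (\<phi>' (?r\<^sup>2) * (z t \<bullet> p t)\<^sup>2) +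
        \<phi> (?r\<^sup>2) * ((v ?r)\<^sup>2 - ?r * U' ?r / m))"
      using main[OF r] by (simp add: mult.assoc)
    moreover have "z t \<bullet> z t = ?r\<^sup>2" by (simp add: power2_norm_eq_inner)
    ultimately show ?thesis
      using False by (simp add: Q'_def path_speed_def pp za mult.assoc)
  qed
  from has_integral_le[OF Pi Qi this]
  have "\<kappa> * T - K * integral {0..T} path_speed \<le> Q T - Q 0" .
  then show ?thesis using Qb'[OF T] Qb'[OF zero_in_L] by linarith
qed

text \<open>A bootstrap: while the displacement is below \<open>\<eta>\<close>, the speed is at most
  \<open>V\<close>, so the displacement is at most \<open>V * \<delta>\<close>, which is less than
  \<open>\<eta>\<close>. Hence there is no first time at which it reaches \<open>\<eta>\<close>. Nor
  can the lifetime end before \<open>\<delta>\<close>, because the path would have to be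
  unbounded.\<close>

lemma stays_near:
  assumes \<eta>: "0 < \<eta>" "\<eta> < norm (z 0)" and V: "0 \<le> V" "0 \<le> \<delta>" "V * \<delta> < \<eta>"
    and vV: "\<And>r. r \<in> D \<Longrightarrow> \<bar>r - norm (z 0)\<bar> \<le> \<eta> \<Longrightarrow> v r \<le> V"
  shows "\<delta> \<in> L" "\<And>t. t \<in> {0..\<delta>} \<Longrightarrow> norm (z t - z 0) \<le> V * t" "\<And>t. t \<in> {0..\<delta>} \<Longrightarrow> z t \<noteq> 0"
proof -
  have lip: "norm (z a - z 0) \<le> V * a"
    if a: "a \<in> L" "\<And>t. 0 \<le> t \<Longrightarrow> t < a \<Longrightarrow> norm (z t - z 0) < \<eta>" for a
  proof (cases "a = 0")
    case False
    then have "0 < a" using L_nonneg[OF a(1)] by auto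
    then have "norm (z a - z 0) \<le> V * a - V * 0"
    proof (rule differentiable_bound_general)
      show "continuous_on {0..a} z" by (rule continuous_on_subset[OF cont L_sub[OF a(1)]]) simp
      show "continuous_on {0..a} ((*) V)" by (intro continuous_intros)
      fix t assume t: "0 < t" "t < a"
      have tL: "t \<in> L" using L_down[OF a(1), of t] t by auto
      have n: "norm (z t - z 0) < \<eta>" using a(2)[of t] t by auto
      then have nz: "z t \<noteq> 0" using \<eta>(2) by auto
      show "(z has_vector_derivative p t) (at t)" using velocity tL nz t by blast
      show "((*) V has_vector_derivative V) (at t)" by (auto intro!: derivative_eq_intros)
      have "\<bar>norm (z t) - norm (z 0)\<bar> \<le> norm (z t - z 0)" by (rule norm_triangle_ineq3)
      then show "norm (p t) \<le> V"
        using norm_p[OF tL nz] vV[OF in_D[OF tL]] n by linarith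
    qed
    then show ?thesis by simp
  qed simp
  have near: "norm (z t - z 0) < \<eta>" if t: "t \<in> L" "t \<le> \<delta>" for t
  proof (rule ccontr)
    assume n: "\<not> norm (z t - z 0) < \<eta>"
    have c: "continuous_on {0..t} (\<lambda>s. norm (z s - z 0))"
      by (intro continuous_intros continuous_on_subset[OF cont L_sub[OF t(1)]]) simp
    define K where "K = {0..t} \<inter> (\<lambda>s. norm (z s - z 0)) -` {\<eta>..}"
    have "closed K" unfolding K_def using c by (intro continuous_closed_preimage) auto
    moreover have "bounded K" by (rule bounded_subset[of "{0..t}"]) (auto simp: K_def)
    ultimately have "compact K" by (simp add: compact_eq_bounded_closed)
    moreover have "t \<in> K" using n L_nonneg[OF t(1)] by (auto simp: K_def)
    ultimately obtain a where a: "a \<in> K" "\<And>t. t \<in> K \<Longrightarrow> a \<le> t"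
      using compact_attains_inf[of K] by blast
    have at: "0 \<le> a" "a \<le> t" "\<eta> \<le> norm (z a - z 0)" using a(1) by (auto simp: K_def)
    have "norm (z a - z 0) \<le> V * a"
    proof (rule lip)
      show "a \<in> L" using L_down[OF t(1), of a] at by auto
      fix s assume s: "0 \<le> s" "s < a"
      show "norm (z s - z 0) < \<eta>"
      proof (rule ccontr)
        assume "\<not> norm (z s - z 0) < \<eta>"
        then have "s \<in> K" using s at by (simp add: K_def)
        then show False using a(2)[of s] s by simp
      qed
    qed
    also have "\<dots> \<le> V * \<delta>" using at t V by (intro mult_left_mono) auto
    finally show False using V at by auto
  qed
  show dL: "\<delta> \<in> L"
  proof (rule ccontr)
    assume no: "\<delta> \<notin> L"
    then obtain b where b: "b > 0" "L = {0..<b}" "filterlim (\<lambda>t. norm (z t)) at_top (at_left b)"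
      using lifetime V by auto
    then have "\<forall>\<^sub>F t in at_left b. norm (z 0) + \<eta> < norm (z t)"
      by (simp add: filterlim_at_top_dense)
    moreover have "\<forall>\<^sub>F t in at_left b. t \<in> {0<..<b}"
      using eventually_at_left[of 0 b] b(1) by auto
    ultimately have "\<forall>\<^sub>F t in at_left b. False"
    proof eventually_elim
      case (elim t)
      have "norm (z t - z 0) < \<eta>" using near[of t] elim b(2) no V by auto
      then show ?case using elim(1) norm_triangle_ineq2[of "z t" "z 0"] by linarith
    qed
    then show False by (simp add: trivial_limit_at_left_real)
  qed
  fix t assume t: "t \<in> {0..\<delta>}"
  have tL: "t \<in> L" using L_down[OF dL, of t] t by auto
  show "norm (z t - z 0) \<le> V * t"
    by (rule lip[OF tL]) (use near L_down[OF tL] t in auto)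
  show "z t \<noteq> 0" using near[OF tL] t \<eta>(2) by auto
qed

end

section \<open>The depth along a path: continuity, and comparison with length and lifetime\<close>

locale radial_flight = radial_motion +
  fixes g :: "real \<Rightarrow> real" and g0 :: real
  assumes g0: "0 < g0" and g_ge: "\<And>r. r \<in> D \<Longrightarrow> g0 \<le> g r" and g_cont: "continuous_on D g"
begin

text \<open>At a zero of \<open>z\<close> and beyond the lifetime this is \<open>g 0 * v 0\<close>,
  which may be junk. The zeros are finite in number on compact parts of \<open>L\<close>, and the
  depth is already infinite when a finite lifetime ends.\<close>

definition rate :: "real \<Rightarrow> real" where
  "rate t = g (norm (z t)) * v (norm (z t))"

definition depth :: "real \<Rightarrow> ennreal" where
  "depth t = (\<integral>\<^sup>+s\<in>{0..t}. ennreal (rate s) \<partial>lborel)"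

lemma L_borel: "L \<in> sets borel"
  using lifetime by auto

lemma z_borel: "z \<in> borel_measurable borel"
proof -
  have "(\<lambda>t. indicator L t *\<^sub>R z t) \<in> borel_measurable borel"
    by (rule borel_measurable_continuous_on_indicator[OF L_borel cont])
  also have "(\<lambda>t. indicator L t *\<^sub>R z t) = z" using outside by (auto simp: indicator_def)
  finally show ?thesis .
qed

lemma v_cont: "continuous_on (D - {0}) v"
  unfolding speed_def by (intro continuous_intros U_cont)

lemma moving_borel: "L \<inter> {t. z t \<noteq> 0} \<in> sets borel"
proof -
  have "{t. z t \<noteq> 0} = z -` (-{0}) \<inter> space borel" by auto
  also have "\<dots> \<in> sets borel" by (rule measurable_sets[OF z_borel]) simp
  finally show ?thesis using L_borel by auto
qed

lemma rate_cont: "A \<subseteq> L \<Longrightarrow> (\<And>t. t \<in> A \<Longrightarrow> z t \<noteq> 0) \<Longrightarrow> continuous_on A rate"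
  unfolding rate_def
proof (intro continuous_intros)
  assume A: "A \<subseteq> L" "\<And>t. t \<in> A \<Longrightarrow> z t \<noteq> 0"
  have n: "continuous_on A (\<lambda>t. norm (z t))" by (intro continuous_intros continuous_on_subset[OF cont A(1)])
  show "continuous_on A (\<lambda>t. g (norm (z t)))"
    by (rule continuous_on_compose2[OF g_cont n]) (use A in_D in auto)
  show "continuous_on A (\<lambda>t. v (norm (z t)))"
    by (rule continuous_on_compose2[OF v_cont n]) (use A in_D in auto)
qed

lemma rate_borel [measurable]: "rate \<in> borel_measurable borel"
proof -
  let ?A = "L \<inter> {t. z t \<noteq> 0}"
  note A = moving_borel
  have "(\<lambda>t. indicator ?A t *\<^sub>R rate t) \<in> borel_measurable borel"
    by (rule borel_measurable_continuous_on_indicator[OF A rate_cont]) auto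
  then have "(\<lambda>t. indicator ?A t *\<^sub>R rate t + indicator (- ?A) t * (g 0 * v 0)) \<in> borel_measurable borel"
    by (intro borel_measurable_add borel_measurable_times borel_measurable_indicator[OF borel_comp[OF A]]) auto
  also have "(\<lambda>t. indicator ?A t *\<^sub>R rate t + indicator (- ?A) t * (g 0 * v 0)) = rate"
    using outside by (auto simp: indicator_def rate_def fun_eq_iff)
  finally show ?thesis .
qed

lemma path_speed_borel [measurable]: "path_speed \<in> borel_measurable borel"
proof -
  let ?A = "L \<inter> {t. z t \<noteq> 0}"
  note A = moving_borel
  have "continuous_on ?A path_speed \<longleftrightarrow> continuous_on ?A (\<lambda>t. v (norm (z t)))"
    by (intro continuous_on_cong) (auto simp: path_speed_def)
  also have \<dots>
    by (rule continuous_on_compose2[OF v_cont, of _ "\<lambda>t. norm (z t)"])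
      (use in_D in \<open>auto intro!: continuous_intros continuous_on_subset[OF cont]\<close>)
  finally have c: "continuous_on ?A path_speed" .
  have "(\<lambda>t. indicator ?A t *\<^sub>R path_speed t) \<in> borel_measurable borel"
    by (rule borel_measurable_continuous_on_indicator[OF A c])
  then have "(\<lambda>t. indicator ?A t *\<^sub>R path_speed t + indicator (- ?A) t) \<in> borel_measurable borel"
    by (intro borel_measurable_add borel_measurable_indicator[OF borel_comp[OF A]]) auto
  also have "(\<lambda>t. indicator ?A t *\<^sub>R path_speed t + indicator (- ?A) t) = path_speed"
    using outside by (auto simp: indicator_def path_speed_def fun_eq_iff)
  finally show ?thesis .
qed

text \<open>Read as the measure of an interval, the depth gets its one-sided continuity from
  continuity of measures along monotone sequences of sets.\<close>

lemma depth_eq_emeasure: "depth t = emeasure (density lborel (\<lambda>s. ennreal (rate s))) {0..t}"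
  unfolding depth_def by (subst emeasure_density) auto

lemma depth_mono: "s \<le> t \<Longrightarrow> depth s \<le> depth t"
  unfolding depth_eq_emeasure by (intro emeasure_mono) auto

lemma depth_0: "depth 0 = 0"
proof -
  have "depth 0 = (\<integral>\<^sup>+(s::real). 0 \<partial>lborel)" unfolding depth_def
    by (rule nn_integral_cong_AE, rule AE_mp[OF AE_lborel_singleton[of 0]]) auto
  then show ?thesis by simp
qed

lemma depth_add:
  assumes "0 \<le> s" "s \<le> t"
  shows "depth t = depth s + (\<integral>\<^sup>+r\<in>{s..t}. ennreal (rate r) \<partial>lborel)"
proof -
  let ?\<mu> = "density lborel (\<lambda>s. ennreal (rate s))"
  have "{0..t} = {0..s} \<union> {s<..t}" using assms by auto
  then have "depth t = depth s + emeasure ?\<mu> {s<..t}"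
    unfolding depth_eq_emeasure by (subst plus_emeasure) auto
  also have "emeasure ?\<mu> {s<..t} = (\<integral>\<^sup>+r. ennreal (rate r) * indicator {s<..t} r \<partial>lborel)"
    by (subst emeasure_density) auto
  also have "\<dots> = (\<integral>\<^sup>+r\<in>{s..t}. ennreal (rate r) \<partial>lborel)"
    by (rule nn_integral_cong_AE, rule AE_mp[OF AE_lborel_singleton[of s]]) (auto simp: indicator_def)
  finally show ?thesis .
qed

lemma rate_finite_nz:
  assumes "0 \<le> a" "b \<in> L" "\<And>t. t \<in> {a..b} \<Longrightarrow> z t \<noteq> 0"
  shows "(\<integral>\<^sup>+r\<in>{a..b}. ennreal (rate r) \<partial>lborel) < \<infinity>"
proof -
  have "continuous_on {a..b} rate" using assms L_sub[of b a] by (intro rate_cont) auto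
  then have "bounded (rate ` {a..b})" by (intro compact_imp_bounded compact_continuous_image) auto
  then obtain C where C: "\<And>t. t \<in> {a..b} \<Longrightarrow> \<bar>rate t\<bar> \<le> C" unfolding bounded_iff real_norm_def ball_simps by blast
  have "(\<integral>\<^sup>+r\<in>{a..b}. ennreal (rate r) \<partial>lborel) \<le> (\<integral>\<^sup>+r. ennreal C * indicator {a..b} r \<partial>lborel)"
    by (intro nn_integral_mono) (auto simp: indicator_def intro!: ennreal_leI order_trans[OF abs_ge_self C])
  also have "\<dots> < \<infinity>" by (subst nn_integral_cmult_indicator) (auto simp: emeasure_lborel_Icc_eq ennreal_mult_less_top)
  finally show ?thesis .
qed

text \<open>At a zero the speed may be singular, but the path retraces its approach to the zero.\<close>

lemma depth_finite_right:
  assumes T: "T \<in> L" and fin: "depth T < \<infinity>"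
  shows "\<exists>T1>T. T1 \<in> L \<and> depth T1 < \<infinity>"
proof -
  obtain e where e: "e > 0" "T + e \<in> L" using L_open_right[OF T] by auto
  have T0: "0 \<le> T" using L_nonneg[OF T] .
  show ?thesis
  proof (cases "z T = 0")
    case False
    have "continuous_on {T..T+e} z" by (rule continuous_on_subset[OF cont L_sub[OF e(2) T0]])
    then have "(z \<longlongrightarrow> z T) (at T within {T..T+e})" using e by (auto simp: continuous_on_def)
    then have "\<forall>\<^sub>F t in at T within {T..T+e}. z t \<noteq> 0"
      using False by (rule tendsto_imp_eventually_ne)
    then obtain d where d: "d > 0" "\<And>t. t \<in> {T..T+e} \<Longrightarrow> 0 < dist t T \<Longrightarrow> dist t T < d \<Longrightarrow> z t \<noteq> 0"
      unfolding eventually_at by auto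
    let ?T1 = "T + min e (d/2)"
    have T1: "?T1 \<in> L" "T < ?T1" using L_down[OF e(2), of ?T1] T0 e(1) d(1) by auto
    have nz: "z t \<noteq> 0" if "t \<in> {T..?T1}" for t
    proof (cases "t = T")
      case False
      show ?thesis by (rule d(2)) (use False d(1) e(1) that in \<open>auto simp: dist_real_def min_def split: if_splits\<close>)
    qed (simp add: False)
    have "depth ?T1 < \<infinity>"
      using fin rate_finite_nz[OF T0 T1(1) nz] depth_add[OF T0, of ?T1] T1(2) by simp
    then show ?thesis using T1 by blast
  next
    case True
    obtain d where d: "d > 0" "\<And>T. T\<in>L \<Longrightarrow> z T = 0 \<Longrightarrow> d \<le> T \<and> (\<forall>t\<in>{T-d<..<T}. z t \<noteq> 0)"
      using zero_gap by blast
    note dT = d(2)[OF T True]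
    define s where "s = min e d"
    have s: "0 < s" "s \<le> d" "s \<le> e" using e(1) d(1) by (auto simp: s_def)
    have refl: "rate (T + r) = rate (T - r)" if r: "0 \<le> r" "r \<le> s" for r
    proof -
      have "T + r \<in> L" using L_down[OF e(2), of "T + r"] T0 r s by auto
      moreover have "\<forall>t\<in>{T - r<..<T}. z t \<noteq> 0" using dT[THEN conjunct2] r s by fastforce
      ultimately have "z (T + r) = - z (T - r)"
        using dT[THEN conjunct1] r s d(1) True by (intro reflect) auto
      then show ?thesis by (simp add: rate_def)
    qed
    have "(\<integral>\<^sup>+r\<in>{T..T+s}. ennreal (rate r) \<partial>lborel) =
        (\<integral>\<^sup>+r. ennreal (rate (2 * T + (-1) * r)) * indicator {T..T+s} (2 * T + (-1) * r) \<partial>lborel)"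
      using nn_integral_real_affine[of "\<lambda>r. ennreal (rate r) * indicator {T..T+s} r" "-1" "2*T"] by simp
    also have "\<dots> = (\<integral>\<^sup>+r\<in>{T-s..T}. ennreal (rate r) \<partial>lborel)"
    proof (intro nn_integral_cong)
      fix r :: real
      show "ennreal (rate (2 * T + (-1) * r)) * indicator {T..T+s} (2 * T + (-1) * r) = ennreal (rate r) * indicator {T-s..T} r"
        using refl[of "T - r"] by (auto simp: indicator_def)
    qed
    also have "\<dots> \<le> depth T"
      unfolding depth_def using dT[THEN conjunct1] s by (intro nn_integral_mono) (auto simp: indicator_def)
    finally have "depth (T + s) < \<infinity>"
      using depth_add[OF T0, of "T + s"] s fin by simp
    moreover have "T + s \<in> L" using L_down[OF e(2), of "T + s"] T0 s by auto
    ultimately show ?thesis using s by (intro exI[of _ "T + s"]) auto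
  qed
qed

text \<open>Continuity from above needs a set of finite measure, which
  \<open>depth_finite_right\<close> provides to the right of \<open>T\<close> even when
  \<open>T\<close> is a passage through the origin.\<close>

lemma depth_right_cont:
  assumes "T \<in> L" "depth T < \<infinity>" "\<And>s. T < s \<Longrightarrow> c \<le> depth s"
  shows "c \<le> depth T"
proof -
  let ?\<mu> = "density lborel (\<lambda>s. ennreal (rate s))"
  obtain T1 where T1: "T < T1" "depth T1 < \<infinity>" using depth_finite_right assms by blast
  define A where "A n = {0..T + (T1 - T) * inverse (real (Suc n))}" for n :: nat
  have "(INF n. emeasure ?\<mu> (A n)) = emeasure ?\<mu> (\<Inter>n. A n)"
  proof (rule INF_emeasure_decseq)
    show "range A \<subseteq> sets ?\<mu>" by (auto simp: A_def)
    show "decseq A"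
      unfolding decseq_def
    proof (intro allI impI)
      fix k n :: nat assume "k \<le> n"
      then have "(T1 - T) * inverse (real (Suc n)) \<le> (T1 - T) * inverse (real (Suc k))"
        using T1 by (intro mult_left_mono le_imp_inverse_le) auto
      then show "A n \<subseteq> A k" by (auto simp: A_def)
    qed
    fix n
    have "emeasure ?\<mu> (A n) \<le> depth T1"
      unfolding depth_eq_emeasure
    proof (rule emeasure_mono)
      have "inverse (real (Suc n)) \<le> 1" by (simp add: inverse_le_1_iff)
      then have "(T1 - T) * inverse (real (Suc n)) \<le> (T1 - T) * 1"
        using T1(1) by (intro mult_left_mono) auto
      then show "A n \<subseteq> {0..T1}" by (auto simp: A_def)
    qed simp
    then show "emeasure ?\<mu> (A n) \<noteq> \<infinity>" using T1(2) by (auto simp: top_unique)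
  qed
  also have "(\<Inter>n. A n) = {0..T}"
  proof -
    have "t \<le> T" if "\<forall>n. t \<le> T + (T1 - T) * inverse (real (Suc n))" for t
    proof (rule LIMSEQ_le_const)
      show "(\<lambda>n. T + (T1 - T) * inverse (real (Suc n))) \<longlonglongrightarrow> T"
        using tendsto_add[OF tendsto_const tendsto_mult[OF tendsto_const LIMSEQ_inverse_real_of_nat]] by simp
    qed (use that in blast)
    moreover have "t \<le> T + (T1 - T) * inverse (real (Suc n))" if "t \<le> T" for t and n :: nat
    proof -
      have "0 \<le> (T1 - T) * inverse (real (Suc n))" using T1(1) by simp
      then show ?thesis using that by linarith
    qed
    ultimately show ?thesis unfolding A_def atLeastAtMost_def by blast
  qed
  finally have "depth T = (INF n. emeasure ?\<mu> (A n))" by (simp add: depth_eq_emeasure)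
  also have "c \<le> \<dots>"
  proof (rule INF_greatest)
    fix n
    have "T < T + (T1 - T) * inverse (real (Suc n))" using T1(1) by simp
    then show "c \<le> emeasure ?\<mu> (A n)"
      using assms(3) unfolding A_def depth_eq_emeasure[symmetric] by blast
  qed
  finally show ?thesis .
qed

lemma depth_left_cont:
  assumes "0 < T" "\<And>s. 0 \<le> s \<Longrightarrow> s < T \<Longrightarrow> depth s \<le> c"
  shows "depth T \<le> c"
proof -
  let ?\<mu> = "density lborel (\<lambda>s. ennreal (rate s))"
  define A where "A n = {0..T - T * inverse (real (Suc n))}" for n :: nat
  have "(SUP n. emeasure ?\<mu> (A n)) = emeasure ?\<mu> (\<Union>n. A n)"
  proof (rule SUP_emeasure_incseq)
    show "range A \<subseteq> sets ?\<mu>" by (auto simp: A_def)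
    show "incseq A"
      unfolding incseq_def
    proof (intro allI impI)
      fix k n :: nat assume "k \<le> n"
      then have "T * inverse (real (Suc n)) \<le> T * inverse (real (Suc k))"
        using assms(1) by (intro mult_left_mono le_imp_inverse_le) auto
      then show "A k \<subseteq> A n" by (auto simp: A_def)
    qed
  qed
  also have "(\<Union>n. A n) = {0..<T}"
  proof -
    have "\<exists>n. t \<le> T - T * inverse (real (Suc n))" if "t < T" for t
    proof -
      have "(\<lambda>n. T - T * inverse (real (Suc n))) \<longlonglongrightarrow> T"
        using tendsto_diff[OF tendsto_const tendsto_mult[OF tendsto_const LIMSEQ_inverse_real_of_nat]] by fastforce
      from order_tendstoD(1)[OF this that] show ?thesis
        by (auto simp: eventually_sequentially intro: less_imp_le)
    qed
    moreover have "T - T * inverse (real (Suc n)) < T" for n using assms(1) by simp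
    ultimately show ?thesis unfolding A_def atLeastAtMost_def atLeastLessThan_def by (blast intro: le_less_trans)
  qed
  also have "emeasure ?\<mu> {0..<T} = depth T"
    unfolding depth_def
    by (subst emeasure_density, simp, simp, rule nn_integral_cong_AE, rule AE_mp[OF AE_lborel_singleton[of T]])
      (auto simp: indicator_def)
  finally have "depth T = (SUP n. emeasure ?\<mu> (A n))" by simp
  also have "\<dots> \<le> c"
  proof (rule SUP_least)
    fix n
    have "inverse (real (Suc n)) \<le> 1" by (simp add: inverse_le_1_iff)
    then have "0 \<le> T - T * inverse (real (Suc n))"
      using assms(1) mult_left_mono[of "inverse (real (Suc n))" 1 T] by simp
    moreover have "T - T * inverse (real (Suc n)) < T" using assms(1) by simp
    ultimately show "emeasure ?\<mu> (A n) \<le> c"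
      using assms(2) unfolding A_def depth_eq_emeasure[symmetric] by blast
  qed
  finally show ?thesis .
qed

text \<open>Except at finitely many zeros, \<open>rate\<close> is at least
  \<open>g0 * path_speed\<close>. Hence a finite depth makes the length integral converge and bounds
  it.\<close>

lemma path_speed_depth:
  assumes T: "T \<in> L" and fin: "depth T < \<infinity>"
  shows "path_speed integrable_on {0..T}" "g0 * integral {0..T} path_speed \<le> enn2real (depth T)"
proof -
  have "(\<integral>\<^sup>+s\<in>{0..T}. ennreal (g0 * path_speed s) \<partial>lborel) \<le> depth T"
    unfolding depth_def
  proof (rule nn_integral_mono_AE)
    have "AE s in lborel. s \<notin> {t\<in>{0..T}. z t = 0}"
      by (rule AE_not_in, rule finite_imp_null_set_lborel, rule finite_zeros[OF T])
    then show "AE s in lborel. ennreal (g0 * path_speed s) * indicator {0..T} s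
        \<le> ennreal (rate s) * indicator {0..T} s"
    proof eventually_elim
      case (elim s)
      show ?case
      proof (cases "s \<in> {0..T}")
        case True
        then have sL: "s \<in> L" "z s \<noteq> 0" using L_down[OF T, of s] elim by auto
        have "g0 * v (norm (z s)) \<le> g (norm (z s)) * v (norm (z s))"
          using g_ge[OF in_D[OF sL(1)]] v_nonneg[OF sL] by (intro mult_right_mono) auto
        then show ?thesis using sL by (simp add: path_speed_def rate_def ennreal_leI mult_right_mono)
      qed simp
    qed
  qed
  then have le: "(\<integral>\<^sup>+s. ennreal (g0 * path_speed s * indicator {0..T} s) \<partial>lborel) \<le> depth T"
    by (simp add: ennreal_indicator[symmetric] ennreal_mult''[symmetric])
  have nn: "0 \<le> g0 * path_speed s * indicator {0..T} s" for s
    using path_speed_nonneg L_down[OF T, of s] g0 by (auto simp: indicator_def)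
  have lt: "(\<integral>\<^sup>+s. ennreal (g0 * path_speed s * indicator {0..T} s) \<partial>lborel) < \<infinity>"
    using le fin by (rule order.strict_trans1)
  have bm: "(\<lambda>s. g0 * path_speed s * indicator {0..T} s) \<in> borel_measurable borel" by measurable
  have i: "(\<lambda>s. g0 * path_speed s * indicator {0..T} s) integrable_on UNIV"
    by (rule nn_integral_integrable_on[OF bm nn lt])
  have eq: "(\<lambda>s. g0 * path_speed s * indicator {0..T} s) = (\<lambda>s. if s \<in> {0..T} then g0 * path_speed s else 0)"
    by (auto simp: indicator_def)
  have ig: "(\<lambda>s. g0 * path_speed s) integrable_on {0..T}"
    using i unfolding eq by (simp only: integrable_restrict_UNIV)
  show int: "path_speed integrable_on {0..T}"
    using integrable_cmul[OF ig, of "1/g0"] g0 by simp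
  have "ennreal (integral UNIV (\<lambda>s. g0 * path_speed s * indicator {0..T} s)) \<le> depth T"
    using nn_integral_has_integral_lborel[OF bm nn integrable_integral[OF i]] le by simp
  then have "ennreal (g0 * integral {0..T} path_speed) \<le> depth T"
    unfolding eq by (simp only: integral_restrict_UNIV integral_mult_right)
  moreover have "0 \<le> g0 * integral {0..T} path_speed"
    using g0 path_speed_nonneg L_down[OF T] by (intro mult_nonneg_nonneg integral_nonneg int) auto
  ultimately show "g0 * integral {0..T} path_speed \<le> enn2real (depth T)"
    using enn2real_mono[of "ennreal (g0 * integral {0..T} path_speed)" "depth T"] fin by simp
qed

lemma displacement_le_depth:
  assumes "T \<in> L" "depth T < \<infinity>"
  shows "g0 * norm (z T - z 0) \<le> enn2real (depth T)"
  using displacement_le[OF assms(1) path_speed_depth(1)[OF assms]] path_speed_depth(2)[OF assms] g0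
  by (meson mult_left_mono order.trans less_imp_le)

text \<open>At the end of a finite lifetime the norm blows up, whereas a finite depth would bound
  the displacement.\<close>

lemma depth_infinite_outside:
  assumes "0 \<le> T" "T \<notin> L" shows "depth T = \<infinity>"
proof (rule ccontr)
  assume "depth T \<noteq> \<infinity>"
  then have fin: "depth T < \<infinity>" by (simp add: less_top)
  from assms obtain b where b: "b > 0" "L = {0..<b}" "filterlim (\<lambda>t. norm (z t)) at_top (at_left b)"
    using lifetime by auto
  let ?c = "norm (z 0) + enn2real (depth T) / g0"
  have "\<forall>\<^sub>F t in at_left b. ?c < norm (z t)"
    using b(3) by (simp add: filterlim_at_top_dense)
  moreover have "\<forall>\<^sub>F t in at_left b. t \<in> {0<..<b}"
    using eventually_at_left[of 0 b] b(1) by auto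
  ultimately have "\<forall>\<^sub>F t in at_left b. False"
  proof eventually_elim
    case (elim t)
    then have tL: "t \<in> L" using b by auto
    have le: "depth t \<le> depth T" using elim b assms by (intro depth_mono) auto
    have "g0 * norm (z t - z 0) \<le> enn2real (depth t)"
      using displacement_le_depth[OF tL] le fin by (simp add: order.strict_trans1)
    also have "\<dots> \<le> enn2real (depth T)" using le fin by (intro enn2real_mono) auto
    finally have "norm (z t - z 0) \<le> enn2real (depth T) / g0" using g0 by (simp add: field_simps)
    then show ?case using elim(1) norm_triangle_ineq2[of "z t" "z 0"] by linarith
  qed
  then show False by (simp add: trivial_limit_at_left_real)
qed

lemma depth_real:
  assumes "\<delta> \<in> L" "\<And>t. t \<in> {0..\<delta>} \<Longrightarrow> z t \<noteq> 0" "t \<in> {0..\<delta>}"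
  shows "depth t = ennreal (integral {0..t} rate)" "0 \<le> integral {0..t} rate"
proof -
  have c: "continuous_on {0..t} rate" using assms L_sub[OF assms(1), of 0] by (intro rate_cont) auto
  have nn: "0 \<le> rate s" if "s \<in> {0..t}" for s
    using v_nonneg[of s] g_ge[OF in_D[of s]] g0 assms that L_down[OF assms(1), of s]
    by (auto simp: rate_def intro!: mult_nonneg_nonneg)
  have i: "rate integrable_on {0..t}" using c by (rule integrable_continuous_interval)
  show "depth t = ennreal (integral {0..t} rate)"
    unfolding depth_def
  proof (rule set_nn_integral_lborel_eq_integral)
    show "set_borel_measurable borel {0..t} rate"
      unfolding set_borel_measurable_def by measurable
    have "t \<in> L" using L_down[OF assms(1)] assms(3) by auto
    then show "(\<integral>\<^sup>+x\<in>{0..t}. ennreal (rate x) \<partial>lborel) < \<infinity>"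
      using assms by (intro rate_finite_nz) auto
  qed (use nn in auto)
  show "0 \<le> integral {0..t} rate" using i nn by (rule integral_nonneg)
qed

end

section \<open>Uniform expansion of paths\<close>

text \<open>Taylor's formula in the variable \<open>\<Lambda>\<close>, with \<open>F\<close> and
  \<open>H\<close> as first and second derivatives of \<open>f\<close>. Instead of inverting
  \<open>\<Lambda>\<close>, the mean value inequality is applied in \<open>t\<close>, to the
  remainder of \<open>F\<close> and then to that of \<open>f\<close>; the second application
  produces the factor 1/2.\<close>

lemma second_order_expansion:
  fixes f F H :: "real \<Rightarrow> 'a::real_normed_vector"
  assumes t: "0 \<le> t"
    and \<Lambda>: "continuous_on {0..t} \<Lambda>" "\<And>s. 0 < s \<Longrightarrow> s < t \<Longrightarrow> (\<Lambda> has_real_derivative \<nu> s) (at s)" "\<Lambda> 0 = 0"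
    and \<nu>: "\<And>s. 0 < s \<Longrightarrow> s < t \<Longrightarrow> 0 \<le> \<nu> s"
    and f: "continuous_on {0..t} f" "\<And>s. 0 < s \<Longrightarrow> s < t \<Longrightarrow> (f has_vector_derivative \<nu> s *\<^sub>R F s) (at s)"
    and F: "continuous_on {0..t} F" "\<And>s. 0 < s \<Longrightarrow> s < t \<Longrightarrow> (F has_vector_derivative \<nu> s *\<^sub>R H s) (at s)"
    and H: "\<And>s. 0 < s \<Longrightarrow> s < t \<Longrightarrow> norm (H s - h) \<le> \<epsilon>"
  shows "norm (f t - f 0 - \<Lambda> t *\<^sub>R F 0 - ((\<Lambda> t)\<^sup>2 / 2) *\<^sub>R h) \<le> \<epsilon> * (\<Lambda> t)\<^sup>2 / 2"
proof -
  have vd: "(\<Lambda> has_vector_derivative \<nu> s) (at s)" if "0 < s" "s < t" for s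
    using \<Lambda>(2)[OF that] by (simp add: has_real_derivative_iff_has_vector_derivative)
  have F1: "norm (F s - F 0 - \<Lambda> s *\<^sub>R h) \<le> \<epsilon> * \<Lambda> s" if s: "0 \<le> s" "s \<le> t" for s
  proof (cases "s = 0")
    case False
    then have "0 < s" using s by simp
    then have "norm ((F s - F 0 - \<Lambda> s *\<^sub>R h) - (F 0 - F 0 - \<Lambda> 0 *\<^sub>R h)) \<le> \<epsilon> * \<Lambda> s - \<epsilon> * \<Lambda> 0"
    proof (rule differentiable_bound_general[where f="\<lambda>s. F s - F 0 - \<Lambda> s *\<^sub>R h" and \<phi>="\<lambda>s. \<epsilon> * \<Lambda> s"])
      have sub: "{0..s} \<subseteq> {0..t}" using s by auto
      show "continuous_on {0..s} (\<lambda>s. F s - F 0 - \<Lambda> s *\<^sub>R h)" "continuous_on {0..s} (\<lambda>s. \<epsilon> * \<Lambda> s)"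
        by (intro continuous_intros continuous_on_subset[OF F(1) sub] continuous_on_subset[OF \<Lambda>(1) sub])+
      fix r assume r: "0 < r" "r < s"
      then have rt: "0 < r" "r < t" using s by auto
      show "((\<lambda>s. F s - F 0 - \<Lambda> s *\<^sub>R h) has_vector_derivative \<nu> r *\<^sub>R H r - 0 - \<nu> r *\<^sub>R h) (at r)"
        by (intro has_vector_derivative_diff F(2)[OF rt] has_vector_derivative_const
            has_vector_derivative_scaleR[OF \<Lambda>(2)[OF rt] has_vector_derivative_const[of h], simplified])
      show "((\<lambda>s. \<epsilon> * \<Lambda> s) has_vector_derivative \<epsilon> * \<nu> r) (at r)"
        by (rule has_vector_derivative_mult_right[OF vd[OF rt]])
      have "norm (\<nu> r *\<^sub>R H r - 0 - \<nu> r *\<^sub>R h) = \<nu> r * norm (H r - h)"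
        using \<nu>[OF rt] by (simp add: scaleR_diff_right[symmetric])
      also have "\<dots> \<le> \<nu> r * \<epsilon>" by (intro mult_left_mono H \<nu> rt)
      finally show "norm (\<nu> r *\<^sub>R H r - 0 - \<nu> r *\<^sub>R h) \<le> \<epsilon> * \<nu> r" by (simp add: mult.commute)
    qed
    then show ?thesis using \<Lambda>(3) by simp
  qed (simp add: \<Lambda>(3))
  show ?thesis
  proof (cases "t = 0")
    case False
    then have "0 < t" using t by simp
    then have "norm ((f t - f 0 - \<Lambda> t *\<^sub>R F 0 - ((\<Lambda> t)\<^sup>2 / 2) *\<^sub>R h) - (f 0 - f 0 - \<Lambda> 0 *\<^sub>R F 0 - ((\<Lambda> 0)\<^sup>2 / 2) *\<^sub>R h))
        \<le> \<epsilon> * (\<Lambda> t)\<^sup>2 / 2 - \<epsilon> * (\<Lambda> 0)\<^sup>2 / 2"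
    proof (rule differentiable_bound_general[where f="\<lambda>t. f t - f 0 - \<Lambda> t *\<^sub>R F 0 - ((\<Lambda> t)\<^sup>2 / 2) *\<^sub>R h"
            and \<phi>="\<lambda>t. \<epsilon> * (\<Lambda> t)\<^sup>2 / 2"])
      show "continuous_on {0..t} (\<lambda>t. f t - f 0 - \<Lambda> t *\<^sub>R F 0 - ((\<Lambda> t)\<^sup>2 / 2) *\<^sub>R h)"
        "continuous_on {0..t} (\<lambda>t. \<epsilon> * (\<Lambda> t)\<^sup>2 / 2)"
        by (intro continuous_intros f(1) \<Lambda>(1); simp)+
      fix r assume r: "0 < r" "r < t"
      have sq: "((\<lambda>t. (\<Lambda> t)\<^sup>2 / 2) has_real_derivative \<nu> r * \<Lambda> r) (at r)"
        by (auto intro!: derivative_eq_intros \<Lambda>(2)[OF r])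
      show "((\<lambda>t. f t - f 0 - \<Lambda> t *\<^sub>R F 0 - ((\<Lambda> t)\<^sup>2 / 2) *\<^sub>R h) has_vector_derivative
          \<nu> r *\<^sub>R F r - 0 - \<nu> r *\<^sub>R F 0 - (\<nu> r * \<Lambda> r) *\<^sub>R h) (at r)"
        by (intro has_vector_derivative_diff f(2)[OF r] has_vector_derivative_const
            has_vector_derivative_scaleR[OF \<Lambda>(2)[OF r] has_vector_derivative_const[of "F 0"], simplified]
            has_vector_derivative_scaleR[OF sq has_vector_derivative_const[of h], simplified])
      show "((\<lambda>t. \<epsilon> * (\<Lambda> t)\<^sup>2 / 2) has_vector_derivative \<epsilon> * (\<nu> r * \<Lambda> r)) (at r)"
        using has_vector_derivative_mult_right[OF sq[unfolded has_real_derivative_iff_has_vector_derivative], of \<epsilon>] by simp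
      have "norm (\<nu> r *\<^sub>R F r - 0 - \<nu> r *\<^sub>R F 0 - (\<nu> r * \<Lambda> r) *\<^sub>R h) = norm (\<nu> r *\<^sub>R (F r - F 0 - \<Lambda> r *\<^sub>R h))"
        by (simp add: scaleR_diff_right)
      also have "\<dots> = \<nu> r * norm (F r - F 0 - \<Lambda> r *\<^sub>R h)"
        using \<nu>[OF r] by simp
      also have "\<dots> \<le> \<nu> r * (\<epsilon> * \<Lambda> r)" using r by (intro mult_left_mono F1 \<nu>) auto
      finally show "norm (\<nu> r *\<^sub>R F r - 0 - \<nu> r *\<^sub>R F 0 - (\<nu> r * \<Lambda> r) *\<^sub>R h) \<le> \<epsilon> * (\<nu> r * \<Lambda> r)"
        by (simp add: mult_ac)
    qed
    then show ?thesis using \<Lambda>(3) by simp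
  qed (simp add: \<Lambda>(3))
qed

text \<open>The hypotheses of \<open>escape\<close> on \<open>\<phi>\<close>, for some constants.\<close>

definition escape_data :: "real \<Rightarrow> real \<Rightarrow> real set \<Rightarrow> (real \<Rightarrow> real) \<Rightarrow> (real \<Rightarrow> real) \<Rightarrow> bool" where
  "escape_data m E D U U' \<longleftrightarrow> (\<exists>\<phi> \<phi>' \<eta> \<kappa> K B. 0 < \<kappa> \<and> 0 < K \<and> 0 < \<eta> \<and>
      (\<forall>\<rho>. (\<phi> has_real_derivative \<phi>' \<rho>) (at \<rho>)) \<and>
      (\<forall>r\<in>D. r < \<eta> \<longrightarrow> \<phi> (r\<^sup>2) = 0) \<and>
      (\<forall>r\<in>D. 0 < r \<longrightarrow> \<bar>\<phi> (r\<^sup>2)\<bar> * r * speed m E U r \<le> B) \<and>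
      (\<forall>r\<in>D. 0 < r \<longrightarrow> \<kappa> \<le> K * speed m E U r - 2 * \<bar>\<phi>' (r\<^sup>2)\<bar> * r\<^sup>2 * (speed m E U r)\<^sup>2
          + \<phi> (r\<^sup>2) * ((speed m E U r)\<^sup>2 - r * U' r / m)))"

text \<open>\<open>J\<close> contains the regular radii, at which the speed is positive and
  \<open>g\<close> is differentiable. \<open>D\<close> may add turning radii and the origin, so
  nothing is required of \<open>U\<close> at 0.\<close>

locale medium =
  fixes m E :: real and D J :: "real set" and U U' g g' :: "real \<Rightarrow> real" and g0 :: real
  assumes mass: "0 < m"
    and D_nn: "\<And>r. r \<in> D \<Longrightarrow> 0 \<le> r"
    and U_der: "\<And>r. r \<in> D \<Longrightarrow> 0 < r \<Longrightarrow> (U has_real_derivative U' r) (at r within D)"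
    and U'_con: "continuous_on (D - {0}) U'"
    and U_leE: "\<And>r. r \<in> D \<Longrightarrow> 0 < r \<Longrightarrow> U r \<le> E"
    and J: "open J" "J \<subseteq> D"
    and J_pos: "\<And>r. r \<in> J \<Longrightarrow> 0 < r"
    and U_less: "\<And>r. r \<in> J \<Longrightarrow> U r < E"
    and g_der: "\<And>r. r \<in> J \<Longrightarrow> (g has_real_derivative g' r) (at r)"
    and g'_con: "continuous_on J g'"
    and g_con: "continuous_on D g"
    and g0_pos: "0 < g0" and g_lower: "\<And>r. r \<in> D \<Longrightarrow> g0 \<le> g r"
    and escape_function: "escape_data m E D U U'"
begin

abbreviation "spd \<equiv> speed m E U"

definition lam :: "real \<Rightarrow> real" where "lam r = g r * spd r"

definition lam' :: "real \<Rightarrow> real" where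
  "lam' r = g' r * spd r - g r * U' r / (m * spd r)"

text \<open>Refers to the path alone, so that statements can quantify over all paths of the medium;
  for a ray it is its \<open>depth\<close>.\<close>

definition ray_depth :: "(real \<Rightarrow> 'a::real_normed_vector) \<Rightarrow> real \<Rightarrow> ennreal" where
  "ray_depth z t = (\<integral>\<^sup>+s\<in>{0..t}. ennreal (lam (norm (z s))) \<partial>lborel)"

text \<open>\<open>drift2 (z t) (z' t)\<close> is the second derivative of a path \<open>z\<close> with respect to its depth.\<close>

definition drift2 :: "'a::real_inner \<Rightarrow> 'a \<Rightarrow> 'a" where
  "drift2 a b = (- (U' (norm a)) / (m * norm a * (lam (norm a))\<^sup>2)) *\<^sub>R a
     - (lam' (norm a) * (a \<bullet> b) / (norm a * (lam (norm a))^3)) *\<^sub>R b"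

lemma spd_pos: "r \<in> J \<Longrightarrow> 0 < spd r"
  using U_less mass by (simp add: speed_def)

lemma g_pos: "r \<in> D \<Longrightarrow> 0 < g r"
  using g_lower g0_pos by force

lemma lam_pos: "r \<in> J \<Longrightarrow> 0 < lam r"
  using spd_pos g_pos J(2) by (auto simp: lam_def intro!: mult_pos_pos)

lemma U_der_J: "r \<in> J \<Longrightarrow> (U has_real_derivative U' r) (at r)"
  using U_der[of r] J J_pos[of r] at_within_open_subset[of r J D] by auto

lemma v_der: "r \<in> J \<Longrightarrow> (spd has_real_derivative - U' r / (m * spd r)) (at r)"
proof -
  assume r: "r \<in> J"
  have p: "0 < 2 / m * (E - U r)" using U_less[OF r] mass by simp
  have d: "((\<lambda>r. 2 / m * (E - U r)) has_real_derivative 2 / m * (0 - U' r)) (at r)"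
    by (intro DERIV_cmult DERIV_diff DERIV_const U_der_J r)
  have "((\<lambda>r. sqrt (2 / m * (E - U r))) has_real_derivative
      inverse (sqrt (2 / m * (E - U r))) / 2 * (2 / m * (0 - U' r))) (at r)"
    by (rule DERIV_chain2[OF DERIV_real_sqrt[OF p] d])
  then show ?thesis using mass by (simp add: speed_def[abs_def] field_simps)
qed

lemma lam_der: "r \<in> J \<Longrightarrow> (lam has_real_derivative lam' r) (at r)"
proof -
  assume r: "r \<in> J"
  have "((\<lambda>r. g r * spd r) has_real_derivative g' r * spd r + (- U' r / (m * spd r)) * g r) (at r)"
    by (rule DERIV_mult[OF g_der[OF r] v_der[OF r]])
  then show ?thesis by (simp add: lam_def[abs_def] lam'_def algebra_simps)
qed

lemma U'_cont_J: "continuous_on J U'"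
  using J J_pos by (intro continuous_on_subset[OF U'_con]) auto

lemma v_cont_J: "continuous_on J spd"
  using v_der by (intro continuous_at_imp_continuous_on) (auto dest: DERIV_isCont)

lemma lam_cont_J: "continuous_on J lam"
  using lam_der by (intro continuous_at_imp_continuous_on) (auto dest: DERIV_isCont)

lemma g_cont_J: "continuous_on J g"
  using continuous_on_subset[OF g_con J(2)] .

lemma lam'_cont_J: "continuous_on J lam'"
  unfolding lam'_def using mass spd_pos
  by (intro continuous_intros g'_con v_cont_J g_cont_J U'_cont_J) force+

lemma drift2_cont:
  "continuous_on {(a, b). norm a \<in> J} (\<lambda>(a, b). drift2 a (b :: 'a::real_inner))"
proof -
  let ?A = "{p :: 'a \<times> 'a. norm (fst p) \<in> J}"
  have n: "continuous_on ?A (\<lambda>p. norm (fst p))" by (intro continuous_intros)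
  have c: "continuous_on ?A (\<lambda>p. h (norm (fst p)))" if "continuous_on J h" for h :: "real \<Rightarrow> real"
    by (rule continuous_on_compose2[OF that n]) auto
  show ?thesis
    unfolding drift2_def case_prod_beta using mass
    by (intro continuous_intros c U'_cont_J lam_cont_J lam'_cont_J)
      (auto dest: J_pos lam_pos simp: less_imp_neq)
qed

end

section \<open>Taylor expansion of position and time in the depth, near the start\<close>

locale ray = medium m E D J U U' g g' g0 + radial_flight m E D U U' z p L g g0
  for m E D J U U' g g' g0 and z p :: "real \<Rightarrow> 'a::euclidean_space" and L
begin

lemma rate_eq: "rate t = lam (norm (z t))"
  by (simp add: rate_def lam_def)

lemma ray_depth_eq: "ray_depth z t = depth t"
  by (simp add: ray_depth_def depth_def rate_eq)

context
  fixes \<delta> :: real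
  assumes \<delta>: "\<delta> \<in> L" and near: "\<And>t. t \<in> {0..\<delta>} \<Longrightarrow> z t \<noteq> 0" "\<And>t. t \<in> {0..\<delta>} \<Longrightarrow> norm (z t) \<in> J"
begin

lemma rate_cont_near: "continuous_on {0..\<delta>} rate"
  using \<delta> near(1) L_sub[of \<delta> 0] by (intro rate_cont) auto

lemma rate_pos_near: "t \<in> {0..\<delta>} \<Longrightarrow> 0 < rate t"
  using near(2) lam_pos by (simp add: rate_eq)

lemma depth_near: "t \<in> {0..\<delta>} \<Longrightarrow> enn2real (depth t) = integral {0..t} rate"
  using depth_real[OF \<delta> near(1), of t] by simp

lemma depth_cont_near: "continuous_on {0..\<delta>} (\<lambda>t. integral {0..t} rate)"
  by (intro indefinite_integral_continuous_1 integrable_continuous_interval rate_cont_near)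

lemma depth_deriv_near:
  assumes "0 < s" "s < \<delta>" shows "((\<lambda>t. integral {0..t} rate) has_real_derivative rate s) (at s)"
proof -
  have "((\<lambda>t. integral {0..t} rate) has_real_derivative rate s) (at s within {0..\<delta>})"
    using assms by (intro integral_has_real_derivative rate_cont_near) auto
  then show ?thesis using at_within_interior[of s "{0..\<delta>}"] assms by simp
qed

lemma rate_deriv_near:
  assumes "0 < s" "s < \<delta>"
  shows "(rate has_real_derivative lam' (norm (z s)) * ((z s \<bullet> p s) / norm (z s))) (at s)"
proof -
  have s: "s \<in> L" "s \<in> {0..\<delta>}" using assms L_down[OF \<delta>, of s] by auto
  have zd: "(z has_derivative (\<lambda>h. h *\<^sub>R p s)) (at s)"
    using velocity[OF s(1) assms(1) near(1)[OF s(2)]] by (simp add: has_vector_derivative_def)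
  have n: "((\<lambda>t. norm (z t)) has_real_derivative (z s \<bullet> p s) / norm (z s)) (at s)"
    unfolding has_field_derivative_def
    by (rule has_derivative_eq_rhs[OF has_derivative_compose[OF zd has_derivative_norm[OF near(1)[OF s(2)]]]])
      (auto simp: sgn_div_norm inner_commute divide_simps)
  show ?thesis
    unfolding rate_eq[abs_def] by (rule DERIV_chain2[OF lam_der[OF near(2)[OF s(2)]] n])
qed

text \<open>With respect to depth the path has derivative \<open>p / rate\<close>, and
  differentiating once more, by the equation of motion, gives \<open>drift2\<close>.\<close>

lemma position_expansion:
  assumes t: "t \<in> {0..\<delta>}" and H: "\<And>s. s \<in> {0..t} \<Longrightarrow> norm (drift2 (z s) (p s) - h) \<le> \<epsilon>"
  shows "norm (z t - z 0 - enn2real (depth t) *\<^sub>R ((1 / lam (norm (z 0))) *\<^sub>R p 0) -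
      ((enn2real (depth t))\<^sup>2 / 2) *\<^sub>R h) \<le> \<epsilon> * (enn2real (depth t))\<^sup>2 / 2"
  unfolding depth_near[OF t] rate_eq[symmetric]
proof (rule second_order_expansion[where F="\<lambda>s. (1 / rate s) *\<^sub>R p s" and \<nu>=rate and H="\<lambda>s. drift2 (z s) (p s)"])
  have sub: "{0..t} \<subseteq> {0..\<delta>}" using t by auto
  have tL: "t \<in> L" using L_down[OF \<delta>, of t] t by auto
  show "0 \<le> t" using t by simp
  show "continuous_on {0..t} (\<lambda>t. integral {0..t} rate)" by (rule continuous_on_subset[OF depth_cont_near sub])
  show "integral {0..0} rate = 0" by simp
  show "continuous_on {0..t} z" by (rule continuous_on_subset[OF cont L_sub[OF tL]]) simp
  have r: "continuous_on {0..t} rate" by (rule continuous_on_subset[OF rate_cont_near sub])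
  have pc: "continuous_on {0..t} p" using near(1) t by (intro p_cont[OF tL]) auto
  have "\<forall>s\<in>{0..t}. rate s \<noteq> 0" using rate_pos_near sub by (metis less_irrefl subsetD)
  then show "continuous_on {0..t} (\<lambda>s. (1 / rate s) *\<^sub>R p s)"
    by (intro continuous_on_scaleR continuous_on_divide continuous_on_const r pc)
  fix s assume s: "0 < s" "s < t"
  then have s\<delta>: "s < \<delta>" "s \<in> {0..\<delta>}" "s \<in> L" using t L_down[OF tL, of s] by auto
  note rp = rate_pos_near[OF s\<delta>(2)] and nz = near(1)[OF s\<delta>(2)]
  show "((\<lambda>t. integral {0..t} rate) has_real_derivative rate s) (at s)" by (rule depth_deriv_near[OF s(1) s\<delta>(1)])
  show "0 \<le> rate s" using rp by simp
  show "(z has_vector_derivative rate s *\<^sub>R ((1 / rate s) *\<^sub>R p s)) (at s)"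
    using velocity[OF s\<delta>(3) s(1) nz] rp by simp
  show "norm (drift2 (z s) (p s) - h) \<le> \<epsilon>" using H[of s] s by simp
  have "((\<lambda>s. 1 / rate s) has_real_derivative - (lam' (norm (z s)) * ((z s \<bullet> p s) / norm (z s))) / (rate s * rate s)) (at s)"
    using DERIV_divide[OF DERIV_const rate_deriv_near[OF s(1) s\<delta>(1)], of 1] rp by simp
  from has_vector_derivative_scaleR[OF this accel[OF s\<delta>(3) s(1) nz]]
  show "((\<lambda>s. (1 / rate s) *\<^sub>R p s) has_vector_derivative rate s *\<^sub>R drift2 (z s) (p s)) (at s)"
  proof (rule has_vector_derivative_eq_rhs)
    have "0 < norm (z s)" using nz by simp
    then show "(1 / rate s) *\<^sub>R (- (U' (norm (z s)) / (m * norm (z s)))) *\<^sub>R z s +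
        (- (lam' (norm (z s)) * ((z s \<bullet> p s) / norm (z s))) / (rate s * rate s)) *\<^sub>R p s =
        rate s *\<^sub>R drift2 (z s) (p s)"
      using rp mass by (simp add: drift2_def rate_eq[symmetric] scaleR_diff_right power2_eq_square power3_eq_cube)
  qed
qed

text \<open>Here the derivative is \<open>1 / rate\<close>, and its own derivative is only bounded,
  which corresponds to \<open>h = 0\<close> in the general expansion. First order suffices because
  the clock of the chain carries a further factor 1/\<surd>n.\<close>

lemma time_expansion:
  assumes t: "t \<in> {0..\<delta>}"
    and H: "\<And>s. s \<in> {0..t} \<Longrightarrow> \<bar>lam' (norm (z s)) * ((z s \<bullet> p s) / norm (z s)) / rate s ^ 3\<bar> \<le> C"
  shows "\<bar>t - enn2real (depth t) / lam (norm (z 0))\<bar> \<le> C * (enn2real (depth t))\<^sup>2 / 2"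
proof -
  have "norm (t - 0 - enn2real (depth t) *\<^sub>R (1 / rate 0) - ((enn2real (depth t))\<^sup>2 / 2) *\<^sub>R 0) \<le> C * (enn2real (depth t))\<^sup>2 / 2"
    unfolding depth_near[OF t]
  proof (rule second_order_expansion[where f="\<lambda>s. s" and F="\<lambda>s. 1 / rate s" and \<nu>=rate
        and H="\<lambda>s. - (lam' (norm (z s)) * ((z s \<bullet> p s) / norm (z s)) / rate s ^ 3)"])
    have sub: "{0..t} \<subseteq> {0..\<delta>}" using t by auto
    show "0 \<le> t" using t by simp
    show "continuous_on {0..t} (\<lambda>t. integral {0..t} rate)" by (rule continuous_on_subset[OF depth_cont_near sub])
    show "integral {0..0} rate = 0" by simp
    show "continuous_on {0..t} (\<lambda>s. s)" by (rule continuous_on_id)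
    have r: "continuous_on {0..t} rate" by (rule continuous_on_subset[OF rate_cont_near sub])
    have "\<forall>s\<in>{0..t}. rate s \<noteq> 0" using rate_pos_near sub by (metis less_irrefl subsetD)
    then show "continuous_on {0..t} (\<lambda>s. 1 / rate s)" by (intro continuous_on_divide continuous_on_const r)
    fix s assume s: "0 < s" "s < t"
    then have s\<delta>: "s < \<delta>" "s \<in> {0..\<delta>}" using t by auto
    note rp = rate_pos_near[OF s\<delta>(2)]
    show "((\<lambda>t. integral {0..t} rate) has_real_derivative rate s) (at s)" by (rule depth_deriv_near[OF s(1) s\<delta>(1)])
    show "0 \<le> rate s" using rp by simp
    show "((\<lambda>s. s) has_vector_derivative rate s *\<^sub>R (1 / rate s)) (at s)" using rp by simp
    show "norm (- (lam' (norm (z s)) * ((z s \<bullet> p s) / norm (z s)) / rate s ^ 3) - 0) \<le> C" using H[of s] s by simp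
    have "((\<lambda>s. 1 / rate s) has_real_derivative - (lam' (norm (z s)) * ((z s \<bullet> p s) / norm (z s))) / (rate s * rate s)) (at s)"
      using DERIV_divide[OF DERIV_const rate_deriv_near[OF s(1) s\<delta>(1)], of 1] rp by simp
    then show "((\<lambda>s. 1 / rate s) has_vector_derivative rate s *\<^sub>R - (lam' (norm (z s)) * ((z s \<bullet> p s) / norm (z s)) / rate s ^ 3)) (at s)"
      using rp by (simp add: has_real_derivative_iff_has_vector_derivative[symmetric] power3_eq_cube)
  qed
  then show ?thesis by (simp add: rate_eq)
qed

end

end

section \<open>Estimates uniform over all paths that start at radii in a compact set\<close>

locale compact_radii = medium +
  fixes S :: "real set"
  assumes S: "compact S" "S \<subseteq> J"
begin

definition starts :: "(real \<Rightarrow> 'a::euclidean_space) \<Rightarrow> (real \<Rightarrow> 'a) \<Rightarrow> real set \<Rightarrow> bool" where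
  "starts z p L \<longleftrightarrow> ray m E D J U U' g g' g0 z p L \<and> norm (z 0) \<in> S"

text \<open>Some closed neighbourhood \<open>S'\<close> of \<open>S\<close>, of width
  \<open>\<eta>\<close>, still lies in \<open>J\<close>. The speed is at most \<open>V\<close> on
  it, so every path stays in it up to time \<open>\<eta> / (2 * V)\<close>.\<close>

lemma uniform_start:
  obtains \<delta> V l A S' where "0 < \<delta>" "0 < V" "0 < l" "compact S'" "S \<subseteq> S'" "S' \<subseteq> J"
    "\<And>r. r \<in> S' \<Longrightarrow> spd r \<le> V" "\<And>r. r \<in> S' \<Longrightarrow> l \<le> lam r" "\<And>r. r \<in> S' \<Longrightarrow> \<bar>U' r\<bar> / m \<le> A"
    "\<And>(z :: real \<Rightarrow> 'a::euclidean_space) p L t. starts z p L \<Longrightarrow> t \<in> {0..\<delta>} \<Longrightarrow>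
      t \<in> L \<and> z t \<noteq> 0 \<and> norm (z t) \<in> S' \<and> norm (z t - z 0) \<le> V * t"
proof (cases "S = {}")
  case True
  have "\<not> starts z p L" for z p :: "real \<Rightarrow> 'a" and L
    unfolding starts_def using True by simp
  then show thesis by (intro that[of 1 1 1 "{}"]) (use True in auto)
next
  case False
  obtain \<eta> where \<eta>: "0 < \<eta>" "(\<Union>x\<in>S. cball x \<eta>) \<subseteq> J"
    using compact_subset_open_imp_cball_epsilon_subset[OF S(1) J(1) S(2)] by blast
  define S' where "S' = (\<Union>x\<in>S. cball x \<eta>)"
  have S'c: "compact S'" unfolding S'_def by (rule compact_minkowski_sum_cball[OF S(1)])
  have SS': "S \<subseteq> S'" using \<eta>(1) by (auto simp: S'_def)
  have S'J: "S' \<subseteq> J" using \<eta>(2) by (simp add: S'_def)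
  have S'ne: "S' \<noteq> {}" using False SS' by auto
  have bdd: "\<exists>C>0. \<forall>r\<in>S'. h r \<le> C" if h: "continuous_on J h" for h :: "real \<Rightarrow> real"
  proof -
    obtain x where "x \<in> S'" "\<And>y. y \<in> S' \<Longrightarrow> h y \<le> h x"
      using continuous_attains_sup[OF S'c S'ne continuous_on_subset[OF h S'J]] by blast
    then show ?thesis by (intro exI[of _ "max 1 (h x)"]) (auto intro: max.coboundedI2)
  qed
  obtain V where V: "0 < V" "\<And>r. r \<in> S' \<Longrightarrow> spd r \<le> V" using bdd[OF v_cont_J] by blast
  have "continuous_on J (\<lambda>r. \<bar>U' r\<bar> / m)" using mass by (intro continuous_intros U'_cont_J) auto
  then obtain A where A: "\<And>r. r \<in> S' \<Longrightarrow> \<bar>U' r\<bar> / m \<le> A" using bdd by blast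
  obtain r0 where r0: "r0 \<in> S'" "\<And>y. y \<in> S' \<Longrightarrow> lam r0 \<le> lam y"
    using continuous_attains_inf[OF S'c S'ne continuous_on_subset[OF lam_cont_J S'J]] by blast
  define \<delta> where "\<delta> = \<eta> / (2 * V)"
  have \<delta>: "0 < \<delta>" "V * \<delta> < \<eta>" using V(1) \<eta>(1) by (auto simp: \<delta>_def)
  show thesis
  proof (rule that[OF \<delta>(1) V(1) lam_pos[of r0] S'c SS' S'J V(2) r0(2) A])
    show "r0 \<in> J" using r0(1) S'J by auto
    fix z p :: "real \<Rightarrow> 'a" and L t
    assume st: "starts z p L" and t: "t \<in> {0..\<delta>}"
    then interpret R: ray m E D J U U' g g' g0 z p L by (simp add: starts_def)
    have z0: "norm (z 0) \<in> S" using st by (simp add: starts_def)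
    have "\<eta> < norm (z 0)"
    proof -
      have "norm (z 0) - \<eta> \<in> cball (norm (z 0)) \<eta>" using \<eta>(1) by (simp add: dist_real_def)
      then have "norm (z 0) - \<eta> \<in> J" using \<eta>(2) z0 by blast
      then show ?thesis using J_pos by force
    qed
    moreover have "spd r \<le> V" if "r \<in> D" "\<bar>r - norm (z 0)\<bar> \<le> \<eta>" for r
    proof -
      have "r \<in> cball (norm (z 0)) \<eta>" using that by (simp add: dist_real_def abs_minus_commute)
      then show ?thesis using V(2) z0 by (auto simp: S'_def)
    qed
    ultimately have near: "\<delta> \<in> L" "norm (z t - z 0) \<le> V * t" "z t \<noteq> 0"
      using R.stays_near[of \<eta> V \<delta>] \<eta>(1) V(1) \<delta> t by auto
    have "V * t \<le> V * \<delta>" using t V(1) by simp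
    then have "\<bar>norm (z t) - norm (z 0)\<bar> \<le> V * \<delta>"
      using near(2) norm_triangle_ineq3[of "z t" "z 0"] by linarith
    then have "norm (z t) \<in> cball (norm (z 0)) \<eta>" using \<delta> by (simp add: dist_real_def abs_minus_commute)
    then have "norm (z t) \<in> S'" using z0 by (auto simp: S'_def)
    then show "t \<in> L \<and> z t \<noteq> 0 \<and> norm (z t) \<in> S' \<and> norm (z t - z 0) \<le> V * t"
      using near R.L_down[OF near(1), of t] t by auto
  qed
qed

end

context compact_radii
begin

lemma depth_lower_near:
  assumes ray: "ray m E D J U U' g g' g0 z p L" and \<delta>: "\<delta> \<in> L" "t \<in> {0..\<delta>}"
    and near: "\<And>s. s \<in> {0..\<delta>} \<Longrightarrow> z s \<noteq> 0 \<and> norm (z s) \<in> J \<and> l \<le> lam (norm (z s))"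
  shows "l * t \<le> enn2real (ray_depth z t)"
proof -
  interpret R: ray m E D J U U' g g' g0 z p L by fact
  note nz = near[THEN conjunct1] near[THEN conjunct2, THEN conjunct1]
  have sub: "{0..t} \<subseteq> {0..\<delta>}" using \<delta>(2) by auto
  have "integral {0..t} (\<lambda>_. l) \<le> integral {0..t} R.rate"
  proof (rule integral_le)
    show "(\<lambda>_. l) integrable_on {0..t}" by (rule integrable_const_ivl)
    show "R.rate integrable_on {0..t}"
      by (rule integrable_continuous_interval[OF continuous_on_subset[OF R.rate_cont_near[OF \<delta>(1) nz] sub]])
    fix s assume "s \<in> {0..t}"
    then have "s \<in> {0..\<delta>}" using \<delta>(2) by auto
    from near[OF this] show "l \<le> R.rate s" by (simp only: R.rate_eq)
  qed
  also have "integral {0..t} R.rate = enn2real (ray_depth z t)"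
    unfolding R.ray_depth_eq by (rule R.depth_near[OF \<delta>(1) nz \<delta>(2), symmetric])
  also have "integral {0..t} (\<lambda>_. l) = l * t" using \<delta>(2) by (simp add: mult.commute)
  finally show ?thesis .
qed

text \<open>Excludes paths that spend a long time at little depth, say by lingering at a turning
  radius. For long times the escape estimate bounds the length, hence the depth, below by a multiple
  of the time.\<close>

lemma linear_growth:
  "\<exists>a>0. \<forall>(z :: real \<Rightarrow> 'a::euclidean_space) p L t. starts z p L \<longrightarrow> 0 \<le> t \<longrightarrow> ennreal (a * t) \<le> ray_depth z t"
proof -
  obtain \<delta> V l A S' where u: "0 < \<delta>" "0 < V" "0 < l" "compact S'" "S \<subseteq> S'" "S' \<subseteq> J"
    "\<And>r. r \<in> S' \<Longrightarrow> spd r \<le> V" "\<And>r. r \<in> S' \<Longrightarrow> l \<le> lam r" "\<And>r. r \<in> S' \<Longrightarrow> \<bar>U' r\<bar> / m \<le> A"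
    and near: "\<And>(z :: real \<Rightarrow> 'a) p L t. starts z p L \<Longrightarrow> t \<in> {0..\<delta>} \<Longrightarrow>
      t \<in> L \<and> z t \<noteq> 0 \<and> norm (z t) \<in> S' \<and> norm (z t - z 0) \<le> V * t"
    by (rule uniform_start) (rule that; assumption)
  obtain \<phi> \<phi>' \<eta> \<kappa> K B where e: "0 < \<kappa>" "0 < K" "0 < \<eta>"
      "\<forall>\<rho>. (\<phi> has_real_derivative \<phi>' \<rho>) (at \<rho>)"
      "\<forall>r\<in>D. r < \<eta> \<longrightarrow> \<phi> (r\<^sup>2) = 0"
      "\<forall>r\<in>D. 0 < r \<longrightarrow> \<bar>\<phi> (r\<^sup>2)\<bar> * r * spd r \<le> B"
      "\<forall>r\<in>D. 0 < r \<longrightarrow> \<kappa> \<le> K * spd r - 2 * \<bar>\<phi>' (r\<^sup>2)\<bar> * r\<^sup>2 * (spd r)\<^sup>2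
          + \<phi> (r\<^sup>2) * ((spd r)\<^sup>2 - r * U' r / m)"
    using escape_function unfolding escape_data_def by (elim exE conjE) (rule that)
  define B' where "B' = max B 0"
  \<comment> \<open>The slopes for three ranges of time: up to \<open>\<delta>\<close>, where the
    rate is at least \<open>l\<close>; beyond \<open>4 * B' / \<kappa>\<close>, where half of
    \<open>\<kappa> * t\<close> survives the boundary term \<open>2 * B\<close> of the escape
    estimate; and in between, where the depth \<open>l * \<delta>\<close> gained at
    \<open>\<delta>\<close> is spread over a bounded time. The summand 1 keeps the last denominator
    positive.\<close>
  define a where "a = min l (min (g0 * \<kappa> / (2 * K)) (l * \<delta> * \<kappa> / (4 * B' + 1)))"
  have B': "0 \<le> B'" "B \<le> B'" by (auto simp: B'_def)
  have a: "0 < a" "a \<le> l" "a \<le> g0 * \<kappa> / (2 * K)" "a \<le> l * \<delta> * \<kappa> / (4 * B' + 1)"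
    using u e g0_pos B' by (auto simp: a_def)
  have "ennreal (a * t) \<le> ray_depth z t" if st: "starts z p L" and t: "0 \<le> t" for z :: "real \<Rightarrow> 'a" and p L t
  proof (cases "ray_depth z t = \<infinity>")
    case False
    have ray: "ray m E D J U U' g g' g0 z p L" using st by (simp add: starts_def)
    then interpret R: ray m E D J U U' g g' g0 z p L .
    have fin: "R.depth t < \<infinity>" using False by (simp add: R.ray_depth_eq less_top)
    have tL: "t \<in> L" using R.depth_infinite_outside[OF t] fin by (cases "t \<in> L") auto
    have \<delta>L: "\<delta> \<in> L" using near[OF st, of \<delta>] u(1) by auto
    have near': "z s \<noteq> 0 \<and> norm (z s) \<in> J \<and> l \<le> lam (norm (z s))" if "s \<in> {0..\<delta>}" for s
      using near[OF st that] u(6,8) by blast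
    have "a * t \<le> enn2real (R.depth t)"
    proof (cases "t \<le> \<delta>")
      case True
      have "a * t \<le> l * t" using a(2) t by (rule mult_right_mono)
      then show ?thesis
        using depth_lower_near[OF ray \<delta>L _ near', of t] t True by (simp add: R.ray_depth_eq)
    next
      case gt: False
      show ?thesis
      proof (cases "4 * B' / \<kappa> \<le> t")
        case True
        define I where "I = integral {0..t} R.path_speed"
        note ps = R.path_speed_depth[OF tL fin]
        have "\<kappa> * t - 2 * B \<le> K * I"
          unfolding I_def by (rule R.escape[OF e(4)[rule_format] e(3) e(5-7)[rule_format] tL ps(1)])
        moreover have "4 * B' \<le> \<kappa> * t" using True e(1) by (simp add: field_simps)
        ultimately have "\<kappa> * t / 2 \<le> K * I" using B' by linarith
        then have "\<kappa> / (2 * K) * t \<le> I" using e(2) by (simp add: field_simps)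
        then have "g0 * (\<kappa> / (2 * K) * t) \<le> g0 * I" using g0_pos by (intro mult_left_mono) auto
        moreover have "a * t \<le> g0 * \<kappa> / (2 * K) * t" using a(3) t by (rule mult_right_mono)
        ultimately show ?thesis using ps(2) by (simp add: I_def mult.assoc)
      next
        case False
        then have "t * \<kappa> \<le> 4 * B' + 1" using e(1) by (simp add: field_simps)
        moreover have "0 < 4 * B' + 1" using B' by simp
        ultimately have "\<kappa> * t / (4 * B' + 1) \<le> 1" by (simp add: mult.commute)
        then have "l * \<delta> * (\<kappa> * t / (4 * B' + 1)) \<le> l * \<delta> * 1" using u(1,3) by (intro mult_left_mono) auto
        moreover have "a * t \<le> l * \<delta> * \<kappa> / (4 * B' + 1) * t" using a(4) t by (rule mult_right_mono)
        moreover have "l * \<delta> \<le> enn2real (R.depth \<delta>)"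
          using depth_lower_near[OF ray \<delta>L _ near', of \<delta>] u(1) by (simp add: R.ray_depth_eq)
        moreover have "enn2real (R.depth \<delta>) \<le> enn2real (R.depth t)"
          using R.depth_mono[of \<delta> t] gt fin by (intro enn2real_mono) auto
        ultimately show ?thesis by simp
      qed
    qed
    then have "ennreal (a * t) \<le> ennreal (enn2real (R.depth t))" by (rule ennreal_leI)
    also have "\<dots> = ray_depth z t" using fin by (simp add: R.ray_depth_eq)
    finally show ?thesis .
  qed simp
  then show ?thesis using a(1) by blast
qed

text \<open>After taking means and multiplying by n, the \<epsilon> term of the position contributes
  \<open>2 * \<epsilon>\<close> and the cubic one a multiple of \<open>C\<close> over \<surd>n. So
  \<open>C\<close> may depend on \<open>\<epsilon>\<close>.\<close>

definition expansion :: "real \<Rightarrow> real \<Rightarrow> (real \<Rightarrow> 'a::euclidean_space) \<Rightarrow> (real \<Rightarrow> 'a) \<Rightarrow> real \<Rightarrow> real \<Rightarrow> bool" where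
  "expansion \<epsilon> C z p t \<Lambda> \<longleftrightarrow>
    norm (z t - z 0 - \<Lambda> *\<^sub>R ((1 / lam (norm (z 0))) *\<^sub>R p 0) - (\<Lambda>\<^sup>2 / 2) *\<^sub>R drift2 (z 0) (p 0))
      \<le> \<epsilon> * \<Lambda>\<^sup>2 + C * \<Lambda>^3 \<and>
    norm (drift2 (z 0) (p 0)) \<le> C \<and> \<bar>t - \<Lambda> / lam (norm (z 0))\<bar> \<le> C * \<Lambda>\<^sup>2"

text \<open>Up to a short time \<open>\<delta>'\<close>, uniform continuity keeps
  \<open>drift2\<close> within \<open>\<epsilon>\<close> of its initial value and Taylor's formula
  applies. Afterwards the depth exceeds the fixed number \<open>b\<close>, and the global bounds on
  displacement and time are absorbed into higher powers of the depth.\<close>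

lemma uniform_expansion:
  assumes \<epsilon>: "0 < \<epsilon>"
  shows "\<exists>C\<ge>0. \<forall>(z :: real \<Rightarrow> 'a::euclidean_space) p L t. starts z p L \<longrightarrow> 0 \<le> t \<longrightarrow> ray_depth z t < \<infinity> \<longrightarrow>
    expansion \<epsilon> C z p t (enn2real (ray_depth z t))"
proof -
  obtain \<delta> V l A S' where u: "0 < \<delta>" "0 < V" "0 < l" "compact S'" "S \<subseteq> S'" "S' \<subseteq> J"
    "\<And>r. r \<in> S' \<Longrightarrow> spd r \<le> V" "\<And>r. r \<in> S' \<Longrightarrow> l \<le> lam r" "\<And>r. r \<in> S' \<Longrightarrow> \<bar>U' r\<bar> / m \<le> A"
    and near: "\<And>(z :: real \<Rightarrow> 'a) p L t. starts z p L \<Longrightarrow> t \<in> {0..\<delta>} \<Longrightarrow>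
      t \<in> L \<and> z t \<noteq> 0 \<and> norm (z t) \<in> S' \<and> norm (z t - z 0) \<le> V * t"
    by (rule uniform_start) (rule that; assumption)
  obtain a where a: "0 < a" "\<And>(z :: real \<Rightarrow> 'a) p L t. starts z p L \<Longrightarrow> 0 \<le> t \<Longrightarrow> ennreal (a * t) \<le> ray_depth z t"
    using linear_growth by blast
  \<comment> \<open>A compact set containing every pair of position and velocity up to time
    \<open>\<delta>\<close>.\<close>
  define W :: "('a \<times> 'a) set" where "W = (cball 0 (Sup S' + 1) \<inter> norm -` S') \<times> cball 0 V"
  have "closed ((norm :: 'a \<Rightarrow> real) -` S')"
    using continuous_closed_vimage[OF compact_imp_closed[OF u(4)], of "norm :: 'a \<Rightarrow> real"] by (simp add: continuous_at_imp_continuous_on)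
  then have Wc: "compact W" unfolding W_def
    by (intro compact_Times closed_Int_compact[of "norm -` S'", unfolded Int_commute[of "norm -` S'"]] compact_cball)
  have WJ: "W \<subseteq> {(x, y). norm x \<in> J}" using u(6) by (auto simp: W_def)
  have inW: "(x, y) \<in> W" if "norm x \<in> S'" "norm y \<le> V" for x y :: 'a
    using that cSup_upper[OF that(1) compact_imp_bounded[OF u(4), THEN bounded_imp_bdd_above]] by (simp add: W_def)
  have dc: "continuous_on W (\<lambda>(x, y). drift2 x y)" by (rule continuous_on_subset[OF drift2_cont WJ])
  obtain CH where CH: "0 \<le> CH" "\<And>x y :: 'a. (x, y) \<in> W \<Longrightarrow> norm (drift2 x y) \<le> CH"
  proof -
    have "bounded ((\<lambda>(x, y). drift2 x y) ` W)" by (intro compact_imp_bounded compact_continuous_image dc Wc)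
    then obtain c where "\<forall>w\<in>(\<lambda>(x, y). drift2 x y) ` W. norm w \<le> c" by (auto simp: bounded_iff)
    then show thesis using that[of "max c 0"] by (force simp: le_max_iff_disj)
  qed
  obtain d where d: "0 < d" "\<And>w w'. w \<in> W \<Longrightarrow> w' \<in> W \<Longrightarrow> dist w' w < d \<Longrightarrow>
      dist ((\<lambda>(x, y). drift2 x y) w') ((\<lambda>(x, y). drift2 x y) w) < \<epsilon>"
    using compact_uniformly_continuous[OF dc Wc] \<epsilon> unfolding uniformly_continuous_on_def by blast
  have "bounded (lam' ` S')"
    by (intro compact_imp_bounded compact_continuous_image u(4) continuous_on_subset[OF lam'_cont_J u(6)])
  then obtain M where M: "\<And>r. r \<in> S' \<Longrightarrow> \<bar>lam' r\<bar> \<le> M" by (auto simp: bounded_iff)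
  define A' where "A' = max A 0"
  \<comment> \<open>Velocity is bounded by \<open>V\<close> and acceleration by \<open>A'\<close>,
    so up to this time position and velocity together move by at most \<open>d / 2\<close>.\<close>
  define \<delta>' where "\<delta>' = min \<delta> (d / (2 * (V + A')))"
  have VA: "0 < V + A'" using u(2) by (simp add: A'_def)
  have \<delta>': "0 < \<delta>'" "\<delta>' \<le> \<delta>" "\<delta>' \<le> d / (2 * (V + A'))" using u(1) d(1) VA by (auto simp: \<delta>'_def)
  define b where "b = l * \<delta>'"
  have b: "0 < b" using u(3) \<delta>'(1) by (simp add: b_def)
  \<comment> \<open>In this order the entries serve the position after \<open>\<delta>'\<close>, the
    bound on \<open>drift2\<close>, the time after \<open>\<delta>'\<close>, and the time before
    \<open>\<delta>'\<close>.\<close>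
  define C where "C = max (max (2 / (g0 * b\<^sup>2) + CH / (2 * b)) CH) (max (1 / (a * b) + 1 / (l * b)) (max M 0 * V / l^3))"
  have C: "2 / (g0 * b\<^sup>2) + CH / (2 * b) \<le> C" "CH \<le> C" "1 / (a * b) + 1 / (l * b) \<le> C" "max M 0 * V / l^3 \<le> C"
    by (auto simp: C_def)
  have C0: "0 \<le> C" using CH C by linarith
  have main: "expansion \<epsilon> C z p t \<Lambda>"
    if st: "starts z p L" and t: "0 \<le> t" and fin: "ray_depth z t < \<infinity>" and \<Lambda>: "\<Lambda> = enn2real (ray_depth z t)"
    for z :: "real \<Rightarrow> 'a" and p L t \<Lambda>
  proof -
    have ray: "ray m E D J U U' g g' g0 z p L" using st by (simp add: starts_def)
    then interpret R: ray m E D J U U' g g' g0 z p L .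
    have fin': "R.depth t < \<infinity>" using fin by (simp add: R.ray_depth_eq)
    have tL: "t \<in> L" using R.depth_infinite_outside[OF t] fin' by (cases "t \<in> L") auto
    have \<Lambda>0: "0 \<le> \<Lambda>" by (simp add: \<Lambda>)
    have nz: "z s \<noteq> 0" "norm (z s) \<in> S'" "norm (z s) \<in> J" "s \<in> L" "norm (z s - z 0) \<le> V * s" if "s \<in> {0..\<delta>}" for s
      using near[OF st that] u(6) by auto
    have \<delta>L: "\<delta> \<in> L" using nz(4)[of \<delta>] u(1) by auto
    have pV: "norm (p s) \<le> V" if "s \<in> {0..\<delta>}" for s
      using R.norm_p[OF nz(4)[OF that] nz(1)[OF that]] u(7)[OF nz(2)[OF that]] by simp
    have start: "(z 0, p 0) \<in> W" using inW nz(2)[of 0] pV[of 0] u(1) by simp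
    have l0: "l \<le> lam (norm (z 0))" using u(8) nz(2)[of 0] u(1) by simp
    have D2: "norm (drift2 (z 0) (p 0)) \<le> CH" using CH(2) start .
    have p0: "norm ((1 / lam (norm (z 0))) *\<^sub>R p 0) \<le> 1 / g0"
    proof -
      have J0: "norm (z 0) \<in> J" using nz(3)[of 0] u(1) by simp
      have "norm (p 0) = spd (norm (z 0))" by (rule R.start_energy)
      then have "norm ((1 / lam (norm (z 0))) *\<^sub>R p 0) = 1 / g (norm (z 0))"
        using spd_pos[OF J0] g_pos[of "norm (z 0)"] J0 J(2) by (auto simp: lam_def)
      also have "\<dots> \<le> 1 / g0" using g_lower[of "norm (z 0)"] J0 J(2) g0_pos by (intro divide_left_mono) auto
      finally show ?thesis .
    qed
    show ?thesis
    proof (cases "t \<le> \<delta>'")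
      case True
      then have t\<delta>: "t \<in> {0..\<delta>}" using t \<delta>' by auto
      have H: "norm (drift2 (z s) (p s) - drift2 (z 0) (p 0)) \<le> \<epsilon>" if s: "s \<in> {0..t}" for s
      proof -
        have s\<delta>: "s \<in> {0..\<delta>}" using s t\<delta> by auto
        have "norm (p s - p 0) \<le> A' * s"
        proof (cases "s = 0")
          case False
          then have "0 < s" using s by simp
          then have "norm (p s - p 0) \<le> A' * s - A' * 0"
          proof (rule differentiable_bound_general)
            show "continuous_on {0..s} p" using nz s\<delta> by (intro R.p_cont) auto
            show "continuous_on {0..s} ((*) A')" by (intro continuous_intros)
            fix r assume r: "0 < r" "r < s"
            then have r\<delta>: "r \<in> {0..\<delta>}" using s\<delta> by auto
            show "(p has_vector_derivative R.acc r) (at r)"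
              unfolding R.acc_def by (rule R.accel[OF nz(4)[OF r\<delta>] r(1) nz(1)[OF r\<delta>]])
            show "((*) A' has_vector_derivative A') (at r)" by (auto intro!: derivative_eq_intros)
            have "norm (R.acc r) = \<bar>U' (norm (z r))\<bar> / m" using nz(1)[OF r\<delta>] mass by (simp add: R.acc_def abs_divide)
            also have "\<dots> \<le> A'" using u(9)[OF nz(2)[OF r\<delta>]] by (simp add: A'_def)
            finally show "norm (R.acc r) \<le> A'" .
          qed
          then show ?thesis by simp
        qed simp
        then have "dist (z s, p s) (z 0, p 0) \<le> V * s + A' * s"
          using nz(5)[OF s\<delta>] sqrt_sum_squares_le_sum[of "norm (z s - z 0)" "norm (p s - p 0)"]
          by (simp add: dist_norm norm_Pair)
        also have "\<dots> \<le> (V + A') * (d / (2 * (V + A')))"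
          unfolding distrib_right[symmetric] using s True \<delta>'(3) VA by (intro mult_left_mono) auto
        also have "\<dots> = d / 2" using VA by (simp only: mult.commute[of 2] divide_divide_eq_left[symmetric] times_divide_eq_right nonzero_mult_div_cancel_left less_imp_neq[OF VA, symmetric] not_False_eq_True)
        also have "\<dots> < d" using d(1) by simp
        finally have "dist (drift2 (z s) (p s)) (drift2 (z 0) (p 0)) < \<epsilon>"
          using d(2)[OF start inW[OF nz(2)[OF s\<delta>] pV[OF s\<delta>]]] by simp
        then show ?thesis by (simp add: dist_norm)
      qed
      have "norm (z t - z 0 - \<Lambda> *\<^sub>R ((1 / lam (norm (z 0))) *\<^sub>R p 0) - (\<Lambda>\<^sup>2 / 2) *\<^sub>R drift2 (z 0) (p 0)) \<le> \<epsilon> * \<Lambda>\<^sup>2 / 2"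
        unfolding \<Lambda> R.ray_depth_eq by (rule R.position_expansion[OF \<delta>L nz(1,3) t\<delta> H])
      also have "\<dots> \<le> \<epsilon> * \<Lambda>\<^sup>2" using \<epsilon> by simp
      also have "\<dots> \<le> \<epsilon> * \<Lambda>\<^sup>2 + C * \<Lambda>^3" using C0 \<Lambda>0 by simp
      finally have 1: "norm (z t - z 0 - \<Lambda> *\<^sub>R ((1 / lam (norm (z 0))) *\<^sub>R p 0) - (\<Lambda>\<^sup>2 / 2) *\<^sub>R drift2 (z 0) (p 0))
          \<le> \<epsilon> * \<Lambda>\<^sup>2 + C * \<Lambda>^3" .
      have H2: "\<bar>lam' (norm (z s)) * ((z s \<bullet> p s) / norm (z s)) / R.rate s ^ 3\<bar> \<le> C" if s: "s \<in> {0..t}" for s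
      proof -
        have s\<delta>: "s \<in> {0..\<delta>}" using s t\<delta> by auto
        have "\<bar>z s \<bullet> p s\<bar> \<le> norm (z s) * V"
          using Cauchy_Schwarz_ineq2[of "z s" "p s"] pV[OF s\<delta>] by (meson mult_left_mono norm_ge_zero order_trans)
        then have zp: "\<bar>(z s \<bullet> p s) / norm (z s)\<bar> \<le> V" using nz(1)[OF s\<delta>] by (simp add: abs_divide divide_simps mult.commute)
        have lr: "l ^ 3 \<le> R.rate s ^ 3" using u(3,8) nz(2)[OF s\<delta>] by (intro power_mono) (auto simp: R.rate_eq)
        have "\<bar>lam' (norm (z s)) * ((z s \<bullet> p s) / norm (z s)) / R.rate s ^ 3\<bar>
            = \<bar>lam' (norm (z s))\<bar> * \<bar>(z s \<bullet> p s) / norm (z s)\<bar> / R.rate s ^ 3"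
          using R.rate_pos_near[OF \<delta>L nz(1,3) s\<delta>] by (simp add: abs_mult abs_divide)
        also have "\<dots> \<le> (max M 0 * V) / l ^ 3"
          using M[OF nz(2)[OF s\<delta>]] zp u(2,3) lr by (intro frac_le mult_mono mult_nonneg_nonneg) auto
        finally show ?thesis using C(4) by linarith
      qed
      have "\<bar>t - \<Lambda> / lam (norm (z 0))\<bar> \<le> C * \<Lambda>\<^sup>2 / 2"
        unfolding \<Lambda> R.ray_depth_eq by (rule R.time_expansion[OF \<delta>L nz(1,3) t\<delta> H2])
      also have "\<dots> \<le> C * \<Lambda>\<^sup>2" using C0 by simp
      finally show ?thesis unfolding expansion_def using 1 D2 C(2) by linarith
    next
      case False
      have "b \<le> enn2real (R.depth \<delta>')"
      proof -
        have "z s \<noteq> 0 \<and> norm (z s) \<in> J \<and> l \<le> lam (norm (z s))" if "s \<in> {0..\<delta>}" for s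
          using nz[OF that] u(8) by blast
        from depth_lower_near[OF ray \<delta>L _ this, of \<delta>'] show ?thesis
          using \<delta>' by (simp add: b_def R.ray_depth_eq)
      qed
      also have "\<dots> \<le> \<Lambda>"
        unfolding \<Lambda> R.ray_depth_eq using R.depth_mono[of \<delta>' t] False fin' by (intro enn2real_mono) auto
      finally have b\<Lambda>: "b \<le> \<Lambda>" .
      have dz: "norm (z t - z 0) \<le> \<Lambda> / g0"
        using R.displacement_le_depth[OF tL fin'] g0_pos by (simp add: \<Lambda> R.ray_depth_eq field_simps)
      have "ennreal (a * t) \<le> ennreal \<Lambda>" using a(2)[OF st t] fin by (simp add: \<Lambda>)
      then have at: "t \<le> \<Lambda> / a" using a(1) \<Lambda>0 by (simp add: ennreal_le_iff field_simps)
      have "norm (z t - z 0 - \<Lambda> *\<^sub>R ((1 / lam (norm (z 0))) *\<^sub>R p 0) - (\<Lambda>\<^sup>2 / 2) *\<^sub>R drift2 (z 0) (p 0))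
        \<le> norm (z t - z 0) + norm (\<Lambda> *\<^sub>R ((1 / lam (norm (z 0))) *\<^sub>R p 0)) + norm ((\<Lambda>\<^sup>2 / 2) *\<^sub>R drift2 (z 0) (p 0))"
        by (meson add_right_mono norm_triangle_ineq4 order_trans)
      also have "\<dots> \<le> \<Lambda> / g0 + \<Lambda> * (1 / g0) + \<Lambda>\<^sup>2 / 2 * CH"
      proof (intro add_mono dz)
        show "norm (\<Lambda> *\<^sub>R ((1 / lam (norm (z 0))) *\<^sub>R p 0)) \<le> \<Lambda> * (1 / g0)"
          unfolding norm_scaleR[of \<Lambda>] abs_of_nonneg[OF \<Lambda>0] by (rule mult_left_mono[OF p0 \<Lambda>0])
        show "norm ((\<Lambda>\<^sup>2 / 2) *\<^sub>R drift2 (z 0) (p 0)) \<le> \<Lambda>\<^sup>2 / 2 * CH"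
          using D2 by (simp add: mult_left_mono)
      qed
      also have "\<dots> = 2 / g0 * \<Lambda> + CH / 2 * \<Lambda>\<^sup>2" by (simp add: field_simps)
      \<comment> \<open>As \<open>b \<le> \<Lambda>\<close>, a factor \<open>\<Lambda> / b\<close>
        may be inserted: twice in the linear term, once in the quadratic one.\<close>
      also have "\<dots> \<le> 2 / (g0 * b\<^sup>2) * \<Lambda>^3 + CH / (2 * b) * \<Lambda>^3"
      proof (rule add_mono)
        have "b\<^sup>2 * \<Lambda> \<le> \<Lambda>\<^sup>2 * \<Lambda>" using b b\<Lambda> \<Lambda>0 by (intro mult_right_mono power_mono) auto
        then have "2 / (g0 * b\<^sup>2) * (b\<^sup>2 * \<Lambda>) \<le> 2 / (g0 * b\<^sup>2) * \<Lambda>^3"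
          using g0_pos b by (intro mult_left_mono) (auto simp: power3_eq_cube power2_eq_square)
        then show "2 / g0 * \<Lambda> \<le> 2 / (g0 * b\<^sup>2) * \<Lambda>^3" using b g0_pos by simp
        have "b * \<Lambda>\<^sup>2 \<le> \<Lambda> * \<Lambda>\<^sup>2" using b\<Lambda> by (intro mult_right_mono) auto
        then have "CH / (2 * b) * (b * \<Lambda>\<^sup>2) \<le> CH / (2 * b) * \<Lambda>^3"
          using CH(1) b by (intro mult_left_mono) (auto simp: power3_eq_cube power2_eq_square)
        then show "CH / 2 * \<Lambda>\<^sup>2 \<le> CH / (2 * b) * \<Lambda>^3" using b by simp
      qed
      also have "\<dots> = (2 / (g0 * b\<^sup>2) + CH / (2 * b)) * \<Lambda>^3" by (simp only: distrib_right)
      also have "\<dots> \<le> C * \<Lambda>^3" using C(1) \<Lambda>0 by (intro mult_right_mono) auto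
      also have "\<dots> \<le> \<epsilon> * \<Lambda>\<^sup>2 + C * \<Lambda>^3" using \<epsilon> by simp
      finally have 1: "norm (z t - z 0 - \<Lambda> *\<^sub>R ((1 / lam (norm (z 0))) *\<^sub>R p 0) - (\<Lambda>\<^sup>2 / 2) *\<^sub>R drift2 (z 0) (p 0))
          \<le> \<epsilon> * \<Lambda>\<^sup>2 + C * \<Lambda>^3" .
      have "\<bar>t - \<Lambda> / lam (norm (z 0))\<bar> \<le> \<Lambda> / a + \<Lambda> / l"
      proof -
        have "\<Lambda> / lam (norm (z 0)) \<le> \<Lambda> / l" using l0 u(3) \<Lambda>0 by (intro divide_left_mono) auto
        moreover have "0 \<le> \<Lambda> / lam (norm (z 0))" using l0 u(3) \<Lambda>0 by simp
        ultimately show ?thesis using at t by linarith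
      qed
      also have "\<dots> = (1 / (a * b) + 1 / (l * b)) * (b * \<Lambda>)" using b a(1) u(3) by (simp add: field_simps)
      also have "\<dots> \<le> (1 / (a * b) + 1 / (l * b)) * \<Lambda>\<^sup>2"
        unfolding power2_eq_square using b b\<Lambda> \<Lambda>0 a(1) u(3) by (intro mult_left_mono mult_right_mono) auto
      also have "\<dots> \<le> C * \<Lambda>\<^sup>2" using C(3) by (intro mult_right_mono) auto
      finally show ?thesis unfolding expansion_def using 1 D2 C(2) by linarith
    qed
  qed
  show ?thesis
    by (intro exI[of _ C] conjI C0 allI impI; use main in blast)
qed

end

section \<open>Admissible media\<close>

text \<open>Where \<open>\<psi> \<le> 0\<close>, a compact set, \<open>w\<close> has a positive
  minimum, so a large \<open>K\<close> outweighs \<open>\<psi>\<close>. The sum is then positive on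
  all of \<open>T\<close>, and compactness makes this uniform. In the applications \<open>w\<close>
  is the speed, which vanishes only at turning radii, and \<open>\<psi>\<close> is positive there by
  the force.\<close>

lemma penalised_pos:
  fixes \<psi> w :: "real \<Rightarrow> real"
  assumes T: "compact T" and \<psi>: "continuous_on T \<psi>" and w: "continuous_on T w"
    and nn: "\<And>r. r \<in> T \<Longrightarrow> 0 \<le> w r" and pos: "\<And>r. r \<in> T \<Longrightarrow> w r = 0 \<Longrightarrow> 0 < \<psi> r"
  shows "\<exists>\<kappa>>0. \<exists>K>0. \<forall>r\<in>T. \<kappa> \<le> K * w r + \<psi> r"
proof -
  define T0 where "T0 = T \<inter> \<psi> -` {..0}"
  have T0c: "compact T0"
  proof -
    have "closed T0"
      unfolding T0_def by (rule continuous_closed_preimage[OF \<psi> compact_imp_closed[OF T] closed_atMost])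
    then have "compact (T \<inter> T0)" by (rule compact_Int_closed[OF T])
    then show ?thesis by (simp add: T0_def)
  qed
  have "\<exists>K>0. \<forall>r\<in>T0. 1 \<le> K * w r + \<psi> r"
  proof (cases "T0 = {}")
    case False
    have sub: "T0 \<subseteq> T" by (auto simp: T0_def)
    obtain a where a: "a \<in> T0" "\<And>r. r \<in> T0 \<Longrightarrow> w a \<le> w r"
      using continuous_attains_inf[OF T0c False continuous_on_subset[OF w sub]] by blast
    obtain b where b: "b \<in> T0" "\<And>r. r \<in> T0 \<Longrightarrow> \<psi> b \<le> \<psi> r"
      using continuous_attains_inf[OF T0c False continuous_on_subset[OF \<psi> sub]] by blast
    have wa: "0 < w a" using nn[of a] pos[of a] a(1) by (fastforce simp: T0_def)
    have \<psi>b: "\<psi> b \<le> 0" using b(1) by (simp add: T0_def)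
    define K where "K = (1 - \<psi> b) / w a"
    have K: "0 < K" using wa \<psi>b by (simp add: K_def)
    moreover have "1 \<le> K * w r + \<psi> r" if r: "r \<in> T0" for r
    proof -
      have "1 - \<psi> b = K * w a" using wa by (simp add: K_def)
      also have "\<dots> \<le> K * w r" using a(2)[OF r] K by simp
      finally show ?thesis using b(2)[OF r] by simp
    qed
    ultimately show ?thesis by blast
  qed (auto intro: exI[of _ 1])
  then obtain K where K: "0 < K" "\<And>r. r \<in> T0 \<Longrightarrow> 1 \<le> K * w r + \<psi> r" by blast
  have p: "0 < K * w r + \<psi> r" if r: "r \<in> T" for r
  proof (cases "r \<in> T0")
    case True then show ?thesis using K(2) by force
  next
    case False
    then have "0 < \<psi> r" using r by (auto simp: T0_def)
    moreover have "0 \<le> K * w r" using nn[OF r] K(1) by simp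
    ultimately show ?thesis by simp
  qed
  show ?thesis
  proof (cases "T = {}")
    case True then show ?thesis by (auto intro: exI[of _ 1])
  next
    case False
    have "continuous_on T (\<lambda>r. K * w r + \<psi> r)" by (intro continuous_intros \<psi> w)
    from continuous_attains_inf[OF T False this] obtain a where
      a: "a \<in> T" "\<And>r. r \<in> T \<Longrightarrow> K * w a + \<psi> a \<le> K * w r + \<psi> r" by blast
    show ?thesis using p[OF a(1)] a(2) K(1) by blast
  qed
qed

lemma continuous_on_of_deriv:
  assumes "\<And>r. r \<in> T \<Longrightarrow> (f has_real_derivative f' r) (at r within D)" "T \<subseteq> D"
  shows "continuous_on T f"
  unfolding continuous_on_eq_continuous_within
proof
  fix r assume "r \<in> T"
  then have "continuous (at r within D) f" by (rule DERIV_continuous[OF assms(1)])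
  then show "continuous (at r within T) f" by (rule continuous_within_subset[OF _ assms(2)])
qed

lemma compact_bound:
  fixes f :: "real \<Rightarrow> real"
  assumes "compact T" "continuous_on T f"
  obtains B where "0 \<le> B" "\<And>r. r \<in> T \<Longrightarrow> f r \<le> B"
proof -
  have "bounded (f ` T)" by (intro compact_imp_bounded compact_continuous_image assms)
  then obtain c where c: "\<forall>x\<in>f ` T. norm x \<le> c" by (auto simp: bounded_iff)
  show thesis
  proof (rule that[of "max c 0"])
    fix r assume "r \<in> T"
    then have "\<bar>f r\<bar> \<le> c" using c by auto
    then show "f r \<le> max c 0" by linarith
  qed simp
qed

text \<open>Here no radius is slow, so \<open>\<phi> = 0\<close> does: the speed alone supplies
  \<open>\<kappa>\<close>.\<close>

lemma escape_data_unbounded: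
  assumes m: "0 < m" and e: "0 < e" "\<And>r. r \<in> D \<Longrightarrow> 0 < r \<Longrightarrow> e \<le> E - U r"
  shows "escape_data m E D U U'"
  unfolding escape_data_def
proof (intro exI conjI)
  show "0 < sqrt (2 / m * e)" "(0::real) < 1" "(0::real) < 1" using m e(1) by auto
  show "\<forall>\<rho>. ((\<lambda>_. 0) has_real_derivative (\<lambda>_. 0) \<rho>) (at \<rho>)" by simp
  have "sqrt (2 / m * e) \<le> speed m E U r" if "r \<in> D" "0 < r" for r
    unfolding speed_def using m e(2)[OF that] by (intro real_sqrt_le_mono mult_left_mono) auto
  then show "\<forall>r\<in>D. 0 < r \<longrightarrow> sqrt (2 / m * e) \<le> 1 * speed m E U r - 2 * \<bar>(\<lambda>_. 0) (r\<^sup>2)\<bar> * r\<^sup>2 * (speed m E U r)\<^sup>2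
          + (\<lambda>_. 0) (r\<^sup>2) * ((speed m E U r)\<^sup>2 - r * U' r / m)"
    by simp
  show "\<forall>r\<in>D. 0 < r \<longrightarrow> \<bar>(\<lambda>_. 0) (r\<^sup>2)\<bar> * r * speed m E U r \<le> 0" by simp
qed simp

text \<open>The force pushes outwards at \<open>a\<close> and inwards at \<open>b\<close>, so
  \<open>\<phi>\<close> must be positive at \<open>a\<^sup>2\<close> and negative at
  \<open>b\<^sup>2\<close>. The choice is \<open>c - \<rho>\<close>, with \<open>c\<close> the
  midpoint of the two squares.\<close>

lemma escape_data_shell:
  assumes m: "0 < m" and ab: "0 < a" "a < b"
    and U: "\<And>r. r \<in> {a..b} \<Longrightarrow> (U has_real_derivative U' r) (at r within {a..b})"
    and U': "continuous_on {a..b} U'"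
    and lt: "\<And>r. a < r \<Longrightarrow> r < b \<Longrightarrow> U r < E" and eq: "U a = E" "U b = E"
    and sgn: "U' a < 0" "0 < U' b"
  shows "escape_data m E {a..b} U U'"
proof -
  let ?w = "speed m E U"
  define c where "c = (a\<^sup>2 + b\<^sup>2) / 2"
  define \<psi> where "\<psi> r = - 2 * r\<^sup>2 * (?w r)\<^sup>2 + (c - r\<^sup>2) * ((?w r)\<^sup>2 - r * U' r / m)" for r
  have wc: "continuous_on {a..b} ?w"
    unfolding speed_def by (intro continuous_intros continuous_on_of_deriv[OF U]) auto
  have "a\<^sup>2 < b\<^sup>2" using ab by (intro power_strict_mono) auto
  then have c: "a\<^sup>2 < c" "c < b\<^sup>2" by (auto simp: c_def)
  have "\<exists>\<kappa>>0. \<exists>K>0. \<forall>r\<in>{a..b}. \<kappa> \<le> K * ?w r + \<psi> r"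
  proof (rule penalised_pos[OF compact_Icc _ wc])
    show "continuous_on {a..b} \<psi>" unfolding \<psi>_def using m by (intro continuous_intros wc U') auto
    fix r assume r: "r \<in> {a..b}"
    have "U r \<le> E" using lt[of r] eq r by (cases "r = a \<or> r = b") (auto simp: less_le)
    then show "0 \<le> ?w r" using m by (simp add: speed_def)
    assume w0: "?w r = 0"
    have "r = a \<or> r = b"
    proof (rule ccontr)
      assume "\<not> (r = a \<or> r = b)"
      then have "U r < E" using lt[of r] r by auto
      then show False using w0 m by (simp add: speed_def)
    qed
    then show "0 < \<psi> r"
    proof
      assume [simp]: "r = a"
      have "0 < (c - a\<^sup>2) * (- (a * U' a / m))"
        using c(1) sgn(1) ab(1) m by (intro mult_pos_pos) (auto simp: mult_pos_neg divide_neg_pos)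
      then show ?thesis using w0 by (simp add: \<psi>_def)
    next
      assume [simp]: "r = b"
      have "0 < (b\<^sup>2 - c) * (b * U' b / m)"
        using c(2) sgn(2) ab m by (intro mult_pos_pos) auto
      then show ?thesis using w0 by (simp add: \<psi>_def algebra_simps)
    qed
  qed
  then obtain \<kappa> K where \<kappa>: "0 < \<kappa>" "0 < K" "\<And>r. r \<in> {a..b} \<Longrightarrow> \<kappa> \<le> K * ?w r + \<psi> r" by blast
  have "continuous_on {a..b} (\<lambda>r. \<bar>c - r\<^sup>2\<bar> * r * ?w r)" by (intro continuous_intros wc)
  then obtain B where B: "\<And>r. r \<in> {a..b} \<Longrightarrow> \<bar>c - r\<^sup>2\<bar> * r * ?w r \<le> B"
    using compact_bound[OF compact_Icc] by blast
  show ?thesis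
    unfolding escape_data_def
  proof (intro exI conjI)
    \<comment> \<open>The shell has no radius below \<open>a\<close>, so \<open>\<eta> = a\<close>
      makes the vanishing condition vacuous.\<close>
    show "0 < \<kappa>" "0 < K" "0 < a" by fact+
    show "\<forall>\<rho>. ((\<lambda>\<rho>. c - \<rho>) has_real_derivative (\<lambda>_. -1) \<rho>) (at \<rho>)" by (auto intro!: derivative_eq_intros)
    show "\<forall>r\<in>{a..b}. 0 < r \<longrightarrow> \<bar>(\<lambda>\<rho>. c - \<rho>) (r\<^sup>2)\<bar> * r * ?w r \<le> B" using B by simp
    show "\<forall>r\<in>{a..b}. 0 < r \<longrightarrow> \<kappa> \<le> K * ?w r - 2 * \<bar>(\<lambda>_. -1) (r\<^sup>2)\<bar> * r\<^sup>2 * (?w r)\<^sup>2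
          + (\<lambda>\<rho>. c - \<rho>) (r\<^sup>2) * ((?w r)\<^sup>2 - r * U' r / m)"
      using \<kappa>(3) by (simp add: \<psi>_def algebra_simps)
  qed auto
qed

text \<open>The potential may be singular at the origin, hence a function \<open>\<phi>\<close> that vanishes near \<open>0\<close>.\<close>

lemma escape_data_ball:
  assumes m: "0 < m" and b: "0 < b"
    and U: "\<And>r. r \<in> {0<..b} \<Longrightarrow> (U has_real_derivative U' r) (at r within {0..b})"
    and U': "continuous_on {0<..b} U'"
    and lt: "\<And>r. 0 < r \<Longrightarrow> r < b \<Longrightarrow> U r < E" and eq: "U b = E" and sgn: "0 < U' b"
    and e: "0 < e" "\<forall>\<^sub>F r in at_right 0. e \<le> E - U r"
  shows "escape_data m E {0..b} U U'"
proof -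
  let ?w = "speed m E U"
  define c where "c = (b/2)\<^sup>2"
  \<comment> \<open>Negative at the only turning radius \<open>b\<close>, where the force points
    inwards; quadratic beyond \<open>c\<close>, hence differentiable at the junction.\<close>
  define \<phi> where "\<phi> \<rho> = - (max 0 (\<rho> - c))\<^sup>2" for \<rho>
  define \<phi>' where "\<phi>' \<rho> = - (2 * max 0 (\<rho> - c))" for \<rho>
  have \<phi>d: "(\<phi> has_real_derivative \<phi>' \<rho>) (at \<rho>)" for \<rho>
  proof (cases \<rho> c rule: linorder_cases)
    case less
    have "((\<lambda>_. 0) has_real_derivative \<phi>' \<rho>) (at \<rho>)" using less by (simp add: \<phi>'_def)
    then show ?thesis
      by (rule has_field_derivative_transform_within_open[where S="{..<c}"]) (use less in \<open>auto simp: \<phi>_def\<close>)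
  next
    case greater
    have "((\<lambda>\<rho>. - (\<rho> - c)\<^sup>2) has_real_derivative \<phi>' \<rho>) (at \<rho>)"
      using greater by (auto intro!: derivative_eq_intros simp: \<phi>'_def)
    then show ?thesis
      by (rule has_field_derivative_transform_within_open[where S="{c<..}"]) (use greater in \<open>auto simp: \<phi>_def\<close>)
  next
    case equal
    have "(\<lambda>h. (\<phi> (\<rho> + h) - \<phi> \<rho>) / h) \<midarrow>0\<rightarrow> 0"
    proof (rule tendsto_0_le[where K=1 and f="\<lambda>h. h"])
      show "\<forall>\<^sub>F h in at 0. norm ((\<phi> (\<rho> + h) - \<phi> \<rho>) / h) \<le> norm h * 1"
        by (intro always_eventually allI) (auto simp: \<phi>_def equal max_def power2_eq_square abs_mult)
    qed (rule tendsto_ident_at)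
    then show ?thesis using equal by (simp add: DERIV_def \<phi>'_def)
  qed
  have small: "\<phi> (r\<^sup>2) = 0" "\<phi>' (r\<^sup>2) = 0" if "0 \<le> r" "r \<le> b/2" for r
  proof -
    have "r\<^sup>2 \<le> c" unfolding c_def using that by (intro power_mono) auto
    then show "\<phi> (r\<^sup>2) = 0" "\<phi>' (r\<^sup>2) = 0" by (auto simp: \<phi>_def \<phi>'_def)
  qed
  define \<psi> where "\<psi> r = - 2 * \<bar>\<phi>' (r\<^sup>2)\<bar> * r\<^sup>2 * (?w r)\<^sup>2 + \<phi> (r\<^sup>2) * ((?w r)\<^sup>2 - r * U' r / m)" for r
  have wc: "continuous_on {0<..b} ?w"
    unfolding speed_def by (intro continuous_intros continuous_on_of_deriv[OF U]) auto
  have sub: "{b/2..b} \<subseteq> {0<..b}" using b by auto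
  note wc' = continuous_on_subset[OF wc sub] and Uc' = continuous_on_subset[OF U' sub]
  have wnn: "0 \<le> ?w r" if "r \<in> {0<..b}" for r
  proof -
    have "U r \<le> E" using lt[of r] eq that by (cases "r = b") (auto simp: less_le)
    then show ?thesis using m by (simp add: speed_def)
  qed
  have \<phi>c: "continuous_on {b/2..b} (\<lambda>r. \<phi> (r\<^sup>2))" "continuous_on {b/2..b} (\<lambda>r. \<phi>' (r\<^sup>2))"
    unfolding \<phi>_def \<phi>'_def by (intro continuous_intros)+
  have "\<exists>\<kappa>>0. \<exists>K>0. \<forall>r\<in>{b/2..b}. \<kappa> \<le> K * ?w r + \<psi> r"
  proof (rule penalised_pos[OF compact_Icc _ wc'])
    show "continuous_on {b/2..b} \<psi>" unfolding \<psi>_def using m by (intro continuous_intros wc' Uc' \<phi>c) auto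
    fix r assume r: "r \<in> {b/2..b}"
    then show "0 \<le> ?w r" using wnn sub by blast
    assume w0: "?w r = 0"
    have rb: "r = b"
    proof (rule ccontr)
      assume "r \<noteq> b"
      then have "U r < E" using lt[of r] r b by auto
      then show False using w0 m by (simp add: speed_def)
    qed
    have "c < b\<^sup>2" using b by (simp add: c_def power2_eq_square)
    then have "0 < (b\<^sup>2 - c)\<^sup>2 * (b * U' b / m)" using sgn b m by (intro mult_pos_pos) auto
    then show "0 < \<psi> r" using w0 \<open>c < b\<^sup>2\<close> by (simp add: rb \<psi>_def \<phi>_def)
  qed
  then obtain \<kappa> K where \<kappa>: "0 < \<kappa>" "0 < K" "\<And>r. r \<in> {b/2..b} \<Longrightarrow> \<kappa> \<le> K * ?w r + \<psi> r" by blast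
  have "continuous_on {b/2..b} (\<lambda>r. \<bar>\<phi> (r\<^sup>2)\<bar> * r * ?w r)" by (intro continuous_intros wc' \<phi>c)
  then obtain B where B: "0 \<le> B" "\<And>r. r \<in> {b/2..b} \<Longrightarrow> \<bar>\<phi> (r\<^sup>2)\<bar> * r * ?w r \<le> B"
    using compact_bound[OF compact_Icc] by blast
  obtain d where d: "0 < d" "\<And>r. 0 < r \<Longrightarrow> r < d \<Longrightarrow> e \<le> E - U r"
    using e(2) unfolding eventually_at_right_field by auto
  \<comment> \<open>Where \<open>\<phi>\<close> vanishes, the speed alone has to supply the bound.
    It is bounded below near 0 by the hypothesis on \<open>E - U\<close>, and on the rest of the
    inner half by compactness.\<close>
  have "\<exists>e'>0. \<forall>r\<in>{0<..b/2}. e' \<le> ?w r"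
  proof -
    define d' where "d' = min d (b/2)"
    have d': "0 < d'" "d' \<le> b/2" "d' \<le> d" using d(1) b by (auto simp: d'_def)
    have "{d'..b/2} \<noteq> {}" using d' by auto
    moreover have "continuous_on {d'..b/2} ?w" by (rule continuous_on_subset[OF wc]) (use d' b in auto)
    ultimately obtain r0 where r0: "r0 \<in> {d'..b/2}" "\<And>r. r \<in> {d'..b/2} \<Longrightarrow> ?w r0 \<le> ?w r"
      using continuous_attains_inf[OF compact_Icc] by blast
    have w0: "0 < ?w r0" using lt[of r0] r0(1) d' b m by (auto simp: speed_def)
    have "min (?w r0) (sqrt (2 / m * e)) \<le> ?w r" if r: "r \<in> {0<..b/2}" for r
    proof (cases "r < d'")
      case True
      then have "e \<le> E - U r" using d(2)[of r] r d' by auto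
      then have "sqrt (2 / m * e) \<le> ?w r" using m by (simp add: speed_def divide_right_mono)
      then show ?thesis by simp
    next
      case False
      then have "?w r0 \<le> ?w r" using r0(2)[of r] r by auto
      then show ?thesis by simp
    qed
    moreover have "0 < min (?w r0) (sqrt (2 / m * e))" using w0 e(1) m by simp
    ultimately show ?thesis by blast
  qed
  then obtain e' where e': "0 < e'" "\<And>r. r \<in> {0<..b/2} \<Longrightarrow> e' \<le> ?w r" by blast
  show ?thesis
    unfolding escape_data_def
  proof (intro exI conjI)
    show "0 < min \<kappa> (K * e')" "0 < K" "0 < b/2" using \<kappa> e' b by auto
    show "\<forall>\<rho>. (\<phi> has_real_derivative \<phi>' \<rho>) (at \<rho>)" using \<phi>d by blast
    show "\<forall>r\<in>{0..b}. r < b/2 \<longrightarrow> \<phi> (r\<^sup>2) = 0" using small by auto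
    show "\<forall>r\<in>{0..b}. 0 < r \<longrightarrow> \<bar>\<phi> (r\<^sup>2)\<bar> * r * ?w r \<le> B"
    proof (intro ballI impI)
      fix r assume r: "r \<in> {0..b}" "0 < r"
      show "\<bar>\<phi> (r\<^sup>2)\<bar> * r * ?w r \<le> B"
        using B(1) B(2)[of r] small(1)[of r] r by (cases "r \<le> b/2") auto
    qed
    show "\<forall>r\<in>{0..b}. 0 < r \<longrightarrow> min \<kappa> (K * e') \<le> K * ?w r - 2 * \<bar>\<phi>' (r\<^sup>2)\<bar> * r\<^sup>2 * (?w r)\<^sup>2
          + \<phi> (r\<^sup>2) * ((?w r)\<^sup>2 - r * U' r / m)"
    proof (intro ballI impI)
      fix r assume r: "r \<in> {0..b}" "0 < r"
      show "min \<kappa> (K * e') \<le> K * ?w r - 2 * \<bar>\<phi>' (r\<^sup>2)\<bar> * r\<^sup>2 * (?w r)\<^sup>2 + \<phi> (r\<^sup>2) * ((?w r)\<^sup>2 - r * U' r / m)"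
      proof (cases "r \<le> b/2")
        case True
        then have "K * e' \<le> K * ?w r" using e'(2)[of r] r \<kappa>(2) by simp
        then show ?thesis using small[of r] True r by simp
      next
        case False
        then have "\<kappa> \<le> K * ?w r + \<psi> r" using \<kappa>(3)[of r] r by simp
        then show ?thesis by (simp add: \<psi>_def)
      qed
    qed
  qed
qed

text \<open>Here the alternatives in the hypotheses are resolved: half-line, shell or ball, and
  regular or singular origin. Each case contributes its own escape function; from here on they are
  treated alike.\<close>

lemma admissible_imp_medium:
  assumes adm: "admissible_medium m E hm hp U g"
  obtains U' g' g0 where "medium m E (radial_dom hm hp) (radial_int hm hp) U U' g g' g0"
    "0 \<le> hm" "convex (radial_dom hm hp)"
    "\<And>r. r \<in> radial_dom hm hp \<Longrightarrow> \<exists>b\<in>radial_dom hm hp. b \<noteq> r"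
proof -
  let ?D = "radial_dom hm hp" and ?J = "radial_int hm hp"
  note A = adm[unfolded admissible_medium_def]
  have m: "0 < m" using A by blast
  have dom: "hm = 0 \<and> hp = \<infinity> \<or> 0 \<le> hm \<and> ereal hm < hp \<and> hp < \<infinity>" using A by blast
  have lt: "\<forall>r\<in>?J. E - U r > 0" using A by blast
  have lo: "hm > 0 \<longrightarrow> U hm = E \<and> (\<exists>d. (U has_real_derivative d) (at hm within ?D) \<and> - d > 0)" using A by blast
  have hi: "hp < \<infinity> \<longrightarrow> U (real_of_ereal hp) = E \<and>
        (\<exists>d. (U has_real_derivative d) (at (real_of_ereal hp) within ?D) \<and> - d < 0)" using A by blast
  have inf: "hp = \<infinity> \<longrightarrow> (\<forall>\<epsilon>>0. (INF r\<in>{hm + \<epsilon>..}. ereal (E - U r)) > 0)" using A by blast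
  have c1: "C1_on ?D U \<and> (hm = 0 \<longrightarrow> E - U 0 > 0) \<or>
      hm = 0 \<and> hp < \<infinity> \<and> C1_on (?D - {0}) U \<and> Liminf (at_right 0) (\<lambda>r. ereal (E - U r)) > 0" using A by blast
  have g: "continuous_on ?D g" "C1_on ?J g" "(INF r\<in>?D. ereal (g r)) > 0" using A by blast+
  have hm0: "0 \<le> hm" using dom by auto
  have Dnn: "0 \<le> r" if "r \<in> ?D" for r using that hm0 by (simp add: radial_dom_def)
  have shape: "(hm = 0 \<and> hp = \<infinity> \<and> ?D = {0..} \<and> ?J = {0<..}) \<or>
      (\<exists>b. hp = ereal b \<and> hm < b \<and> ?D = {hm..b} \<and> ?J = {hm<..<b})"
    using dom by (cases hp) (auto simp: radial_dom_def radial_int_def)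
  have J: "open ?J" "?J \<subseteq> ?D" and cvx: "convex ?D" using shape by auto
  have other: "\<exists>b\<in>?D. b \<noteq> r" if "r \<in> ?D" for r
    using shape
  proof
    assume "hm = 0 \<and> hp = \<infinity> \<and> ?D = {0..} \<and> ?J = {0<..}"
    then show ?thesis using that by (intro bexI[of _ "r + 1"]) auto
  next
    assume "\<exists>b. hp = ereal b \<and> hm < b \<and> ?D = {hm..b} \<and> ?J = {hm<..<b}"
    then obtain b where b: "hm < b" "?D = {hm..b}" by blast
    show ?thesis using b by (cases "r = b") (auto intro: bexI[of _ hm] bexI[of _ b])
  qed
  have Jpos: "0 < r" if "r \<in> ?J" for r using that hm0 by (simp add: radial_int_def)
  obtain U' where U': "\<And>r. r \<in> ?D \<Longrightarrow> 0 < r \<Longrightarrow> (U has_real_derivative U' r) (at r within ?D)" "continuous_on (?D - {0}) U'"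
  proof -
    from c1 show thesis
    proof (elim disjE conjE)
      assume "C1_on ?D U"
      then obtain U' where "\<forall>r\<in>?D. (U has_real_derivative U' r) (at r within ?D)" "continuous_on ?D U'"
        unfolding C1_on_def by blast
      then show thesis by (intro that[of U']) (auto intro: continuous_on_subset)
    next
      assume "C1_on (?D - {0}) U"
      then obtain U' where u: "\<forall>r\<in>?D - {0}. (U has_real_derivative U' r) (at r within ?D - {0})" "continuous_on (?D - {0}) U'"
        unfolding C1_on_def by blast
      \<comment> \<open>Away from 0, removing the origin does not change the neighbourhoods, so the
        derivatives on the punctured domain are derivatives within the whole domain.\<close>
      have eq: "at r within ?D - {0} = at r within ?D" if "0 < r" for r
        by (rule at_within_nhd[where S="{0<..}"]) (use that in auto)
      show thesis
      proof (rule that[of U'])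
        fix r assume r: "r \<in> ?D" "0 < r"
        then have "r \<in> ?D - {0}" by simp
        then show "(U has_real_derivative U' r) (at r within ?D)" using u(1) eq[OF r(2)] by metis
      qed (rule u(2))
    qed
  qed
  obtain g' where g': "\<forall>r\<in>?J. (g has_real_derivative g' r) (at r within ?J)" "continuous_on ?J g'"
    using g(2) unfolding C1_on_def by blast
  obtain g0 where g0: "0 < ereal g0" "ereal g0 < (INF r\<in>?D. ereal (g r))"
    using ereal_dense2[OF g(3)] by blast
  have gge: "g0 \<le> g r" if "r \<in> ?D" for r
    using less_INF_D[OF g0(2) that] by simp
  \<comment> \<open>The sign conditions at the turning radii are stated for some one-sided
    derivative; uniqueness transfers them to \<open>U'\<close>.\<close>
  have uniq: "d = U' r" if dU: "(U has_real_derivative d) (at r within ?D)" and r: "r \<in> ?D" "0 < r" for r d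
  proof -
    have "at r within ?D \<noteq> bot"
    proof -
      obtain b where b: "b \<in> ?D" "b \<noteq> r" using other[OF r(1)] by blast
      have "r islimpt ?D"
        using cvx r(1) b by (metis connected_imp_perfect convex_connected insert_absorb insert_iff singletonD singletonI)
      then show ?thesis by (simp add: trivial_limit_within)
    qed
    then show ?thesis
      using vector_derivative_unique_within[of r ?D U d "U' r"] dU U'(1)[OF r]
      by (simp add: has_real_derivative_iff_has_vector_derivative)
  qed
  \<comment> \<open>Both readings of positivity at the origin, by value and by lower limit, give
    this common form.\<close>
  have near0: "\<exists>e>0. \<forall>\<^sub>F r in at_right 0. e \<le> E - U r" if hm: "hm = 0"
    using c1
  proof (elim disjE conjE)
    assume a: "C1_on ?D U" "hm = 0 \<longrightarrow> E - U 0 > 0"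
    then obtain d where d: "\<forall>r\<in>?D. (U has_real_derivative d r) (at r within ?D)" unfolding C1_on_def by blast
    have D0: "0 \<in> ?D" using hm shape by auto
    have "continuous (at 0 within ?D) U" using d D0 DERIV_continuous by blast
    then have l: "(U \<longlongrightarrow> U 0) (at 0 within ?D)" by (simp add: continuous_within)
    have "at_right 0 = at 0 within ?J"
      using shape
    proof
      assume "\<exists>b. hp = ereal b \<and> hm < b \<and> ?D = {hm..b} \<and> ?J = {hm<..<b}"
      then obtain b where b: "hm < b" "?J = {hm<..<b}" by blast
      have "at_right 0 = at 0 within {0<..<b}"
        by (rule at_within_nhd[where S="{..<b}"]) (use b(1) hm in auto)
      then show ?thesis using b(2) unfolding hm by (simp only:)
    next
      assume "hm = 0 \<and> hp = \<infinity> \<and> ?D = {0..} \<and> ?J = {0<..}"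
      then have "?J = {0<..}" by blast
      then show ?thesis by (simp only:)
    qed
    also have "\<dots> \<le> at 0 within ?D" using J(2) by (rule at_le)
    finally have "(U \<longlongrightarrow> U 0) (at_right 0)" using l by (rule tendsto_mono)
    then have "((\<lambda>r. E - U r) \<longlongrightarrow> E - U 0) (at_right 0)" by (intro tendsto_intros)
    moreover have "(E - U 0) / 2 < E - U 0" using a(2) hm by simp
    ultimately have "\<forall>\<^sub>F r in at_right 0. (E - U 0) / 2 < E - U r" by (rule order_tendstoD)
    then have "\<forall>\<^sub>F r in at_right 0. (E - U 0) / 2 \<le> E - U r" by eventually_elim simp
    moreover have "0 < (E - U 0) / 2" using a(2) hm by simp
    ultimately show ?thesis by blast
  next
    assume "Liminf (at_right 0) (\<lambda>r. ereal (E - U r)) > 0"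
    then obtain e where e: "0 < ereal e" "ereal e < Liminf (at_right 0) (\<lambda>r. ereal (E - U r))"
      using ereal_dense2 by blast
    have "\<forall>\<^sub>F r in at_right 0. ereal e < ereal (E - U r)" by (rule less_LiminfD[OF e(2)])
    then have "\<forall>\<^sub>F r in at_right 0. e \<le> E - U r" by eventually_elim simp
    then show ?thesis using e(1) by auto
  qed
  have esc: "escape_data m E ?D U U'"
    using shape
  proof
    assume s: "hm = 0 \<and> hp = \<infinity> \<and> ?D = {0..} \<and> ?J = {0<..}"
    obtain e d where e: "0 < e" "0 < d" "\<And>r. 0 < r \<Longrightarrow> r < d \<Longrightarrow> e \<le> E - U r"
      using near0 s unfolding eventually_at_right_field by blast
    have "(INF r\<in>{hm + d..}. ereal (E - U r)) > 0" using inf s e(2) by blast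
    then obtain e2 where e2: "0 < ereal e2" "ereal e2 < (INF r\<in>{hm + d..}. ereal (E - U r))"
      using ereal_dense2 by blast
    show ?thesis
    proof (rule escape_data_unbounded[OF m])
      show "0 < min e e2" using e e2(1) by simp
      fix r assume r: "r \<in> ?D" "0 < r"
      show "min e e2 \<le> E - U r"
      proof (cases "r < d")
        case True then show ?thesis using e(3)[of r] r by simp
      next
        case False
        then have "ereal e2 < ereal (E - U r)" using s by (intro less_INF_D[OF e2(2)]) auto
        then show ?thesis by simp
      qed
    qed
  next
    assume "\<exists>b. hp = ereal b \<and> hm < b \<and> ?D = {hm..b} \<and> ?J = {hm<..<b}"
    then obtain b where b: "hp = ereal b" "hm < b" "?D = {hm..b}" "?J = {hm<..<b}" by blast
    have bp: "0 < b" using hm0 b(2) by simp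
    have Ub: "U b = E" "0 < U' b"
    proof -
      obtain d where d: "U b = E" "(U has_real_derivative d) (at b within ?D)" "- d < 0"
        using hi b(1) by auto
      have "b \<in> ?D" using b by simp
      then show "U b = E" "0 < U' b" using uniq[OF d(2)] d bp by auto
    qed
    show ?thesis
    proof (cases "hm = 0")
      case True
      obtain e where e: "0 < e" "\<forall>\<^sub>F r in at_right 0. e \<le> E - U r" using near0[OF True] by blast
      have "?D - {0} = {0<..b}" using b True by auto
      then have cU: "continuous_on {0<..b} U'" using U'(2) by simp
      have dU: "(U has_real_derivative U' r) (at r within {0..b})" if "r \<in> {0<..b}" for r
        using U'(1)[of r] that b True by auto
      have lU: "U r < E" if "0 < r" "r < b" for r using lt b(4) True that by auto
      have "escape_data m E {0..b} U U'"
        by (rule escape_data_ball[OF m bp dU cU lU Ub e])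
      then show ?thesis using b True by simp
    next
      case False
      then have hmp: "0 < hm" using hm0 by simp
      have "hm \<in> ?D" using b by simp
      obtain d where d: "U hm = E" "(U has_real_derivative d) (at hm within ?D)" "- d > 0" using lo hmp by blast
      have Uh: "U' hm < 0" using uniq[OF d(2) \<open>hm \<in> ?D\<close> hmp] d(3) by simp
      have "?D - {0} = {hm..b}" using b hmp by auto
      then have cU: "continuous_on {hm..b} U'" using U'(2) by simp
      have dU: "(U has_real_derivative U' r) (at r within {hm..b})" if "r \<in> {hm..b}" for r
        using U'(1)[of r] that b hmp by auto
      have lU: "U r < E" if "hm < r" "r < b" for r using lt b(4) that by auto
      have "escape_data m E {hm..b} U U'"
        by (rule escape_data_shell[OF m hmp b(2) dU cU lU d(1) Ub(1) Uh Ub(2)])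
      then show ?thesis using b by simp
    qed
  qed
  have le: "U r \<le> E" if r: "r \<in> ?D" "0 < r" for r
    using shape
  proof
    assume "hm = 0 \<and> hp = \<infinity> \<and> ?D = {0..} \<and> ?J = {0<..}"
    then show ?thesis using lt r by force
  next
    assume "\<exists>b. hp = ereal b \<and> hm < b \<and> ?D = {hm..b} \<and> ?J = {hm<..<b}"
    then obtain b where b: "hp = ereal b" "?D = {hm..b}" "?J = {hm<..<b}" by blast
    consider "r = hm" | "r = b" | "r \<in> ?J" using r b by force
    then show ?thesis using lo hi r lt b(1) by cases auto
  qed
  have "medium m E ?D ?J U U' g g' g0"
  proof
    show "(g has_real_derivative g' r) (at r)" if "r \<in> ?J" for r
      using g'(1) that at_within_open[OF that J(1)] by auto
  qed (use m Dnn U' le J Jpos lt g' g(1) g0(1) gge esc in \<open>simp_all\<close>)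
  then show thesis using that hm0 cvx other by blast
qed

section \<open>The scaled free path chain\<close>

text \<open>With \<open>c\<close> equal to n to the power -1/4, the force scales by the square of
  \<open>c\<close> and the speed by \<open>c\<close>. Running the trajectory at time
  \<open>s / c\<close> divides velocities by \<open>c\<close> and accelerations by its square, so n
  disappears from the equation of motion.\<close>

lemma trajectory_imp_ray:
  fixes x u :: "real^3"
  assumes med: "medium m E D J U U' g g' g0" and cvx: "convex D"
    and other: "\<And>r. r \<in> D \<Longrightarrow> \<exists>b\<in>D. b \<noteq> r"
    and n: "n \<ge> 1" and x: "norm x \<in> J" and u: "norm u = 1"
    and tr: "is_trajectory m D (scaled_potential U n) x (scaled_speed m E U n (norm x) *\<^sub>R u) y"
    and c: "c = real n powr (- 1 / 4)"
  shows "\<exists>p L. ray m E D J U U' g g' g0 (\<lambda>s. y (s / c)) p L \<and> p 0 = speed m E U (norm x) *\<^sub>R u \<and> y 0 = x"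
proof -
  interpret medium m E D J U U' g g' g0 by (rule med)
  have c0: "0 < c" using n by (simp add: c)
  have csq: "real n powr (- 1 / 2) = c * c" unfolding c by (simp flip: powr_add)
  obtain \<tau> :: ereal and y' where \<tau>: "0 < \<tau>"
    and life: "\<tau> = \<infinity> \<or> filterlim (\<lambda>t. norm (y t)) at_top (at_left (real_of_ereal \<tau>))"
    and out: "\<forall>t. t < 0 \<or> \<tau> \<le> ereal t \<longrightarrow> y t = 0"
    and inD: "\<forall>t. 0 \<le> t \<and> ereal t < \<tau> \<longrightarrow> norm (y t) \<in> D"
    and cont: "continuous_on {t. 0 \<le> t \<and> ereal t < \<tau>} y"
    and y0: "y 0 = x"
    and v0: "(y has_vector_derivative (scaled_speed m E U n (norm x) *\<^sub>R u)) (at 0 within {0..})"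
    and ode: "\<forall>t. 0 < t \<and> ereal t < \<tau> \<and> y t \<noteq> 0 \<longrightarrow> (y has_vector_derivative y' t) (at t) \<and>
        (\<exists>a. (y' has_vector_derivative a) (at t) \<and> m *\<^sub>R a = - radial_grad D (scaled_potential U n) (y t))"
    and refl: "\<forall>T s. 0 < T \<and> y T = 0 \<and> 0 \<le> s \<and> s \<le> T \<and> ereal (T + s) < \<tau> \<and>
        (\<forall>t\<in>{T - s<..<T}. y t \<noteq> 0) \<longrightarrow> y (T + s) = - y (T - s)"
    using tr unfolding is_trajectory_def by (elim exE conjE) (rule that; assumption)
  \<comment> \<open>The function \<open>y'\<close> carries information at positive times only, so
    the initial velocity is inserted by hand.\<close>
  define p where "p s = (if s = 0 then speed m E U (norm x) *\<^sub>R u else (1 / c) *\<^sub>R y' (s / c))" for s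
  define L where "L = {s. 0 \<le> s \<and> ereal (s / c) < \<tau>}"
  have comp: "((\<lambda>s. f (s / c)) has_vector_derivative (1 / c) *\<^sub>R d) (at s within A)"
    if "(f has_vector_derivative d) (at (s / c) within (\<lambda>s. s / c) ` A)" for f :: "real \<Rightarrow> real^3" and d s A
  proof -
    have "((\<lambda>s. s / c) has_vector_derivative 1 / c) (at s within A)"
      using c0 by (auto intro!: derivative_eq_intros simp: has_real_derivative_iff_has_vector_derivative[symmetric])
    from vector_diff_chain_within[OF this that] show ?thesis by (simp add: o_def)
  qed
  have compat: "((\<lambda>s. f (s / c)) has_vector_derivative (1 / c) *\<^sub>R d) (at s)"
    if "(f has_vector_derivative d) (at (s / c))" for f :: "real \<Rightarrow> real^3" and d s
    using comp[OF has_vector_derivative_at_within[OF that]] by blast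
  have "ray m E D J U U' g g' g0 (\<lambda>s. y (s / c)) p L"
  proof (intro_locales)
    show "radial_motion m E D U U' (\<lambda>s. y (s / c)) p L"
    proof
      show "L = {0..} \<or> (\<exists>b>0. L = {0..<b} \<and> filterlim (\<lambda>t. norm (y (t / c))) at_top (at_left b))"
      proof (cases \<tau>)
        case (real b)
        have b: "0 < b" using \<tau> real by simp
        have tc: "filterlim (\<lambda>t. t / c) (at_left b) (at_left (b * c))"
          unfolding filterlim_at
        proof
          show "\<forall>\<^sub>F t in at_left (b * c). t / c \<in> {..<b} \<and> t / c \<noteq> b"
          proof -
            have "\<forall>\<^sub>F t in at_left (b * c). t \<in> {..<b * c}" by (simp add: eventually_at_filter)
            then show ?thesis by eventually_elim (use c0 in \<open>auto simp: field_simps\<close>)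
          qed
          have "((\<lambda>t. t / c) \<longlongrightarrow> b * c / c) (at_left (b * c))" using c0 by (intro tendsto_intros) auto
          then show "((\<lambda>t. t / c) \<longlongrightarrow> b) (at_left (b * c))" using c0 by simp
        qed
        have "filterlim (\<lambda>t. norm (y t)) at_top (at_left b)" using life real by simp
        then have "filterlim (\<lambda>t. norm (y (t / c))) at_top (at_left (b * c))"
          using tc by (rule filterlim_compose)
        moreover have "L = {0..<b * c}" using c0 real by (auto simp: L_def field_simps)
        ultimately show ?thesis using b c0 by (intro disjI2 exI[of _ "b * c"]) auto
      next
        case PInf
        then show ?thesis by (auto simp: L_def)
      qed (use \<tau> in auto)
      show "y (t / c) = 0" if "t \<notin> L" for t
        using that c0 by (intro out[rule_format]) (auto simp: L_def not_less divide_less_0_iff)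
      show "norm (y (t / c)) \<in> D" if "t \<in> L" for t
        using that c0 by (intro inD[rule_format]) (auto simp: L_def)
      show "continuous_on L (\<lambda>s. y (s / c))"
        by (rule continuous_on_compose2[OF cont]) (use c0 in \<open>auto simp: L_def intro!: continuous_intros\<close>)
      show "y (0 / c) \<noteq> 0" using y0 x J_pos by fastforce
      show "((\<lambda>s. y (s / c)) has_vector_derivative p 0) (at 0 within {0..})"
      proof -
        have "(\<lambda>s. s / c) ` {0..} \<subseteq> {0..}" using c0 by auto
        then have "((\<lambda>s. y (s / c)) has_vector_derivative (1 / c) *\<^sub>R (scaled_speed m E U n (norm x) *\<^sub>R u)) (at 0 within {0..})"
          using v0 by (intro comp) (auto intro: has_vector_derivative_within_subset)
        moreover have "(1 / c) *\<^sub>R (scaled_speed m E U n (norm x) *\<^sub>R u) = p 0"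
          using c0 unfolding scaled_speed_def c[symmetric] p_def by simp
        ultimately show ?thesis by simp
      qed
      show "norm (p 0) = speed m E U (norm (y (0 / c)))"
        using spd_pos[OF x] u y0 by (simp add: p_def)
      fix t assume t: "t \<in> L" "0 < t" "y (t / c) \<noteq> 0"
      then have tc: "0 < t / c" "ereal (t / c) < \<tau>" using c0 by (auto simp: L_def)
      have o: "(y has_vector_derivative y' (t / c)) (at (t / c)) \<and> (\<exists>a. (y' has_vector_derivative a) (at (t / c)) \<and>
          m *\<^sub>R a = - radial_grad D (scaled_potential U n) (y (t / c)))"
        using ode tc t(3) by blast
      show "((\<lambda>s. y (s / c)) has_vector_derivative p t) (at t)"
        using compat[OF o[THEN conjunct1]] t(2) by (simp add: p_def)
      obtain a where a: "(y' has_vector_derivative a) (at (t / c))"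
        "m *\<^sub>R a = - radial_grad D (scaled_potential U n) (y (t / c))" using o by blast
      let ?r = "norm (y (t / c))"
      have r: "?r \<in> D" "0 < ?r" using inD[rule_format, of "t / c"] tc t(3) by auto
      obtain b where b: "b \<in> D" "b \<noteq> ?r" using other[OF r(1)] by blast
      have sd: "(scaled_potential U n has_real_derivative c * c * U' ?r) (at ?r within D)"
        unfolding scaled_potential_def[abs_def] csq by (rule DERIV_cmult[OF U_der[OF r]])
      have "radial_grad D (scaled_potential U n) (y (t / c)) = (c * c * U' ?r / ?r) *\<^sub>R y (t / c)"
        by (rule radial_grad_eq[OF cvx r(1) b t(3) D_nn sd])
      then have "(1 / m) *\<^sub>R (m *\<^sub>R a) = (1 / m) *\<^sub>R (- ((c * c * U' ?r / ?r) *\<^sub>R y (t / c)))" using a(2) by simp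
      then have a': "(1 / c) *\<^sub>R ((1 / c) *\<^sub>R a) = (- (U' ?r / (m * ?r))) *\<^sub>R y (t / c)"
        using mass c0 by simp
      have "((\<lambda>s. (1 / c) *\<^sub>R y' (s / c)) has_vector_derivative (1 / c) *\<^sub>R ((1 / c) *\<^sub>R a)) (at t)"
        using has_vector_derivative_scaleR[OF DERIV_const[of "1 / c"] compat[OF a(1)]] by simp
      then have "(p has_vector_derivative (1 / c) *\<^sub>R ((1 / c) *\<^sub>R a)) (at t)"
        by (rule has_vector_derivative_transform_within_open[where S="{0<..}"]) (use t(2) in \<open>auto simp: p_def\<close>)
      then show "(p has_vector_derivative (- (U' ?r / (m * ?r))) *\<^sub>R y (t / c)) (at t)" by (simp only: a')
    next
      fix T s assume T: "0 < T" "y (T / c) = 0" "0 \<le> s" "s \<le> T" "T + s \<in> L" and nz: "\<forall>t\<in>{T - s<..<T}. y (t / c) \<noteq> 0"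
      have "y (T / c + s / c) = - y (T / c - s / c)"
      proof (rule refl[rule_format], intro conjI)
        show "\<forall>t\<in>{T / c - s / c<..<T / c}. y t \<noteq> 0"
        proof
          fix t assume t: "t \<in> {T / c - s / c<..<T / c}"
          then have "t * c \<in> {T - s<..<T}" using c0 by (auto simp: field_simps)
          then show "y t \<noteq> 0" using nz c0 by force
        qed
      qed (use T c0 in \<open>auto simp: L_def divide_right_mono add_divide_distrib\<close>)
      then show "y ((T + s) / c) = - y ((T - s) / c)" by (simp add: add_divide_distrib diff_divide_distrib)
    qed (use mass D_nn U_der U'_con U_leE in auto)
    show "radial_flight_axioms D g g0"
      by (rule radial_flight_axioms.intro) (use g0_pos g_lower g_con in auto)
  qed
  then show ?thesis using y0 by (intro exI[of _ p] exI[of _ L]) (simp add: p_def)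
qed

text \<open>The density contributes \<surd>n and the speed \<open>c\<close>; the latter is absorbed
  by the substitution in time.\<close>

lemma optical_depth_scaled:
  assumes n: "n \<ge> 1" and c: "c = real n powr (- 1 / 4)"
    and z: "ray m E D J U U' g g' g0 (\<lambda>s. y (s / c)) p L"
  shows "optical_depth (scaled_density g n) (scaled_speed m E U n) y t =
    ennreal (sqrt (real n)) * radial_flight.depth m E U (\<lambda>s. y (s / c)) g (c * t)"
proof -
  interpret R: ray m E D J U U' g g' g0 "\<lambda>s. y (s / c)" p L by (rule z)
  have c0: "0 < c" using n by (simp add: c)
  have c': "real n powr - (1 / 4) = c" using c by simp
  have "R.depth (c * t) = (\<integral>\<^sup>+s. ennreal (R.rate s) * indicator {0..c * t} s \<partial>lborel)" by (simp add: R.depth_def)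
  also have "\<dots> = \<bar>c\<bar> * (\<integral>\<^sup>+s. ennreal (R.rate (0 + c * s)) * indicator {0..c * t} (0 + c * s) \<partial>lborel)"
    by (rule nn_integral_real_affine) (use c0 in auto)
  also have "\<dots> = (\<integral>\<^sup>+s. ennreal c * (ennreal (R.rate (c * s)) * indicator {0..t} s) \<partial>lborel)"
  proof (subst nn_integral_cmult[symmetric])
    have eq: "indicator {0..c * t} (0 + c * s) = (indicator {0..t} s :: ennreal)" for s
      using c0 by (auto simp: indicator_def zero_le_mult_iff)
    show "(\<integral>\<^sup>+s. ennreal \<bar>c\<bar> * (ennreal (R.rate (0 + c * s)) * indicator {0..c * t} (0 + c * s)) \<partial>lborel) =
        (\<integral>\<^sup>+s. ennreal c * (ennreal (R.rate (c * s)) * indicator {0..t} s) \<partial>lborel)"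
      using c0 by (simp add: eq[simplified])
  qed measurable
  finally have "ennreal (sqrt (real n)) * R.depth (c * t) =
      (\<integral>\<^sup>+s. ennreal (sqrt (real n)) * (ennreal c * (ennreal (R.rate (c * s)) * indicator {0..t} s)) \<partial>lborel)"
    by (subst nn_integral_cmult) (simp_all, measurable)
  also have "\<dots> = optical_depth (scaled_density g n) (scaled_speed m E U n) y t"
    unfolding optical_depth_def
  proof (rule nn_integral_cong)
    fix s
    have "scaled_density g n (norm (y s)) * scaled_speed m E U n (norm (y s)) = sqrt (real n) * (c * R.rate (c * s))"
      using c0 c' by (simp add: scaled_density_def scaled_speed_def R.rate_def)
    then show "ennreal (sqrt (real n)) * (ennreal c * (ennreal (R.rate (c * s)) * indicator {0..t} s)) =
        ennreal (scaled_density g n (norm (y s)) * scaled_speed m E U n (norm (y s))) * indicator {0..t} s"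
      using c0 by (simp add: ennreal_mult' mult.assoc)
  qed
  finally show ?thesis by simp
qed

text \<open>The linear lower bound makes the hazard unbounded, so the flight time is finite. Right
  continuity is used only at finite depth, that is, before the end of the lifetime.\<close>

lemma (in radial_flight) cumulative_hazard_scaled:
  assumes a: "0 < a" "\<And>t. 0 \<le> t \<Longrightarrow> ennreal (a * t) \<le> depth t" and N: "0 < N" and c: "0 < c"
  shows "cumulative_hazard (\<lambda>t. ennreal N * depth (c * t))"
proof -
  have inv: "ennreal (1 / N) * (ennreal N * b) = b" for b :: ennreal
    using N by (simp add: mult.assoc[symmetric] ennreal_mult[symmetric])
  have inv': "ennreal N * (ennreal (1 / N) * b) = b" for b :: ennreal
    using N by (simp add: mult.assoc[symmetric] ennreal_mult[symmetric])
  show ?thesis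
  proof
    show "ennreal N * depth (c * s) \<le> ennreal N * depth (c * t)" if "s \<le> t" for s t
      using that c by (intro mult_left_mono depth_mono) auto
    show "ennreal N * depth (c * 0) = 0" by (simp add: depth_0)
    show "ennreal N * depth (c * T) \<le> C"
      if T: "0 < T" and le: "\<And>s. 0 \<le> s \<Longrightarrow> s < T \<Longrightarrow> ennreal N * depth (c * s) \<le> C" for T C
    proof -
      have "depth (c * T) \<le> ennreal (1 / N) * C"
      proof (rule depth_left_cont)
        show "0 < c * T" using T c by simp
        fix s assume s: "0 \<le> s" "s < c * T"
        have "ennreal N * depth (c * (s / c)) \<le> C" using s c by (intro le) (auto simp: field_simps)
        then have "ennreal (1 / N) * (ennreal N * depth s) \<le> ennreal (1 / N) * C"
          using c by (intro mult_left_mono) auto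
        then show "depth s \<le> ennreal (1 / N) * C" by (simp only: inv)
      qed
      then have "ennreal N * depth (c * T) \<le> ennreal N * (ennreal (1 / N) * C)" by (rule mult_left_mono) simp
      then show ?thesis by (simp only: inv')
    qed
    show "C \<le> ennreal N * depth (c * T)"
      if T: "0 \<le> T" and fin: "ennreal N * depth (c * T) < \<infinity>" and le: "\<And>s. T < s \<Longrightarrow> C \<le> ennreal N * depth (c * s)" for T C
    proof -
      have fin': "depth (c * T) < \<infinity>"
        using ennreal_mult_less_top[THEN iffD1, OF _] fin N by (auto simp: ennreal_mult_less_top)
      have "c * T \<in> L"
        using depth_infinite_outside[of "c * T"] T c fin' by (cases "c * T \<in> L") auto
      then have "ennreal (1 / N) * C \<le> depth (c * T)"
      proof (rule depth_right_cont[OF _ fin'])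
        fix s assume s: "c * T < s"
        have "C \<le> ennreal N * depth (c * (s / c))" using s c by (intro le) (auto simp: field_simps)
        then have "ennreal (1 / N) * C \<le> ennreal (1 / N) * (ennreal N * depth s)"
          using c by (intro mult_left_mono) auto
        then show "ennreal (1 / N) * C \<le> depth s" by (simp only: inv)
      qed
      then have "ennreal N * (ennreal (1 / N) * C) \<le> ennreal N * depth (c * T)" by (rule mult_left_mono) simp
      then show ?thesis by (simp only: inv')
    qed
    show "\<exists>t\<ge>0. ennreal \<xi> \<le> ennreal N * depth (c * t)" for \<xi>
    proof (intro exI conjI)
      let ?t = "\<bar>\<xi>\<bar> / (N * a * c)"
      show "0 \<le> ?t" using a(1) N c by simp
      have "\<xi> \<le> N * (a * (c * ?t))" using a(1) N c by (simp add: field_simps)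
      then have "ennreal \<xi> \<le> ennreal (N * (a * (c * ?t)))" by (rule ennreal_leI)
      also have "\<dots> = ennreal N * ennreal (a * (c * ?t))" using N by (intro ennreal_mult') simp
      also have "\<dots> \<le> ennreal N * depth (c * ?t)" using a N c by (intro mult_left_mono a(2)) auto
      finally show "ennreal \<xi> \<le> ennreal N * depth (c * ?t)" .
    qed
  qed
qed

text \<open>Termwise integration with the moments \<open>fact k\<close>. Pairing
  \<open>\<beta>\<close> with half of the square makes its mean exactly
  \<open>\<beta> / N\<^sup>2\<close>. The bound is asked for positive \<open>\<xi>\<close> only,
  which is almost every value.\<close>

lemma exp1_expansion:
  fixes h :: "real \<Rightarrow> real"
  assumes h: "h \<in> borel_measurable borel" and N: "0 < N" and e: "0 \<le> e2" "0 \<le> e3" "0 \<le> e4"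
    and bound: "\<And>\<xi>. 0 < \<xi> \<Longrightarrow> \<bar>h \<xi> - \<alpha> * (\<xi> / N) - \<beta> * ((\<xi> / N)\<^sup>2 / 2)\<bar> \<le> e2 * (\<xi> / N)\<^sup>2 + e3 * (\<xi> / N)^3 + e4 * (\<xi> / N)^4"
  shows "integrable exp1 h"
    "(\<integral>\<xi>. \<bar>h \<xi>\<bar> \<partial>exp1) \<le> \<bar>\<alpha>\<bar> / N + \<bar>\<beta>\<bar> / N\<^sup>2 + (2 * e2 / N\<^sup>2 + 6 * e3 / N^3 + 24 * e4 / N^4)"
    "\<bar>(\<integral>\<xi>. h \<xi> \<partial>exp1) - (\<alpha> / N + \<beta> / N\<^sup>2)\<bar> \<le> 2 * e2 / N\<^sup>2 + 6 * e3 / N^3 + 24 * e4 / N^4"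
proof -
  interpret prob_space exp1 by (rule prob_space_exp1)
  define P where "P a b e2 e3 e4 \<xi> = a * (\<xi> / N) + b * ((\<xi> / N)\<^sup>2 / 2) + e2 * (\<xi> / N)\<^sup>2 + e3 * (\<xi> / N)^3 + e4 * (\<xi> / N)^4" for a b e2 e3 e4 \<xi>
  have Peq: "P a b e2 e3 e4 = (\<lambda>\<xi>. a / N * \<xi> ^ 1 + b / (2 * N\<^sup>2) * \<xi> ^ 2 + e2 / N\<^sup>2 * \<xi> ^ 2 + e3 / N ^ 3 * \<xi> ^ 3 + e4 / N ^ 4 * \<xi> ^ 4)" for a b e2 e3 e4
    by (auto simp: P_def power_divide fun_eq_iff)
  have Pi: "integrable exp1 (P a b e2 e3 e4)" for a b e2 e3 e4
    unfolding Peq by (intro Bochner_Integration.integrable_add integrable_mult_right exp1_moment(1))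
  have PI: "(\<integral>\<xi>. P a b e2 e3 e4 \<xi> \<partial>exp1) = a / N + b / N\<^sup>2 + (2 * e2 / N\<^sup>2 + 6 * e3 / N^3 + 24 * e4 / N^4)" for a b e2 e3 e4
  proof -
    have "(\<integral>\<xi>. P a b e2 e3 e4 \<xi> \<partial>exp1) = a / N * fact 1 + b / (2 * N\<^sup>2) * fact 2 + e2 / N\<^sup>2 * fact 2 + e3 / N ^ 3 * fact 3 + e4 / N ^ 4 * fact 4"
      unfolding Peq
      by (simp only: Bochner_Integration.integral_add Bochner_Integration.integrable_add integrable_mult_right
          integral_mult_right_zero exp1_moment)
    then show ?thesis by (simp add: fact_numeral algebra_simps)
  qed
  have pos: "AE \<xi> in exp1. 0 < \<xi>" by (rule AE_exp1_pos)
  have habs: "AE \<xi> in exp1. \<bar>h \<xi>\<bar> \<le> P \<bar>\<alpha>\<bar> \<bar>\<beta>\<bar> e2 e3 e4 \<xi>"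
    using pos
  proof eventually_elim
    case (elim \<xi>)
    have "\<bar>\<alpha> * (\<xi> / N)\<bar> = \<bar>\<alpha>\<bar> * (\<xi> / N)" "\<bar>\<beta> * ((\<xi> / N)\<^sup>2 / 2)\<bar> = \<bar>\<beta>\<bar> * ((\<xi> / N)\<^sup>2 / 2)"
      using elim N by (simp_all add: abs_mult)
    then show ?case using bound[OF elim] unfolding P_def by linarith
  qed
  have hm: "h \<in> borel_measurable exp1" using h by simp
  show hi: "integrable exp1 h"
    by (rule Bochner_Integration.integrable_bound[OF Pi[of "\<bar>\<alpha>\<bar>" "\<bar>\<beta>\<bar>" e2 e3 e4] hm])
      (use habs in \<open>eventually_elim, simp\<close>)
  have "(\<integral>\<xi>. \<bar>h \<xi>\<bar> \<partial>exp1) \<le> (\<integral>\<xi>. P \<bar>\<alpha>\<bar> \<bar>\<beta>\<bar> e2 e3 e4 \<xi> \<partial>exp1)"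
    using hi Pi habs by (intro integral_mono_AE) auto
  then show "(\<integral>\<xi>. \<bar>h \<xi>\<bar> \<partial>exp1) \<le> \<bar>\<alpha>\<bar> / N + \<bar>\<beta>\<bar> / N\<^sup>2 + (2 * e2 / N\<^sup>2 + 6 * e3 / N^3 + 24 * e4 / N^4)"
    by (simp only: PI)
  have "(\<integral>\<xi>. h \<xi> \<partial>exp1) - (\<alpha> / N + \<beta> / N\<^sup>2) = (\<integral>\<xi>. h \<xi> - P \<alpha> \<beta> 0 0 0 \<xi> \<partial>exp1)"
    using hi Pi[of \<alpha> \<beta> 0 0 0] PI[of \<alpha> \<beta> 0 0 0] by simp
  also have "\<bar>\<dots>\<bar> \<le> (\<integral>\<xi>. \<bar>h \<xi> - P \<alpha> \<beta> 0 0 0 \<xi>\<bar> \<partial>exp1)" by (rule integral_abs_bound)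
  also have "\<dots> \<le> (\<integral>\<xi>. P 0 0 e2 e3 e4 \<xi> \<partial>exp1)"
  proof (rule integral_mono_AE)
    show "integrable exp1 (\<lambda>\<xi>. \<bar>h \<xi> - P \<alpha> \<beta> 0 0 0 \<xi>\<bar>)" using hi Pi[of \<alpha> \<beta> 0 0 0] by simp
    show "AE \<xi> in exp1. \<bar>h \<xi> - P \<alpha> \<beta> 0 0 0 \<xi>\<bar> \<le> P 0 0 e2 e3 e4 \<xi>"
      using pos by eventually_elim (use bound in \<open>simp add: P_def diff_diff_eq\<close>)
  qed (rule Pi)
  finally show "\<bar>(\<integral>\<xi>. h \<xi> \<partial>exp1) - (\<alpha> / N + \<beta> / N\<^sup>2)\<bar> \<le> 2 * e2 / N\<^sup>2 + 6 * e3 / N^3 + 24 * e4 / N^4"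
    by (simp add: PI)
qed

section \<open>One step of the chain from a fixed initial state\<close>

locale flight = compact_radii m E D J U U' g g' g0 S
  for m E :: real and D J :: "real set" and U U' g g' :: "real \<Rightarrow> real" and g0 :: real and S :: "real set" +
  fixes n :: nat and x :: "real^3" and t :: real
    and y :: "nat \<Rightarrow> real^3 \<Rightarrow> real^3 \<Rightarrow> real \<Rightarrow> real^3"
    and A :: "((real^3) \<times> real) set" and M :: "'w measure" and Z :: "nat \<Rightarrow> 'w \<Rightarrow> (real^3) \<times> real"
  assumes D_convex: "convex D" and D_other: "\<And>r. r \<in> D \<Longrightarrow> \<exists>b\<in>D. b \<noteq> r"
    and n: "n \<ge> 1" and x: "norm x \<in> S"
    and trajectory: "\<And>u. norm u = 1 \<Longrightarrow> is_trajectory m D (scaled_potential U n) x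
      (scaled_speed m E U n (norm x) *\<^sub>R u) (y n x (scaled_speed m E U n (norm x) *\<^sub>R u))"
    and chain: "markov_chain_from A (transition_op m E U g y n) (x, t) M Z"
begin

abbreviation "N \<equiv> sqrt (real n)"

lemma N_pos: "0 < N" "1 \<le> N" "N\<^sup>2 = real n"
  using n by auto

text \<open>What the estimates use about a collision. \<open>\<sigma>\<close> is the flight time of
  the path \<open>z\<close> of the unscaled equation of motion; the clock of the chain advances by
  \<open>\<sigma> / N\<close>.\<close>

definition collides :: "real^3 \<Rightarrow> (real \<Rightarrow> real^3) \<Rightarrow> real \<Rightarrow> real \<Rightarrow> bool" where
  "collides u z \<sigma> \<Lambda> \<longleftrightarrow> norm u = 1 \<and> (\<exists>p L. starts z p L \<and> p 0 = spd (norm x) *\<^sub>R u) \<and> z 0 = x \<and>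
    0 \<le> \<sigma> \<and> ray_depth z \<sigma> < \<infinity> \<and> \<Lambda> = enn2real (ray_depth z \<sigma>)"

text \<open>\<open>\<Lambda>\<close> is the unscaled depth at the collision; \<open>N * \<Lambda>\<close> is exponentially distributed, with
  moments \<open>1, 2, 6, 24\<close>.\<close>

lemma first_step_moment:
  assumes f: "f \<in> borel_measurable borel"
    and \<alpha>: "integrable uniform_sphere \<alpha>" "\<And>u. norm u = 1 \<Longrightarrow> \<bar>\<alpha> u\<bar> \<le> Ca"
    and \<beta>: "integrable uniform_sphere \<beta>" "\<And>u. norm u = 1 \<Longrightarrow> \<bar>\<beta> u\<bar> \<le> Cb"
    and e: "0 \<le> e2" "0 \<le> e3" "0 \<le> e4"
    and bound: "\<And>u z \<sigma> \<Lambda>. collides u z \<sigma> \<Lambda> \<Longrightarrow>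
      \<bar>f (z \<sigma>, t + \<sigma> / N) - \<alpha> u * \<Lambda> - \<beta> u * (\<Lambda>\<^sup>2 / 2)\<bar> \<le> e2 * \<Lambda>\<^sup>2 + e3 * \<Lambda>^3 + e4 * \<Lambda>^4"
  shows "integrable M (\<lambda>\<omega>. f (Z 1 \<omega>))"
    "\<bar>(\<integral>\<omega>. f (Z 1 \<omega>) \<partial>M) - ((\<integral>u. \<alpha> u \<partial>uniform_sphere) / N + (\<integral>u. \<beta> u \<partial>uniform_sphere) / N\<^sup>2)\<bar>
      \<le> 2 * e2 / N\<^sup>2 + 6 * e3 / N^3 + 24 * e4 / N^4"
proof -
  define c where "c = real n powr (- 1 / 4)"
  have c0: "0 < c" using n by (simp add: c_def)
  \<comment> \<open>The exponent -3/4 splits into -1/4, the time change of the path, and -1/2, the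
    extra slowness of the clock.\<close>
  have c34: "real n powr (- 3 / 4) * s = c * s / N" for s
  proof -
    have "real n powr (- 3 / 4) = real n powr (- 1 / 4) * real n powr (- (1 / 2))" by (simp flip: powr_add)
    also have "real n powr (- (1 / 2)) = 1 / N"
      by (subst powr_minus_divide, subst powr_half_sqrt) simp_all
    finally have "real n powr (- 3 / 4) = c * (1 / N)" by (simp only: c_def)
    then show ?thesis by simp
  qed
  let ?Y = "\<lambda>u. y n x (scaled_speed m E U n (norm x) *\<^sub>R u)"
  let ?O = "\<lambda>u. optical_depth (scaled_density g n) (scaled_speed m E U n) (?Y u)"
  define T where "T u = crossing (?O u)" for u
  define X where "X u s = (?Y u s, t + real n powr (- 3 / 4) * s)" for u s
  define K where "K u = distr exp1 borel (\<lambda>\<xi>. X u (T u \<xi>))" for u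
  obtain a where a: "0 < a" "\<And>(z :: real \<Rightarrow> real^3) p L t. starts z p L \<Longrightarrow> 0 \<le> t \<Longrightarrow> ennreal (a * t) \<le> ray_depth z t"
    using linear_growth by blast
  have med: "medium m E D J U U' g g' g0" by unfold_locales
  have xJ: "norm x \<in> J" using x S(2) by blast
  have per_u: "cumulative_hazard (?O u)" "X u \<in> borel_measurable borel"
    "\<And>\<xi>. 0 < \<xi> \<Longrightarrow>
      \<bar>f (X u (T u \<xi>)) - \<alpha> u * (\<xi> / N) - \<beta> u * ((\<xi> / N)\<^sup>2 / 2)\<bar> \<le> e2 * (\<xi> / N)\<^sup>2 + e3 * (\<xi> / N)^3 + e4 * (\<xi> / N)^4"
    if u: "norm u = 1" for u
  proof -
    define z where "z = (\<lambda>s. ?Y u (s / c))"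
    obtain p L where r: "ray m E D J U U' g g' g0 z p L" "p 0 = spd (norm x) *\<^sub>R u" "?Y u 0 = x"
      using trajectory_imp_ray[OF med D_convex D_other n xJ u trajectory[OF u] c_def] unfolding z_def by blast
    interpret R: ray m E D J U U' g g' g0 z p L by (rule r(1))
    have z0: "z 0 = x" using r(3) by (simp add: z_def)
    have st: "starts z p L" unfolding starts_def using r(1) z0 x by simp
    have O: "?O u = (\<lambda>s. ennreal N * R.depth (c * s))"
      using optical_depth_scaled[OF n c_def r(1)[unfolded z_def]] unfolding z_def by blast
    have Yz: "?Y u s = z (c * s)" for s using c0 by (simp add: z_def)
    have gr: "ennreal (a * s) \<le> R.depth s" if "0 \<le> s" for s using a(2)[OF st that] by (simp add: R.ray_depth_eq)
    show haz: "cumulative_hazard (?O u)" unfolding O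
      by (rule R.cumulative_hazard_scaled[OF a(1) gr N_pos(1) c0])
    have "(\<lambda>s. z (c * s)) \<in> borel_measurable borel"
      by (rule measurable_compose[OF _ R.z_borel]) measurable
    then show "X u \<in> borel_measurable borel"
      unfolding X_def[abs_def] Yz by (intro borel_measurable_Pair) auto
    interpret H: cumulative_hazard "?O u" by (rule haz)
    fix \<xi> :: real assume \<xi>: "0 < \<xi>"
    define \<sigma> where "\<sigma> = c * T u \<xi>"
    \<comment> \<open>The optical depth at the flight time is the exponential variable itself;
      dividing by \<open>N\<close> gives the unscaled depth \<open>\<xi> / N\<close>.\<close>
    have "ennreal N * R.depth \<sigma> = ennreal \<xi>"
      using H.hazard_crossing[of \<xi>] unfolding T_def \<sigma>_def O .
    moreover have "ennreal (1 / N) * (ennreal N * R.depth \<sigma>) = R.depth \<sigma>"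
      using N_pos(1) by (simp add: mult.assoc[symmetric] ennreal_mult[symmetric])
    ultimately have "R.depth \<sigma> = ennreal (1 / N) * ennreal \<xi>" by simp
    also have "\<dots> = ennreal (\<xi> / N)" using \<xi> N_pos(1) by (simp add: ennreal_mult[symmetric])
    finally have d: "ray_depth z \<sigma> = ennreal (\<xi> / N)" by (simp add: R.ray_depth_eq)
    have "0 \<le> \<sigma>" using H.crossing_nonneg c0 by (simp add: \<sigma>_def T_def)
    moreover have "ray_depth z \<sigma> < \<infinity>" "\<xi> / N = enn2real (ray_depth z \<sigma>)" using d \<xi> N_pos(1) by auto
    ultimately have "collides u z \<sigma> (\<xi> / N)"
      unfolding collides_def using u st z0 r(2) by blast
    note bound[OF this]
    also have "(z \<sigma>, t + \<sigma> / N) = X u (T u \<xi>)" by (simp only: X_def Yz \<sigma>_def c34)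
    finally show "\<bar>f (X u (T u \<xi>)) - \<alpha> u * (\<xi> / N) - \<beta> u * ((\<xi> / N)\<^sup>2 / 2)\<bar> \<le> e2 * (\<xi> / N)\<^sup>2 + e3 * (\<xi> / N)^3 + e4 * (\<xi> / N)^4" .
  qed
  have Tm: "T u \<in> borel_measurable borel" if "norm u = 1" for u
    unfolding T_def by (rule cumulative_hazard.crossing_borel[OF per_u(1)[OF that]])
  have XT: "(\<lambda>\<xi>. X u (T u \<xi>)) \<in> borel_measurable exp1" if "norm u = 1" for u
    using measurable_compose[OF Tm[OF that] per_u(2)[OF that]] by simp
  have sph: "norm u = 1" if "u \<in> space uniform_sphere" for u
    using that by (simp add: space_uniform_sphere)
  have intK: "(\<integral>b. h b \<partial>K u) = (\<integral>\<xi>. h (X u (T u \<xi>)) \<partial>exp1)" if "norm u = 1" "h \<in> borel_measurable borel" for u and h :: "(real^3) \<times> real \<Rightarrow> real"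
    unfolding K_def using XT[OF that(1)] that(2) by (intro integral_distr) auto
  \<comment> \<open>\<open>mix\<close> is the Markov property for the first step, with the flight
    law replaced by its coupling to \<open>exp1\<close>.\<close>
  interpret mixture M uniform_sphere "Z 1" K
  proof (intro mixture.intro mixture_axioms.intro)
    show "prob_space M" "Z 1 \<in> borel_measurable M" using chain by (auto simp: markov_chain_from_def)
    show "prob_space uniform_sphere" by (rule prob_space_uniform_sphere)
    show "prob_space (K u)" if "u \<in> space uniform_sphere" for u
      unfolding K_def by (rule prob_space.prob_space_distr[OF prob_space_exp1 XT[OF sph[OF that]]])
    show "sets (K u) = sets borel" for u by (simp add: K_def)
    fix h :: "(real^3) \<times> real \<Rightarrow> real" assume h: "h \<in> borel_measurable borel" "bounded (range h)"
    have "(\<integral>\<omega>. h (Z 1 \<omega>) \<partial>M) = transition_op m E U g y n h (x, t)"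
      by (rule markov_chain_first_step[OF chain h])
    also have "\<dots> = (\<integral>u. (\<integral>b. h b \<partial>K u) \<partial>uniform_sphere)"
      unfolding transition_op_def prod.case Let_def
    proof (rule Bochner_Integration.integral_cong[OF HOL.refl])
      fix u assume "u \<in> space uniform_sphere"
      then have u: "norm u = 1" by (rule sph)
      have "(\<integral>s. h (?Y u s, t + real n powr (- 3 / 4) * s) \<partial>flight_law (scaled_density g n) (scaled_speed m E U n) (?Y u))
          = (\<integral>s. h (X u s) \<partial>distr exp1 borel (T u))"
        by (simp add: flight_law_eq[OF per_u(1)[OF u]] T_def X_def)
      also have "\<dots> = (\<integral>\<xi>. h (X u (T u \<xi>)) \<partial>exp1)"
        using Tm[OF u] measurable_compose[OF per_u(2)[OF u] h(1)] by (intro integral_distr) auto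
      also have "\<dots> = (\<integral>b. h b \<partial>K u)" by (rule intK[OF u h(1), symmetric])
      finally show "(\<integral>s. h (?Y u s, t + real n powr (- 3 / 4) * s) \<partial>flight_law (scaled_density g n) (scaled_speed m E U n) (?Y u))
          = (\<integral>b. h b \<partial>K u)" .
    qed
    finally show "(\<integral>\<omega>. h (Z 1 \<omega>) \<partial>M) = (\<integral>u. (\<integral>b. h b \<partial>K u) \<partial>uniform_sphere)" .
  qed
  define R where "R = 2 * e2 / N\<^sup>2 + 6 * e3 / N^3 + 24 * e4 / N^4"
  have est: "integrable (K u) f" "(\<integral>b. \<bar>f b\<bar> \<partial>K u) \<le> Ca / N + Cb / N\<^sup>2 + R"
    "\<bar>(\<integral>b. f b \<partial>K u) - (\<alpha> u / N + \<beta> u / N\<^sup>2)\<bar> \<le> R" if "u \<in> space uniform_sphere" for u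
  proof -
    have u: "norm u = 1" using that by (rule sph)
    have hm: "(\<lambda>\<xi>. f (X u (T u \<xi>))) \<in> borel_measurable borel"
      using measurable_compose[OF XT[OF u] f] by simp
    note ex = exp1_expansion[OF hm N_pos(1) e per_u(3)[OF u]]
    show "integrable (K u) f" unfolding K_def
      using ex(1) XT[OF u] f by (subst integrable_distr_eq) auto
    have "(\<integral>b. \<bar>f b\<bar> \<partial>K u) = (\<integral>\<xi>. \<bar>f (X u (T u \<xi>))\<bar> \<partial>exp1)"
      using f by (intro intK[OF u]) measurable
    also have "\<dots> \<le> \<bar>\<alpha> u\<bar> / N + \<bar>\<beta> u\<bar> / N\<^sup>2 + R" using ex(2) by (simp add: R_def)
    also have "\<dots> \<le> Ca / N + Cb / N\<^sup>2 + R"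
      using \<alpha>(2)[OF u] \<beta>(2)[OF u] N_pos by (intro add_mono divide_right_mono) auto
    finally show "(\<integral>b. \<bar>f b\<bar> \<partial>K u) \<le> Ca / N + Cb / N\<^sup>2 + R" .
    show "\<bar>(\<integral>b. f b \<partial>K u) - (\<alpha> u / N + \<beta> u / N\<^sup>2)\<bar> \<le> R"
      using ex(3) by (simp add: R_def intK[OF u f])
  qed
  note mixed = integrable_mix[OF f est(1,2)]
  show "integrable M (\<lambda>\<omega>. f (Z 1 \<omega>))" by (rule mixed(1))
  have ab: "integrable uniform_sphere (\<lambda>u. \<alpha> u / N + \<beta> u / N\<^sup>2)"
    using \<alpha>(1) \<beta>(1) by simp
  have "(\<integral>\<omega>. f (Z 1 \<omega>) \<partial>M) - ((\<integral>u. \<alpha> u \<partial>uniform_sphere) / N + (\<integral>u. \<beta> u \<partial>uniform_sphere) / N\<^sup>2)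
      = (\<integral>u. (\<integral>b. f b \<partial>K u) - (\<alpha> u / N + \<beta> u / N\<^sup>2) \<partial>uniform_sphere)"
    using mixed(2) ab \<alpha>(1) \<beta>(1) mixed(3)
    by (simp del: One_nat_def)
  also have "\<bar>\<dots>\<bar> \<le> (\<integral>u. \<bar>(\<integral>b. f b \<partial>K u) - (\<alpha> u / N + \<beta> u / N\<^sup>2)\<bar> \<partial>uniform_sphere)"
    by (rule integral_abs_bound)
  also have "\<dots> \<le> (\<integral>u. R \<partial>uniform_sphere)"
    using mixed(2) ab est(3) by (intro integral_mono) auto
  finally show "\<bar>(\<integral>\<omega>. f (Z 1 \<omega>) \<partial>M) - ((\<integral>u. \<alpha> u \<partial>uniform_sphere) / N + (\<integral>u. \<beta> u \<partial>uniform_sphere) / N\<^sup>2)\<bar>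
      \<le> 2 * e2 / N\<^sup>2 + 6 * e3 / N^3 + 24 * e4 / N^4"
    by (simp add: P.prob_space R_def)
qed

end

section \<open>Drift and second moments of the first step\<close>

context flight
begin

text \<open>Component \<open>i\<close> of the claimed spatial drift, with both gradients written as
  radial derivatives times \<open>x / norm x\<close>.\<close>

definition xdrift :: "3 \<Rightarrow> real" where
  "xdrift i = - (1 / (3 * (g (norm x))\<^sup>2)) * (2 * U' (norm x) / (m * (spd (norm x))\<^sup>2) + g' (norm x) / g (norm x)) * (x $ i / norm x)"

lemma x_facts: "norm x \<in> J" "0 < norm x" "0 < g (norm x)" "0 < spd (norm x)" "0 < lam (norm x)"
proof -
  show J': "norm x \<in> J" using x S(2) by blast
  show "0 < norm x" "0 < spd (norm x)" "0 < lam (norm x)" using J' J_pos spd_pos lam_pos by blast+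
  show "0 < g (norm x)" using J' J(2) g_pos by blast
qed

lemma integrable_inner: "integrable uniform_sphere (\<lambda>u. (x \<bullet> u) * u $ i)"
  unfolding inner_vec_def sum_distrib_right
  by (intro Bochner_Integration.integrable_sum) (simp add: mult.assoc integrable_sphere_components)

lemma integral_inner: "(\<integral>u. (x \<bullet> u) * u $ i \<partial>uniform_sphere) = x $ i / 3"
proof -
  have "(\<integral>u. (x \<bullet> u) * u $ i \<partial>uniform_sphere) = (\<integral>u. (\<Sum>j\<in>UNIV. x $ j * (u $ j * u $ i)) \<partial>uniform_sphere)"
    by (simp add: inner_vec_def sum_distrib_right mult.assoc)
  also have "\<dots> = (\<Sum>j\<in>UNIV. \<integral>u. x $ j * (u $ j * u $ i) \<partial>uniform_sphere)"
    by (rule Bochner_Integration.integral_sum) (simp add: integrable_sphere_components)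
  also have "\<dots> = (\<Sum>j\<in>UNIV. if j = i then x $ i / 3 else 0)"
    by (intro sum.cong HOL.refl) (simp add: sphere_second_moment)
  finally show ?thesis by simp
qed

lemma drift2_component:
  "drift2 x (spd (norm x) *\<^sub>R u) $ i = - (U' (norm x)) / (m * norm x * (lam (norm x))\<^sup>2) * x $ i
     - lam' (norm x) * (spd (norm x))\<^sup>2 / (norm x * (lam (norm x))^3) * ((x \<bullet> u) * u $ i)"
  by (simp add: drift2_def power2_eq_square)

text \<open>Averaging replaces \<open>(x \<bullet> u) * u $ i\<close> by a third of
  \<open>x $ i\<close>. In units of U'/(m v^2 g^2), the force contributes -1 and the derivative of
  the speed inside \<open>lam'\<close> contributes +1/3, which leaves -2/3. The derivative of g
  contributes -g'/(3 g^3).\<close>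

lemma drift2_integral:
  "integrable uniform_sphere (\<lambda>u. drift2 x (spd (norm x) *\<^sub>R u) $ i)"
  "(\<integral>u. drift2 x (spd (norm x) *\<^sub>R u) $ i \<partial>uniform_sphere) = xdrift i"
proof -
  interpret P: prob_space uniform_sphere by (rule prob_space_uniform_sphere)
  show int: "integrable uniform_sphere (\<lambda>u. drift2 x (spd (norm x) *\<^sub>R u) $ i)"
    unfolding drift2_component
    by (intro Bochner_Integration.integrable_diff P.integrable_const integrable_mult_right integrable_inner)
  have "(\<integral>u. drift2 x (spd (norm x) *\<^sub>R u) $ i \<partial>uniform_sphere) = - (U' (norm x)) / (m * norm x * (lam (norm x))\<^sup>2) * x $ i
     - lam' (norm x) * (spd (norm x))\<^sup>2 / (norm x * (lam (norm x))^3) * (x $ i / 3)"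
    unfolding drift2_component
    by (subst Bochner_Integration.integral_diff)
      (auto simp: integrable_inner integral_inner P.prob_space)
  also have "\<dots> = xdrift i"
    using x_facts mass
    by (simp add: xdrift_def lam'_def lam_def field_simps power2_eq_square power3_eq_cube)
  finally show "(\<integral>u. drift2 x (spd (norm x) *\<^sub>R u) $ i \<partial>uniform_sphere) = xdrift i" .
qed

text \<open>Each moment is an instance of \<open>first_step_moment\<close>. For the position, the
  term linear in the depth would be of order \<surd>n after scaling, but its mean over directions is
  0; the quadratic term yields the drift. For products of displacements the leading term is already
  quadratic. Factors containing time carry 1/N, which makes both second moments that involve time
  vanish.\<close>

lemma estimates:
  assumes \<epsilon>: "0 < \<epsilon>" and C: "0 \<le> C" and a: "0 < a"
    and lin: "\<forall>(z :: real \<Rightarrow> real^3) p L t. starts z p L \<longrightarrow> 0 \<le> t \<longrightarrow> ennreal (a * t) \<le> ray_depth z t"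
    and expn: "\<forall>(z :: real \<Rightarrow> real^3) p L t. starts z p L \<longrightarrow> 0 \<le> t \<longrightarrow> ray_depth z t < \<infinity> \<longrightarrow>
      expansion \<epsilon> C z p t (enn2real (ray_depth z t))"
    and K: "K = 6 * C + 12 / g0 * (\<epsilon> + C / 2) + 48 / g0 * C + 2 / (a * g0) + 2 / a\<^sup>2"
  shows "integrable M (\<lambda>\<omega>. fst (Z 1 \<omega>) $ i - x $ i)"
    "\<bar>real n * (\<integral>\<omega>. fst (Z 1 \<omega>) $ i - x $ i \<partial>M) - xdrift i\<bar> \<le> 2 * \<epsilon> + K / N"
    "integrable M (\<lambda>\<omega>. snd (Z 1 \<omega>) - t)"
    "\<bar>real n * (\<integral>\<omega>. snd (Z 1 \<omega>) - t \<partial>M) - 1 / lam (norm x)\<bar> \<le> K / N"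
    "\<bar>real n * (\<integral>\<omega>. (fst (Z 1 \<omega>) $ i - x $ i) * (fst (Z 1 \<omega>) $ j - x $ j) \<partial>M) - 2 / (3 * (g (norm x))\<^sup>2) * (if i = j then 1 else 0)\<bar> \<le> K / N"
    "\<bar>real n * (\<integral>\<omega>. (fst (Z 1 \<omega>) $ i - x $ i) * (snd (Z 1 \<omega>) - t) \<partial>M)\<bar> \<le> K / N"
    "\<bar>real n * (\<integral>\<omega>. (snd (Z 1 \<omega>) - t)\<^sup>2 \<partial>M)\<bar> \<le> K / N"
proof -
  interpret P: prob_space uniform_sphere by (rule prob_space_uniform_sphere)
  note Np = N_pos
  let ?r = "norm x"
  have pieces: "0 \<le> 6 * C" "0 \<le> 12 / g0 * (\<epsilon> + C / 2)" "0 \<le> 48 / g0 * C" "0 \<le> 2 / (a * g0)" "0 \<le> 2 / a\<^sup>2"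
    using C a g0_pos \<epsilon> by auto
  have KN: "b \<le> K / N" if "b \<le> b' / N" "b' \<le> K" for b b'
    using that Np(1) by (meson divide_right_mono less_imp_le order_trans)
  have comp: "\<bar>u $ i\<bar> \<le> 1" if "norm u = 1" for u :: "real^3" and i
    using component_le_norm_cart[of u i] that by simp
  have pos: "\<bar>z \<sigma> $ i - x $ i - u $ i / g ?r * \<Lambda> - drift2 x (spd ?r *\<^sub>R u) $ i * (\<Lambda>\<^sup>2 / 2)\<bar> \<le> \<epsilon> * \<Lambda>\<^sup>2 + C * \<Lambda>^3"
    "\<bar>z \<sigma> $ i - x $ i - u $ i / g ?r * \<Lambda>\<bar> \<le> (\<epsilon> + C / 2) * \<Lambda>\<^sup>2 + C * \<Lambda>^3"
    "\<bar>drift2 x (spd ?r *\<^sub>R u) $ i\<bar> \<le> C"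
    "\<bar>\<sigma> - \<Lambda> / lam ?r\<bar> \<le> C * \<Lambda>\<^sup>2" "\<bar>z \<sigma> $ i - x $ i\<bar> \<le> \<Lambda> / g0" "\<sigma> \<le> \<Lambda> / a" "0 \<le> \<Lambda>" "\<bar>u $ i / g ?r * \<Lambda>\<bar> \<le> \<Lambda> / g0" "0 \<le> \<sigma>"
    if c: "collides u z \<sigma> \<Lambda>" for u z \<sigma> \<Lambda> i
  proof -
    from c obtain p L where h: "norm u = 1" "starts z p L" "z 0 = x" "p 0 = spd (norm x) *\<^sub>R u" "0 \<le> \<sigma>" "ray_depth z \<sigma> < \<infinity>" "\<Lambda> = enn2real (ray_depth z \<sigma>)"
      unfolding collides_def by blast
    show "0 \<le> \<sigma>" by (rule h(5))
    interpret R: ray m E D J U U' g g' g0 z p L using h(2) by (simp add: starts_def)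
    have fin: "R.depth \<sigma> < \<infinity>" using h(6) by (simp add: R.ray_depth_eq)
    have \<sigma>L: "\<sigma> \<in> L" using R.depth_infinite_outside[OF h(5)] fin by (cases "\<sigma> \<in> L") auto
    show \<Lambda>0: "0 \<le> \<Lambda>" by (simp add: h(7))
    have F1: "(1 / lam ?r) *\<^sub>R (spd ?r *\<^sub>R u) = (1 / g ?r) *\<^sub>R u"
      using x_facts by (simp add: lam_def)
    have e: "norm (z \<sigma> - x - \<Lambda> *\<^sub>R ((1 / g ?r) *\<^sub>R u) - (\<Lambda>\<^sup>2 / 2) *\<^sub>R drift2 x (spd ?r *\<^sub>R u)) \<le> \<epsilon> * \<Lambda>\<^sup>2 + C * \<Lambda>^3"
      "norm (drift2 x (spd ?r *\<^sub>R u)) \<le> C" "\<bar>\<sigma> - \<Lambda> / lam ?r\<bar> \<le> C * \<Lambda>\<^sup>2"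
      using expn[rule_format, OF h(2,5,6)] unfolding expansion_def h(3) h(4) F1 h(7)[symmetric] by blast+
    show "\<bar>\<sigma> - \<Lambda> / lam ?r\<bar> \<le> C * \<Lambda>\<^sup>2" by (rule e(3))
    have "\<bar>(z \<sigma> - x - \<Lambda> *\<^sub>R ((1 / g ?r) *\<^sub>R u) - (\<Lambda>\<^sup>2 / 2) *\<^sub>R drift2 x (spd ?r *\<^sub>R u)) $ i\<bar> \<le> \<epsilon> * \<Lambda>\<^sup>2 + C * \<Lambda>^3"
      using component_le_norm_cart e(1) by (rule order_trans)
    then show p1: "\<bar>z \<sigma> $ i - x $ i - u $ i / g ?r * \<Lambda> - drift2 x (spd ?r *\<^sub>R u) $ i * (\<Lambda>\<^sup>2 / 2)\<bar> \<le> \<epsilon> * \<Lambda>\<^sup>2 + C * \<Lambda>^3"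
      by (simp add: mult.commute)
    show d: "\<bar>drift2 x (spd ?r *\<^sub>R u) $ i\<bar> \<le> C"
      using component_le_norm_cart e(2) by (rule order_trans)
    have "\<bar>drift2 x (spd ?r *\<^sub>R u) $ i * (\<Lambda>\<^sup>2 / 2)\<bar> \<le> C * (\<Lambda>\<^sup>2 / 2)"
      using d by (simp add: abs_mult mult_right_mono)
    then show "\<bar>z \<sigma> $ i - x $ i - u $ i / g ?r * \<Lambda>\<bar> \<le> (\<epsilon> + C / 2) * \<Lambda>\<^sup>2 + C * \<Lambda>^3"
      using p1 by (simp add: distrib_right)
    have "norm (z \<sigma> - x) \<le> \<Lambda> / g0"
      using R.displacement_le_depth[OF \<sigma>L fin] g0_pos h(3,7) by (simp add: R.ray_depth_eq field_simps)
    then show "\<bar>z \<sigma> $ i - x $ i\<bar> \<le> \<Lambda> / g0"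
      using component_le_norm_cart[of "z \<sigma> - x" i] by simp
    have "ennreal (a * \<sigma>) \<le> ennreal \<Lambda>" using lin[rule_format, OF h(2,5)] h(6,7) by simp
    then show "\<sigma> \<le> \<Lambda> / a" using a \<Lambda>0 by (simp add: ennreal_le_iff field_simps)
    have "g0 \<le> g ?r" using g_lower x_facts(1) J(2) by blast
    then have "1 / g ?r \<le> 1 / g0" using g0_pos by (intro divide_left_mono) auto
    then have "\<bar>u $ i\<bar> * (1 / g ?r) * \<Lambda> \<le> 1 * (1 / g0) * \<Lambda>"
      using comp[OF h(1), of i] x_facts(3) \<Lambda>0 by (intro mult_right_mono mult_mono) auto
    then show "\<bar>u $ i / g ?r * \<Lambda>\<bar> \<le> \<Lambda> / g0" using x_facts(3) \<Lambda>0 by (simp add: abs_mult abs_divide)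
  qed
  have zero: "integrable uniform_sphere (\<lambda>u::real^3. 0::real)" "\<And>u::real^3. norm u = 1 \<Longrightarrow> \<bar>0::real\<bar> \<le> 0" by auto
  have bm: "(\<lambda>b::(real^3) \<times> real. fst b $ i) \<in> borel_measurable borel" "(\<lambda>b::(real^3) \<times> real. snd b) \<in> borel_measurable borel" for i
    by (intro borel_measurable_continuous_onI continuous_intros)+

  have dx: "integrable M (\<lambda>\<omega>. fst (Z 1 \<omega>) $ i - x $ i)"
    "\<bar>(\<integral>\<omega>. fst (Z 1 \<omega>) $ i - x $ i \<partial>M) - ((\<integral>u. u $ i / g ?r \<partial>uniform_sphere) / N +
       (\<integral>u. drift2 x (spd ?r *\<^sub>R u) $ i \<partial>uniform_sphere) / N\<^sup>2)\<bar> \<le> 2 * \<epsilon> / N\<^sup>2 + 6 * C / N^3 + 24 * 0 / N^4"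
  proof -
    note fs = first_step_moment[where f="\<lambda>b. fst b $ i - x $ i" and \<alpha>="\<lambda>u. u $ i / g ?r" and Ca="1 / g ?r"
        and \<beta>="\<lambda>u. drift2 x (spd ?r *\<^sub>R u) $ i" and Cb=C and ?e2.0=\<epsilon> and ?e3.0=C and ?e4.0=0]
    have p: "(\<lambda>b::(real^3) \<times> real. fst b $ i - x $ i) \<in> borel_measurable borel" using bm by measurable
    have q: "integrable uniform_sphere (\<lambda>u. u $ i / g ?r)" using integrable_sphere_component by simp
    have r: "\<bar>u $ i / g ?r\<bar> \<le> 1 / g ?r" if "norm u = 1" for u :: "real^3"
      using comp[OF that] x_facts(3) by (simp add: abs_divide divide_right_mono)
    \<comment> \<open>This bound is part of \<open>expansion\<close>, hence tied to a path; the
      trajectory in direction \<open>u\<close>, taken at time 0 and depth 0, supplies one.\<close>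
    have s: "\<bar>drift2 x (spd ?r *\<^sub>R u) $ i\<bar> \<le> C" if u: "norm u = 1" for u :: "real^3"
    proof -
      obtain p L where ray: "ray m E D J U U' g g' g0 (\<lambda>s. y n x (scaled_speed m E U n ?r *\<^sub>R u) (s / (real n powr (- 1 / 4)))) p L"
        "p 0 = spd ?r *\<^sub>R u" "y n x (scaled_speed m E U n ?r *\<^sub>R u) 0 = x"
        using trajectory_imp_ray[OF medium_axioms D_convex D_other n x_facts(1) u trajectory[OF u] HOL.refl] by blast
      let ?z = "\<lambda>s. y n x (scaled_speed m E U n ?r *\<^sub>R u) (s / (real n powr (- 1 / 4)))"
      interpret R: ray m E D J U U' g g' g0 ?z p L by (rule ray(1))
      have st: "starts ?z p L" "?z 0 = x" using ray x by (auto simp: starts_def)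
      have "ray_depth ?z 0 < \<infinity>" unfolding R.ray_depth_eq R.depth_0 by simp
      then have "collides u ?z 0 (enn2real (ray_depth ?z 0))"
        unfolding collides_def using u st ray(2) by blast
      then show ?thesis by (rule pos(3))
    qed
    have b: "\<bar>(fst (z \<sigma>, t + \<sigma> / N) $ i - x $ i) - u $ i / g ?r * \<Lambda> - drift2 x (spd ?r *\<^sub>R u) $ i * (\<Lambda>\<^sup>2 / 2)\<bar> \<le> \<epsilon> * \<Lambda>\<^sup>2 + C * \<Lambda>^3 + 0 * \<Lambda>^4"
      if "collides u z \<sigma> \<Lambda>"
      for u z \<sigma> \<Lambda>
      using pos(1)[OF that, of i] by simp
    show "integrable M (\<lambda>\<omega>. fst (Z 1 \<omega>) $ i - x $ i)"
      by (rule fs(1); (rule p q drift2_integral(1) less_imp_le[OF \<epsilon>] C order_refl | erule r | erule s | (rule b, assumption+)))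
    show "\<bar>(\<integral>\<omega>. fst (Z 1 \<omega>) $ i - x $ i \<partial>M) - ((\<integral>u. u $ i / g ?r \<partial>uniform_sphere) / N +
       (\<integral>u. drift2 x (spd ?r *\<^sub>R u) $ i \<partial>uniform_sphere) / N\<^sup>2)\<bar> \<le> 2 * \<epsilon> / N\<^sup>2 + 6 * C / N^3 + 24 * 0 / N^4"
      by (rule fs(2); (rule p q drift2_integral(1) less_imp_le[OF \<epsilon>] C order_refl | erule r | erule s | (rule b, assumption+)))
  qed
  \<comment> \<open>Multiplication by n, which is the square of \<open>N\<close>. The leading
    \<open>0 / N\<close> is the place of the mean of \<open>\<alpha>\<close>, so the estimate
    applies when that mean vanishes or has been moved to the next order.\<close>
  have scale: "\<bar>real n * I - b\<bar> \<le> 2 * e2 + 6 * e3 / N + 24 * e4 / N\<^sup>2"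
    if "\<bar>I - (0 / N + b / N\<^sup>2)\<bar> \<le> 2 * e2 / N\<^sup>2 + 6 * e3 / N^3 + 24 * e4 / N^4" for I b e2 e3 e4
  proof -
    have "N\<^sup>2 * \<bar>I - (0 / N + b / N\<^sup>2)\<bar> \<le> N\<^sup>2 * (2 * e2 / N\<^sup>2 + 6 * e3 / N^3 + 24 * e4 / N^4)"
      by (intro mult_left_mono that) simp
    moreover have "N\<^sup>2 * \<bar>I - (0 / N + b / N\<^sup>2)\<bar> = \<bar>N\<^sup>2 * (I - (0 / N + b / N\<^sup>2))\<bar>" by (simp add: abs_mult)
    moreover have "N\<^sup>2 * (I - (0 / N + b / N\<^sup>2)) = real n * I - b"
      using Np(1) n by (simp add: right_diff_distrib)
    moreover have "N\<^sup>2 * (2 * e2 / N\<^sup>2 + 6 * e3 / N^3 + 24 * e4 / N^4) = 2 * e2 + 6 * e3 / N + 24 * e4 / N\<^sup>2"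
    proof -
      have "M\<^sup>2 * (2 * e2 / M\<^sup>2 + 6 * e3 / M^3 + 24 * e4 / M^4) = 2 * e2 + 6 * e3 / M + 24 * e4 / M\<^sup>2" if "0 < M" for M :: real
        using that by (simp add: field_simps power2_eq_square power3_eq_cube power4_eq_xxxx)
      then show ?thesis using Np(1) by blast
    qed
    ultimately show ?thesis by simp
  qed
  show "integrable M (\<lambda>\<omega>. fst (Z 1 \<omega>) $ i - x $ i)" by (rule dx(1))
  have "(\<integral>u. u $ i / g ?r \<partial>uniform_sphere) = 0" by (simp add: sphere_mean)
  from dx(2)[unfolded this drift2_integral(2)] have "\<bar>real n * (\<integral>\<omega>. fst (Z 1 \<omega>) $ i - x $ i \<partial>M) - xdrift i\<bar> \<le> 2 * \<epsilon> + 6 * C / N + 24 * 0 / N\<^sup>2"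
    by (rule scale)
  moreover have "6 * C / N \<le> K / N" using pieces by (intro KN[OF order_refl]) (simp add: K)
  ultimately show "\<bar>real n * (\<integral>\<omega>. fst (Z 1 \<omega>) $ i - x $ i \<partial>M) - xdrift i\<bar> \<le> 2 * \<epsilon> + K / N" by simp

  have dt: "integrable M (\<lambda>\<omega>. snd (Z 1 \<omega>) - t)"
    "\<bar>(\<integral>\<omega>. snd (Z 1 \<omega>) - t \<partial>M) - ((\<integral>u. 1 / (lam ?r * N) \<partial>uniform_sphere) / N + (\<integral>u. 0 \<partial>uniform_sphere) / N\<^sup>2)\<bar>
      \<le> 2 * (C / N) / N\<^sup>2 + 6 * 0 / N^3 + 24 * 0 / N^4"
  proof -
    note fs = first_step_moment[where f="\<lambda>b. snd b - t" and \<alpha>="\<lambda>u. 1 / (lam ?r * N)" and Ca="1 / (lam ?r * N)"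
        and \<beta>="\<lambda>u. 0" and Cb=0 and ?e2.0="C / N" and ?e3.0=0 and ?e4.0=0]
    have p: "(\<lambda>b::(real^3) \<times> real. snd b - t) \<in> borel_measurable borel" using bm by measurable
    have q: "integrable uniform_sphere (\<lambda>u::real^3. 1 / (lam ?r * N))" by (rule P.integrable_const)
    have r: "\<bar>1 / (lam ?r * N)\<bar> \<le> 1 / (lam ?r * N)" if "norm u = 1" for u :: "real^3"
      using x_facts(5) Np(1) by simp
    have CN: "0 \<le> C / N" using C Np(1) by simp
    have b: "\<bar>(snd (z \<sigma>, t + \<sigma> / N) - t) - 1 / (lam ?r * N) * \<Lambda> - 0 * (\<Lambda>\<^sup>2 / 2)\<bar> \<le> C / N * \<Lambda>\<^sup>2 + 0 * \<Lambda>^3 + 0 * \<Lambda>^4"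
      if "collides u z \<sigma> \<Lambda>"
      for u z \<sigma> \<Lambda>
    proof -
      have "(snd (z \<sigma>, t + \<sigma> / N) - t) - 1 / (lam ?r * N) * \<Lambda> - 0 * (\<Lambda>\<^sup>2 / 2) = (\<sigma> - \<Lambda> / lam ?r) / N"
        by (simp add: diff_divide_distrib)
      also have "\<bar>\<dots>\<bar> \<le> C * \<Lambda>\<^sup>2 / N"
        unfolding abs_divide abs_of_pos[OF Np(1)] using pos(4)[OF that] Np(1) by (intro divide_right_mono) auto
      finally show ?thesis by simp
    qed
    show "integrable M (\<lambda>\<omega>. snd (Z 1 \<omega>) - t)"
      by (rule fs(1); (rule p q CN zero(1) order_refl | erule r | (rule b, assumption+) | simp))
    show "\<bar>(\<integral>\<omega>. snd (Z 1 \<omega>) - t \<partial>M) - ((\<integral>u. 1 / (lam ?r * N) \<partial>uniform_sphere) / N + (\<integral>u. 0 \<partial>uniform_sphere) / N\<^sup>2)\<bar>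
      \<le> 2 * (C / N) / N\<^sup>2 + 6 * 0 / N^3 + 24 * 0 / N^4"
      by (rule fs(2); (rule p q CN zero(1) order_refl | erule r | (rule b, assumption+) | simp))
  qed
  show "integrable M (\<lambda>\<omega>. snd (Z 1 \<omega>) - t)" by (rule dt(1))
  \<comment> \<open>The linear coefficient of the clock contains \<open>1 / N\<close>, so its mean
    already has the order of \<open>b / N\<^sup>2\<close> and takes that place.\<close>
  have "(\<integral>u. 1 / (lam ?r * N) \<partial>uniform_sphere) / N + (\<integral>u. 0 \<partial>uniform_sphere) / N\<^sup>2 = 0 / N + (1 / lam ?r) / N\<^sup>2"
    by (simp add: P.prob_space power2_eq_square del: real_sqrt_mult_self)
  then have "\<bar>real n * (\<integral>\<omega>. snd (Z 1 \<omega>) - t \<partial>M) - 1 / lam ?r\<bar> \<le> 2 * (C / N) + 6 * 0 / N + 24 * 0 / N\<^sup>2"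
    using dt(2) by (intro scale) (simp only:)
  then show "\<bar>real n * (\<integral>\<omega>. snd (Z 1 \<omega>) - t \<partial>M) - 1 / lam ?r\<bar> \<le> K / N"
    using pieces C by (intro KN[of _ "2 * C"]) (auto simp: K)

  \<comment> \<open>A product of displacements differs from the product of their linear parts by two
    terms, each a bound \<open>\<Lambda> / g0\<close> times the linearisation error. These constants
    are the resulting cubic and quartic coefficients; the moments 6 and 24 turn them into two
    summands of \<open>K\<close>.\<close>
  define C3 where "C3 = 2 / g0 * (\<epsilon> + C / 2)"
  define C4 where "C4 = 2 / g0 * C"
  have C34: "0 \<le> C3" "0 \<le> C4" using g0_pos \<epsilon> C by (auto simp: C3_def C4_def)
  have xx: "\<bar>(\<integral>\<omega>. (fst (Z 1 \<omega>) $ i - x $ i) * (fst (Z 1 \<omega>) $ j - x $ j) \<partial>M) - ((\<integral>u. 0 \<partial>uniform_sphere) / N +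
       (\<integral>u. 2 / (g ?r)\<^sup>2 * (u $ i * u $ j) \<partial>uniform_sphere) / N\<^sup>2)\<bar> \<le> 2 * 0 / N\<^sup>2 + 6 * C3 / N^3 + 24 * C4 / N^4"
  proof -
    note fs = first_step_moment(2)[where f="\<lambda>b. (fst b $ i - x $ i) * (fst b $ j - x $ j)" and \<alpha>="\<lambda>u. 0" and Ca=0
        and \<beta>="\<lambda>u. 2 / (g ?r)\<^sup>2 * (u $ i * u $ j)" and Cb="2 / (g ?r)\<^sup>2" and ?e2.0=0 and ?e3.0=C3 and ?e4.0=C4]
    have p: "(\<lambda>b::(real^3) \<times> real. (fst b $ i - x $ i) * (fst b $ j - x $ j)) \<in> borel_measurable borel"
      using bm by measurable
    have q: "integrable uniform_sphere (\<lambda>u. 2 / (g ?r)\<^sup>2 * (u $ i * u $ j))"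
      using integrable_sphere_components by simp
    have r: "\<bar>2 / (g ?r)\<^sup>2 * (u $ i * u $ j)\<bar> \<le> 2 / (g ?r)\<^sup>2" if "norm u = 1" for u :: "real^3"
    proof -
      have "\<bar>u $ i * u $ j\<bar> \<le> 1" unfolding abs_mult using comp[OF that] by (intro mult_le_one) auto
      then have "2 / (g ?r)\<^sup>2 * \<bar>u $ i * u $ j\<bar> \<le> 2 / (g ?r)\<^sup>2 * 1" by (intro mult_left_mono) auto
      then show ?thesis by (simp add: abs_mult)
    qed
    have b: "\<bar>(fst (z \<sigma>, t + \<sigma> / N) $ i - x $ i) * (fst (z \<sigma>, t + \<sigma> / N) $ j - x $ j) - 0 * \<Lambda> - 2 / (g ?r)\<^sup>2 * (u $ i * u $ j) * (\<Lambda>\<^sup>2 / 2)\<bar> \<le> 0 * \<Lambda>\<^sup>2 + C3 * \<Lambda>^3 + C4 * \<Lambda>^4"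
      if h: "collides u z \<sigma> \<Lambda>"
      for u z \<sigma> \<Lambda>
    proof -
      define A1 A2 B1 B2 where "A1 = z \<sigma> $ i - x $ i" and "A2 = z \<sigma> $ j - x $ j"
        and "B1 = u $ i / g ?r * \<Lambda>" and "B2 = u $ j / g ?r * \<Lambda>"
      define e where "e = (\<epsilon> + C / 2) * \<Lambda>\<^sup>2 + C * \<Lambda>^3"
      have A: "\<bar>A1\<bar> \<le> \<Lambda> / g0" "\<bar>B2\<bar> \<le> \<Lambda> / g0" "\<bar>A1 - B1\<bar> \<le> e" "\<bar>A2 - B2\<bar> \<le> e"
        using pos[OF h] by (simp_all add: A1_def A2_def B1_def B2_def e_def)
      have g0\<Lambda>: "0 \<le> \<Lambda> / g0" using pos(7)[OF h] g0_pos by simp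
      have "A1 * A2 - B1 * B2 = A1 * (A2 - B2) + (A1 - B1) * B2" by (simp add: algebra_simps)
      also have "\<bar>\<dots>\<bar> \<le> \<bar>A1\<bar> * \<bar>A2 - B2\<bar> + \<bar>A1 - B1\<bar> * \<bar>B2\<bar>"
        using abs_triangle_ineq by (simp only: abs_mult[symmetric])
      also have "\<dots> \<le> \<Lambda> / g0 * e + e * (\<Lambda> / g0)"
        using A g0\<Lambda> by (intro add_mono mult_mono) auto
      also have "\<dots> = C3 * \<Lambda>^3 + C4 * \<Lambda>^4"
        by (simp add: e_def C3_def C4_def algebra_simps power2_eq_square power3_eq_cube power4_eq_xxxx)
      finally have "\<bar>A1 * A2 - B1 * B2\<bar> \<le> C3 * \<Lambda>^3 + C4 * \<Lambda>^4" .
      moreover have "B1 * B2 = 2 / (g ?r)\<^sup>2 * (u $ i * u $ j) * (\<Lambda>\<^sup>2 / 2)"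
        by (simp add: B1_def B2_def power2_eq_square)
      ultimately show ?thesis by (simp add: A1_def A2_def)
    qed
    show ?thesis by (rule fs; (rule p q C34 zero(1) order_refl | erule r | (rule b, assumption+) | simp))
  qed
  have s2: "(\<integral>u. 2 / (g ?r)\<^sup>2 * (u $ i * u $ j) \<partial>uniform_sphere) = 2 / (3 * (g ?r)\<^sup>2) * (if i = j then 1 else 0)"
    by (simp add: sphere_second_moment)
  have "(\<integral>u. (0::real) \<partial>uniform_sphere) = 0" by simp
  from xx[unfolded s2 this] have "\<bar>real n * (\<integral>\<omega>. (fst (Z 1 \<omega>) $ i - x $ i) * (fst (Z 1 \<omega>) $ j - x $ j) \<partial>M) - 2 / (3 * (g ?r)\<^sup>2) * (if i = j then 1 else 0)\<bar>
      \<le> 2 * 0 + 6 * C3 / N + 24 * C4 / N\<^sup>2"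
    by (rule scale)
  also have "\<dots> \<le> (6 * C3 + 24 * C4) / N"
  proof -
    have "N \<le> N\<^sup>2" using Np(2) by (rule self_le_power) simp
    then have "24 * C4 / N\<^sup>2 \<le> 24 * C4 / N"
      using C34 Np(1) by (intro divide_left_mono mult_pos_pos zero_less_power) simp_all
    then show ?thesis by (simp add: add_divide_distrib)
  qed
  finally show "\<bar>real n * (\<integral>\<omega>. (fst (Z 1 \<omega>) $ i - x $ i) * (fst (Z 1 \<omega>) $ j - x $ j) \<partial>M) - 2 / (3 * (g (norm x))\<^sup>2) * (if i = j then 1 else 0)\<bar> \<le> K / N"
    using pieces by (intro KN) (auto simp: K C3_def C4_def)

  \<comment> \<open>For the second moments with time no expansion is used: displacement and time are
    linear in the depth, and the spare factor \<open>1 / N\<close> tends to 0.\<close>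
  have \<sigma>N: "\<bar>\<sigma> / N\<bar> \<le> \<Lambda> / a / N" if "0 \<le> \<sigma>" "\<sigma> \<le> \<Lambda> / a" for \<sigma> \<Lambda>
  proof -
    have "\<sigma> / N \<le> \<Lambda> / a / N" using that(2) Np(1) by (intro divide_right_mono) auto
    moreover have "\<bar>\<sigma> / N\<bar> = \<sigma> / N" using that(1) by simp
    ultimately show ?thesis by (simp only:)
  qed
  have "\<bar>(\<integral>\<omega>. (fst (Z 1 \<omega>) $ i - x $ i) * (snd (Z 1 \<omega>) - t) \<partial>M) - ((\<integral>u. 0 \<partial>uniform_sphere) / N +
       (\<integral>u. 0 \<partial>uniform_sphere) / N\<^sup>2)\<bar> \<le> 2 * (1 / (a * g0) / N) / N\<^sup>2 + 6 * 0 / N^3 + 24 * 0 / N^4"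
  proof (rule first_step_moment(2)[where f="\<lambda>b. (fst b $ i - x $ i) * (snd b - t)" and \<alpha>="\<lambda>u. 0" and Ca=0
        and \<beta>="\<lambda>u. 0" and Cb=0 and ?e2.0="1 / (a * g0) / N" and ?e3.0=0 and ?e4.0=0])
    show "(\<lambda>b::(real^3) \<times> real. (fst b $ i - x $ i) * (snd b - t)) \<in> borel_measurable borel" using bm by measurable
    show "0 \<le> 1 / (a * g0) / N" using a g0_pos Np(1) by simp
    fix u z \<sigma> \<Lambda> assume h: "collides u z \<sigma> \<Lambda>"
    have "\<bar>(z \<sigma> $ i - x $ i) * (\<sigma> / N)\<bar> \<le> \<Lambda> / g0 * (\<Lambda> / a / N)"
      unfolding abs_mult using pos(5,7)[OF h] \<sigma>N[OF pos(9)[OF h] pos(6)[OF h]] g0_pos by (intro mult_mono) auto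
    then show "\<bar>(fst (z \<sigma>, t + \<sigma> / N) $ i - x $ i) * (snd (z \<sigma>, t + \<sigma> / N) - t) - 0 * \<Lambda> - 0 * (\<Lambda>\<^sup>2 / 2)\<bar> \<le> 1 / (a * g0) / N * \<Lambda>\<^sup>2 + 0 * \<Lambda>^3 + 0 * \<Lambda>^4"
      by (simp add: power2_eq_square mult_ac)
  qed (simp_all only: zero order_refl)
  then have "\<bar>real n * (\<integral>\<omega>. (fst (Z 1 \<omega>) $ i - x $ i) * (snd (Z 1 \<omega>) - t) \<partial>M) - 0\<bar> \<le> 2 * (1 / (a * g0) / N) + 6 * 0 / N + 24 * 0 / N\<^sup>2"
    by (intro scale) simp
  then show "\<bar>real n * (\<integral>\<omega>. (fst (Z 1 \<omega>) $ i - x $ i) * (snd (Z 1 \<omega>) - t) \<partial>M)\<bar> \<le> K / N"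
    using pieces by (intro KN[of _ "2 / (a * g0)"]) (auto simp: K)

  have "\<bar>(\<integral>\<omega>. (snd (Z 1 \<omega>) - t)\<^sup>2 \<partial>M) - ((\<integral>u. 0 \<partial>uniform_sphere) / N +
       (\<integral>u. 0 \<partial>uniform_sphere) / N\<^sup>2)\<bar> \<le> 2 * (1 / a\<^sup>2 / N) / N\<^sup>2 + 6 * 0 / N^3 + 24 * 0 / N^4"
  proof (rule first_step_moment(2)[where f="\<lambda>b. (snd b - t)\<^sup>2" and \<alpha>="\<lambda>u. 0" and Ca=0
        and \<beta>="\<lambda>u. 0" and Cb=0 and ?e2.0="1 / a\<^sup>2 / N" and ?e3.0=0 and ?e4.0=0])
    show "(\<lambda>b::(real^3) \<times> real. (snd b - t)\<^sup>2) \<in> borel_measurable borel" using bm by measurable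
    show "0 \<le> 1 / a\<^sup>2 / N" using a Np(1) by simp
    fix u z \<sigma> \<Lambda> assume h: "collides u z \<sigma> \<Lambda>"
    have "\<bar>(\<sigma> / N) * (\<sigma> / N)\<bar> \<le> \<Lambda> / a / N * (\<Lambda> / a / N)"
      unfolding abs_mult[of "\<sigma> / N"] using pos(7)[OF h] \<sigma>N[OF pos(9)[OF h] pos(6)[OF h]] a Np(1) by (intro mult_mono) auto
    also have "\<dots> = (\<Lambda> / a)\<^sup>2 / N * (1 / N)" by (simp add: power2_eq_square del: real_sqrt_mult_self)
    \<comment> \<open>Of the two factors \<open>1 / N\<close> one is given away, to match the form
      of the other bounds.\<close>
    also have "\<dots> \<le> (\<Lambda> / a)\<^sup>2 / N * 1" using Np by (intro mult_left_mono) auto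
    finally show "\<bar>(snd (z \<sigma>, t + \<sigma> / N) - t)\<^sup>2 - 0 * \<Lambda> - 0 * (\<Lambda>\<^sup>2 / 2)\<bar> \<le> 1 / a\<^sup>2 / N * \<Lambda>\<^sup>2 + 0 * \<Lambda>^3 + 0 * \<Lambda>^4"
      by (simp add: power2_eq_square del: real_sqrt_mult_self)
  qed (simp_all only: zero order_refl)
  then have "\<bar>real n * (\<integral>\<omega>. (snd (Z 1 \<omega>) - t)\<^sup>2 \<partial>M) - 0\<bar> \<le> 2 * (1 / a\<^sup>2 / N) + 6 * 0 / N + 24 * 0 / N\<^sup>2"
    by (intro scale) simp
  then show "\<bar>real n * (\<integral>\<omega>. (snd (Z 1 \<omega>) - t)\<^sup>2 \<partial>M)\<bar> \<le> K / N"
    using pieces by (intro KN[of _ "2 / a\<^sup>2"]) (auto simp: K)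
qed

end

text \<open>The suprema are extended real, so no boundedness for individual n is required. The
  functions may be negative, as for the covariance with time, so convergence from below rests on one
  point of \<open>I\<close>; the empty supremum would be minus infinity.\<close>

lemma SUP_tendsto_zero:
  fixes f :: "nat \<Rightarrow> 'a \<Rightarrow> real"
  assumes I: "I \<noteq> {}" and f: "\<And>e. 0 < e \<Longrightarrow> \<exists>n0. \<forall>n\<ge>n0. \<forall>p\<in>I. \<bar>f n p\<bar> \<le> e"
  shows "(\<lambda>n. SUP p\<in>I. ereal (f n p)) \<longlonglongrightarrow> 0"
proof (rule order_tendstoI)
  obtain p0 where p0: "p0 \<in> I" using I by blast
  fix a :: ereal
  show "\<forall>\<^sub>F n in sequentially. a < (SUP p\<in>I. ereal (f n p))" if a: "a < 0"
  proof -
    obtain b where b: "a < ereal b" "ereal b < 0" using ereal_dense2[OF a] by blast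
    then obtain n0 where n0: "\<And>n p. n \<ge> n0 \<Longrightarrow> p \<in> I \<Longrightarrow> \<bar>f n p\<bar> \<le> - b" using f[of "- b"] by auto
    have "a < (SUP p\<in>I. ereal (f n p))" if n: "n \<ge> n0" for n
    proof -
      have "ereal b \<le> ereal (f n p0)" using n0[OF n p0] by simp
      also have "\<dots> \<le> (SUP p\<in>I. ereal (f n p))" using p0 by (rule SUP_upper)
      finally show ?thesis using b(1) by simp
    qed
    then show ?thesis unfolding eventually_sequentially by blast
  qed
  show "\<forall>\<^sub>F n in sequentially. (SUP p\<in>I. ereal (f n p)) < a" if a: "0 < a"
  proof -
    obtain b where b: "0 < ereal b" "ereal b < a" using ereal_dense2[OF a] by blast
    then obtain n0 where n0: "\<And>n p. n \<ge> n0 \<Longrightarrow> p \<in> I \<Longrightarrow> \<bar>f n p\<bar> \<le> b" using f[of b] by auto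
    have "(SUP p\<in>I. ereal (f n p)) < a" if n: "n \<ge> n0" for n
    proof -
      have "(SUP p\<in>I. ereal (f n p)) \<le> ereal b"
      proof (rule SUP_least)
        fix p assume "p \<in> I"
        then show "ereal (f n p) \<le> ereal b" using n0[OF n, of p] by simp
      qed
      then show ?thesis using b(2) by simp
    qed
    then show ?thesis unfolding eventually_sequentially by blast
  qed
qed

text \<open>A Bochner integral commutes with coordinate maps once the vector is integrable, and this
  follows from its components through the l1 bound on the norm.\<close>

lemma (in flight) vector_drift:
  assumes i: "\<And>i. integrable M (\<lambda>\<omega>. fst (Z 1 \<omega>) $ i - x $ i)" "integrable M (\<lambda>\<omega>. snd (Z 1 \<omega>) - t)"
  shows "fst (\<integral>\<omega>. Z 1 \<omega> - (x, t) \<partial>M) $ i = (\<integral>\<omega>. fst (Z 1 \<omega>) $ i - x $ i \<partial>M)"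
    "snd (\<integral>\<omega>. Z 1 \<omega> - (x, t) \<partial>M) = (\<integral>\<omega>. snd (Z 1 \<omega>) - t \<partial>M)"
proof -
  have Zm: "Z 1 \<in> borel_measurable M" using chain by (simp add: markov_chain_from_def)
  have int: "integrable M (\<lambda>\<omega>. Z 1 \<omega> - (x, t))"
  proof (rule Bochner_Integration.integrable_bound)
    show "integrable M (\<lambda>\<omega>. (\<Sum>i\<in>UNIV. \<bar>fst (Z 1 \<omega>) $ i - x $ i\<bar>) + \<bar>snd (Z 1 \<omega>) - t\<bar>)"
      by (intro Bochner_Integration.integrable_add Bochner_Integration.integrable_sum integrable_abs i)
    show "(\<lambda>\<omega>. Z 1 \<omega> - (x, t)) \<in> borel_measurable M" using Zm by (intro borel_measurable_diff) auto
    show "AE \<omega> in M. norm (Z 1 \<omega> - (x, t)) \<le> norm ((\<Sum>i\<in>UNIV. \<bar>fst (Z 1 \<omega>) $ i - x $ i\<bar>) + \<bar>snd (Z 1 \<omega>) - t\<bar>)"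
    proof (rule AE_I2)
      fix \<omega>
      have "norm (Z 1 \<omega> - (x, t)) \<le> norm (fst (Z 1 \<omega>) - x) + norm (snd (Z 1 \<omega>) - t)"
        using norm_Pair_le[of "fst (Z 1 \<omega>) - x" "snd (Z 1 \<omega>) - t"] by (simp add: minus_prod_def)
      also have "norm (fst (Z 1 \<omega>) - x) \<le> (\<Sum>i\<in>UNIV. \<bar>(fst (Z 1 \<omega>) - x) $ i\<bar>)" by (rule norm_le_l1_cart)
      finally show "norm (Z 1 \<omega> - (x, t)) \<le> norm ((\<Sum>i\<in>UNIV. \<bar>fst (Z 1 \<omega>) $ i - x $ i\<bar>) + \<bar>snd (Z 1 \<omega>) - t\<bar>)"
        by simp
    qed
  qed
  have "(\<integral>\<omega>. fst (Z 1 \<omega> - (x, t)) $ i \<partial>M) = fst (\<integral>\<omega>. Z 1 \<omega> - (x, t) \<partial>M) $ i"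
    by (rule integral_bounded_linear[OF bounded_linear_compose[OF bounded_linear_vec_nth bounded_linear_fst] int])
  then show "fst (\<integral>\<omega>. Z 1 \<omega> - (x, t) \<partial>M) $ i = (\<integral>\<omega>. fst (Z 1 \<omega>) $ i - x $ i \<partial>M)" by simp
  have "(\<integral>\<omega>. snd (Z 1 \<omega> - (x, t)) \<partial>M) = snd (\<integral>\<omega>. Z 1 \<omega> - (x, t) \<partial>M)"
    by (rule integral_bounded_linear[OF bounded_linear_snd int])
  then show "snd (\<integral>\<omega>. Z 1 \<omega> - (x, t) \<partial>M) = (\<integral>\<omega>. snd (Z 1 \<omega>) - t \<partial>M)" by simp
qed

theorem theorem1p3:
  fixes m E hm :: real and hp :: ereal
    and U g :: "real \<Rightarrow> real"
    and y :: "nat \<Rightarrow> real^3 \<Rightarrow> real^3 \<Rightarrow> real \<Rightarrow> real^3"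
    and M :: "nat \<Rightarrow> (real^3) \<times> real \<Rightarrow> 'w measure"
    and Z :: "nat \<Rightarrow> (real^3) \<times> real \<Rightarrow> nat \<Rightarrow> 'w \<Rightarrow> (real^3) \<times> real"
    and S :: "real set"
  assumes medium: "admissible_medium m E hm hp U g"
    and trajectories: "\<And>n x w. n \<ge> 1 \<Longrightarrow> norm x \<in> radial_dom hm hp \<Longrightarrow> x \<noteq> 0 \<Longrightarrow>
      norm w = scaled_speed m E U n (norm x) \<Longrightarrow>
      is_trajectory m (radial_dom hm hp) (scaled_potential U n) x w (y n x w)"
    and chain: "\<And>n x t. n \<ge> 1 \<Longrightarrow> norm x \<in> radial_int hm hp \<Longrightarrow> t \<ge> 0 \<Longrightarrow>
      markov_chain_from (state_space hm hp) (transition_op m E U g y n) (x, t)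
        (M n (x, t)) (Z n (x, t))"
    and S: "compact S" "S \<subseteq> radial_int hm hp" "S \<noteq> {}"
  shows
    "(\<lambda>n. SUP (x, t)\<in>{x. norm x \<in> S} \<times> {0..}.
        ereal (norm (drift M Z n (x, t) - limit_drift m E hm hp U g x))) \<longlonglongrightarrow> 0 \<and>
     (\<forall>i j. (\<lambda>n. SUP (x, t)\<in>{x. norm x \<in> S} \<times> {0..}.
        ereal \<bar>cov_xx M Z n i j (x, t) - 2 / (3 * (g (norm x))\<^sup>2) * (if i = j then 1 else 0)\<bar>)
        \<longlonglongrightarrow> 0) \<and>
     (\<forall>i. (\<lambda>n. SUP (x, t)\<in>{x. norm x \<in> S} \<times> {0..}. ereal (cov_xt M Z n i (x, t)))
        \<longlonglongrightarrow> 0) \<and>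
     (\<lambda>n. SUP (x, t)\<in>{x. norm x \<in> S} \<times> {0..}. ereal (cov_tt M Z n (x, t))) \<longlonglongrightarrow> 0"
proof -
  let ?D = "radial_dom hm hp" and ?J = "radial_int hm hp"
  obtain U' g' g0 where med: "medium m E ?D ?J U U' g g' g0" and hm: "0 \<le> hm" and cvx: "convex ?D"
    and other: "\<And>r. r \<in> ?D \<Longrightarrow> \<exists>b\<in>?D. b \<noteq> r"
    using admissible_imp_medium[OF medium] by metis
  interpret CR: compact_radii m E ?D ?J U U' g g' g0 S
    using med S(1,2) by (intro compact_radii.intro compact_radii_axioms.intro)
  let ?I = "{x :: real^3. norm x \<in> S} \<times> {0::real..}"
  have flight: "flight m E ?D ?J U U' g g' g0 S n x t y (state_space hm hp) (M n (x, t)) (Z n (x, t))"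
    if n: "n \<ge> 1" and p: "(x, t) \<in> ?I" for n x t
  proof (intro flight.intro flight_axioms.intro)
    show "compact_radii m E ?D ?J U U' g g' g0 S" by unfold_locales
    have xJ: "norm x \<in> ?J" using p S(2) by auto
    then show "markov_chain_from (state_space hm hp) (transition_op m E U g y n) (x, t) (M n (x, t)) (Z n (x, t))"
      using p by (intro chain n) auto
    fix u :: "real^3" assume u: "norm u = 1"
    show "is_trajectory m ?D (scaled_potential U n) x (scaled_speed m E U n (norm x) *\<^sub>R u)
        (y n x (scaled_speed m E U n (norm x) *\<^sub>R u))"
    proof (rule trajectories[OF n])
      show "norm x \<in> ?D" using xJ CR.J(2) by blast
      show "x \<noteq> 0" using CR.J_pos[OF xJ] by auto
      show "norm (scaled_speed m E U n (norm x) *\<^sub>R u) = scaled_speed m E U n (norm x)"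
        using CR.spd_pos[OF xJ] u by (simp add: scaled_speed_def)
    qed
  qed (use cvx other n p in auto)
  obtain a where a: "0 < a" "\<forall>(z :: real \<Rightarrow> real^3) p L t. CR.starts z p L \<longrightarrow> 0 \<le> t \<longrightarrow> ennreal (a * t) \<le> CR.ray_depth z t"
    using CR.linear_growth by blast
  have limit: "fst (limit_drift m E hm hp U g x) $ i = flight.xdrift m E U U' g g' x i"
    "snd (limit_drift m E hm hp U g x) = 1 / CR.lam (norm x)"
    if n: "n \<ge> 1" and p: "(x, t) \<in> ?I" for n :: nat and x t i
  proof -
    interpret F: flight m E ?D ?J U U' g g' g0 S n x t y "state_space hm hp" "M n (x, t)" "Z n (x, t)"
      by (rule flight[OF n p])
    have xD: "norm x \<in> ?D" using F.x_facts(1) CR.J(2) by blast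
    have x0: "x \<noteq> 0" using F.x_facts(2) by auto
    obtain b where b: "b \<in> ?D" "b \<noteq> norm x" using other[OF xD] by blast
    have "radial_grad ?D U x = (U' (norm x) / norm x) *\<^sub>R x"
      by (rule radial_grad_eq[OF cvx xD b x0 CR.D_nn CR.U_der[OF xD F.x_facts(2)]])
    moreover have "radial_grad ?D g x = (g' (norm x) / norm x) *\<^sub>R x"
      by (rule radial_grad_eq[OF cvx xD b x0 CR.D_nn
            has_field_derivative_at_within[OF CR.g_der[OF F.x_facts(1)]]])
    ultimately show "fst (limit_drift m E hm hp U g x) $ i = F.xdrift i"
      using F.x_facts by (simp add: limit_drift_def F.xdrift_def field_simps)
    show "snd (limit_drift m E hm hp U g x) = 1 / CR.lam (norm x)"
      by (simp add: limit_drift_def CR.lam_def)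
  qed
  have main: "\<exists>n0. \<forall>n\<ge>n0. \<forall>(x, t)\<in>?I.
      norm (drift M Z n (x, t) - limit_drift m E hm hp U g x) \<le> e \<and>
      (\<forall>i j. \<bar>cov_xx M Z n i j (x, t) - 2 / (3 * (g (norm x))\<^sup>2) * (if i = j then 1 else 0)\<bar> \<le> e) \<and>
      (\<forall>i. \<bar>cov_xt M Z n i (x, t)\<bar> \<le> e) \<and> \<bar>cov_tt M Z n (x, t)\<bar> \<le> e"
    if e: "0 < e" for e
  proof -
    \<comment> \<open>The three spatial components contribute \<open>6 * \<epsilon>\<close>, which
      is half of \<open>e\<close>. Together with the time component they contribute four times
      \<open>K\<close> over \<surd>n, the other half once that quotient is at most
      \<open>e / 8\<close>.\<close>
    define \<epsilon> where "\<epsilon> = e / 12"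
    have \<epsilon>: "0 < \<epsilon>" using e by (simp add: \<epsilon>_def)
    obtain C where C: "0 \<le> C" and expn: "\<forall>(z :: real \<Rightarrow> real^3) p L t. CR.starts z p L \<longrightarrow> 0 \<le> t \<longrightarrow> CR.ray_depth z t < \<infinity> \<longrightarrow>
        CR.expansion \<epsilon> C z p t (enn2real (CR.ray_depth z t))"
      using CR.uniform_expansion[where 'a="real^3", OF \<epsilon>] by blast
    define K where "K = 6 * C + 12 / g0 * (\<epsilon> + C / 2) + 48 / g0 * C + 2 / (a * g0) + 2 / a\<^sup>2"
    obtain n0 :: nat where n0: "(8 * \<bar>K\<bar> / e)\<^sup>2 \<le> real n0" using real_arch_simple by blast
    have KN: "K / sqrt (real n) \<le> e / 8" if n: "n \<ge> max 1 n0" for n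
    proof -
      have "(8 * \<bar>K\<bar> / e)\<^sup>2 \<le> real n" using n0 n by simp
      then have "8 * \<bar>K\<bar> / e \<le> sqrt (real n)" by (rule real_le_rsqrt)
      then have "\<bar>K\<bar> \<le> e / 8 * sqrt (real n)" using e by (simp add: field_simps)
      then have "\<bar>K\<bar> / sqrt (real n) \<le> e / 8" using n by (simp add: pos_divide_le_eq)
      moreover have "K / sqrt (real n) \<le> \<bar>K\<bar> / sqrt (real n)" by (intro divide_right_mono) auto
      ultimately show ?thesis by linarith
    qed
    let ?P = "\<lambda>n x t. norm (drift M Z n (x, t) - limit_drift m E hm hp U g x) \<le> e \<and>
        (\<forall>i j. \<bar>cov_xx M Z n i j (x, t) - 2 / (3 * (g (norm x))\<^sup>2) * (if i = j then 1 else 0)\<bar> \<le> e) \<and>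
        (\<forall>i. \<bar>cov_xt M Z n i (x, t)\<bar> \<le> e) \<and> \<bar>cov_tt M Z n (x, t)\<bar> \<le> e"
    have pt: "?P n x t" if n: "max 1 n0 \<le> n" and pI: "(x, t) \<in> ?I" for n x t
    proof -
      have n1: "n \<ge> 1" using n by simp
      interpret F: flight m E ?D ?J U U' g g' g0 S n x t y "state_space hm hp" "M n (x, t)" "Z n (x, t)"
        by (rule flight[OF n1 pI])
      note est = F.estimates[OF \<epsilon> C a(1) a(2) expn K_def]
      note vd = F.vector_drift[OF est(1) est(3)]
      define d where "d = drift M Z n (x, t) - limit_drift m E hm hp U g x"
      have di: "fst d $ i = real n * (\<integral>\<omega>. fst (Z n (x, t) 1 \<omega>) $ i - x $ i \<partial>M n (x, t)) - F.xdrift i" for i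
        by (simp only: d_def drift_def fst_diff fst_scaleR vector_minus_component vector_scaleR_component vd(1) limit(1)[OF n1 pI] real_scaleR_def)
      have dt: "snd d = real n * (\<integral>\<omega>. snd (Z n (x, t) 1 \<omega>) - t \<partial>M n (x, t)) - 1 / CR.lam (norm x)"
        by (simp only: d_def drift_def snd_diff snd_scaleR vd(2) limit(2)[OF n1 pI] real_scaleR_def)
      have "norm d \<le> norm (fst d) + norm (snd d)" using norm_Pair_le[of "fst d" "snd d"] by simp
      also have "norm (fst d) \<le> (\<Sum>i\<in>UNIV. \<bar>fst d $ i\<bar>)" by (rule norm_le_l1_cart)
      also have "\<dots> \<le> (\<Sum>i\<in>(UNIV::3 set). 2 * \<epsilon> + K / sqrt (real n))"
        unfolding di by (intro sum_mono est(2))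
      also have "\<dots> = 6 * \<epsilon> + 3 * (K / sqrt (real n))" by simp
      also have "norm (snd d) \<le> K / sqrt (real n)" unfolding dt real_norm_def by (rule est(4))
      finally have "norm d \<le> 6 * \<epsilon> + 4 * (K / sqrt (real n))" by simp
      also have "\<dots> \<le> e" using KN[OF n] unfolding \<epsilon>_def by linarith
      finally have 1: "norm d \<le> e" .
      have Ke: "K / sqrt (real n) \<le> e" using KN[OF n] e by linarith
      have 2: "\<bar>cov_xx M Z n i j (x, t) - 2 / (3 * (g (norm x))\<^sup>2) * (if i = j then 1 else 0)\<bar> \<le> e" for i j
        unfolding cov_xx_def fst_conv snd_conv by (rule order_trans[OF est(5) Ke])
      have 3: "\<bar>cov_xt M Z n i (x, t)\<bar> \<le> e" for i
        unfolding cov_xt_def fst_conv snd_conv by (rule order_trans[OF est(6) Ke])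
      have 4: "\<bar>cov_tt M Z n (x, t)\<bar> \<le> e"
        unfolding cov_tt_def fst_conv snd_conv by (rule order_trans[OF est(7) Ke])
      show ?thesis using 1 2 3 4 unfolding d_def by blast
    qed
    show ?thesis
    proof (intro exI[of _ "max 1 n0"] allI impI ballI)
      fix n p assume n: "max 1 n0 \<le> n" and p: "p \<in> ?I"
      obtain x t where xt: "p = (x, t)" by (cases p)
      show "case p of (x, t) \<Rightarrow> ?P n x t" unfolding xt prod.case by (rule pt[OF n p[unfolded xt]])
    qed
  qed
  have I: "?I \<noteq> {}"
  proof -
    \<comment> \<open>Every nonnegative radius is the norm of a vector, so the index set of the
      suprema is nonempty.\<close>
    obtain r where r: "r \<in> S" using S(3) by blast
    then have "0 \<le> r" using S(2) CR.J_pos by (meson less_imp_le subsetD)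
    then obtain x :: "real^3" where "norm x = r" using vector_choose_size by blast
    then have "(x, 0::real) \<in> ?I" using r by simp
    then show ?thesis by blast
  qed
  have conv: "(\<lambda>n. SUP (x, t)\<in>?I. ereal (f n x t)) \<longlonglongrightarrow> 0"
    if f: "\<And>e. 0 < e \<Longrightarrow> \<exists>n0. \<forall>n\<ge>n0. \<forall>(x, t)\<in>?I. \<bar>f n x t\<bar> \<le> e" for f :: "nat \<Rightarrow> real^3 \<Rightarrow> real \<Rightarrow> real"
    using SUP_tendsto_zero[OF I, of "\<lambda>n (x, t). f n x t"] f by (simp add: case_prod_beta)
  show ?thesis
  proof (intro conjI allI conv)
    fix e :: real assume e: "0 < e"
    obtain n0 where n0: "\<forall>n\<ge>n0. \<forall>(x, t)\<in>?I.
      norm (drift M Z n (x, t) - limit_drift m E hm hp U g x) \<le> e \<and>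
      (\<forall>i j. \<bar>cov_xx M Z n i j (x, t) - 2 / (3 * (g (norm x))\<^sup>2) * (if i = j then 1 else 0)\<bar> \<le> e) \<and>
      (\<forall>i. \<bar>cov_xt M Z n i (x, t)\<bar> \<le> e) \<and> \<bar>cov_tt M Z n (x, t)\<bar> \<le> e"
      using main[OF e] by blast
    have imp: "\<exists>n0. \<forall>n\<ge>n0. \<forall>(x, t)\<in>?I. Q n x t"
      if Q: "\<And>n x t. n \<ge> n0 \<Longrightarrow> (x, t) \<in> ?I \<Longrightarrow> Q n x t" for Q
    proof (intro exI[of _ n0] allI impI ballI)
      fix n p assume n: "n0 \<le> n" and p: "p \<in> ?I"
      obtain x t where xt: "p = (x, t)" by (cases p)
      show "case p of (x, t) \<Rightarrow> Q n x t" unfolding xt prod.case by (rule Q[OF n p[unfolded xt]])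
    qed
    have all: "norm (drift M Z n (x, t) - limit_drift m E hm hp U g x) \<le> e"
      "\<bar>cov_xx M Z n i j (x, t) - 2 / (3 * (g (norm x))\<^sup>2) * (if i = j then 1 else 0)\<bar> \<le> e"
      "\<bar>cov_xt M Z n i (x, t)\<bar> \<le> e" "\<bar>cov_tt M Z n (x, t)\<bar> \<le> e"
      if "n \<ge> n0" "(x, t) \<in> ?I" for n x t i j
      using n0 that by blast+
    show "\<exists>n0. \<forall>n\<ge>n0. \<forall>(x, t)\<in>?I. \<bar>norm (drift M Z n (x, t) - limit_drift m E hm hp U g x)\<bar> \<le> e"
      unfolding abs_norm_cancel by (rule imp[OF all(1)])
    show "\<exists>n0. \<forall>n\<ge>n0. \<forall>(x, t)\<in>?I. \<bar>\<bar>cov_xx M Z n i j (x, t) - 2 / (3 * (g (norm x))\<^sup>2) * (if i = j then 1 else 0)\<bar>\<bar> \<le> e" for i j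
      unfolding abs_idempotent by (rule imp[OF all(2)])
    show "\<exists>n0. \<forall>n\<ge>n0. \<forall>(x, t)\<in>?I. \<bar>cov_xt M Z n i (x, t)\<bar> \<le> e" for i
      by (rule imp[OF all(3)])
    show "\<exists>n0. \<forall>n\<ge>n0. \<forall>(x, t)\<in>?I. \<bar>cov_tt M Z n (x, t)\<bar> \<le> e"
      by (rule imp[OF all(4)])
  qed
qed

end
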